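(* Let $p\ge 5$ be a prime, let $s$ be an integer with $0<s<\frac p2$, let $k$ be an integer with $0\le k<p$, and let $s_p=\frac{p^2-1}{24}$. Define $M_p(s,k)$ by $$\sum_{n\ge 0}\bigl(M_\omega(s,p,pn+k)-M_\omega(p-s,p,pn+k)\bigr)q^n=\sum_{r=1}^{p-1}\frac{p-2r}{2p}D_C(r-s,p,k)+M_p(s,k).$$ Then $$\frac{(q,q^{p-1};q^p)_\infty^2}{q\,(q^p;q^p)_\infty^3}\,G_p^{\,k+s_p+1}\,M_p(s,k),\qquad G_p=\frac{(q^{(p-1)/2},q^{(p+1)/2};q^p)_\infty}{(q^{(p-3)/2},q^{(p+3)/2};q^p)_\infty},$$ is a modular function on $\Gamma_1(p)$.
   Context: Throughout $q=e^{2\pi i\tau}$ with $\tau$ in the upper half-plane $\mathbb H$. $(a;q)_\infty=\prod_{n\ge0}(1-aq^n)$, $(q)_\infty=(q;q)_\infty$ and $(a_1,\dots,a_m;q)_\infty=\prod_i(a_i;q)_\infty$. For a partition $\pi$, let $\omega(\pi)$ be the number of ones in $\pi$. The crank of $\pi$ is the largest part if $\omega(\pi)=0$, and otherwise the number of parts larger than $\omega(\pi)$ minus $\omega(\pi)$. $M_\omega(r,m,n)=\sum_{\pi\vdash n,\ \mathrm{crank}(\pi)\equiv r\,(\mathrm{mod}\,m)}\omega(\pi)$. $M(m,n)$ is the number of partitions of $n$ with crank $m$, with the usual convention for $n\le1$ that makes the generating function identity $$\sum_{n\ge0}\sum_{m\in\mathbb Z}M(m,n)z^mq^n=\frac{(q)_\infty}{(zq;q)_\infty(z^{-1}q;q)_\infty}$$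 hold (so $M(0,0)=1$, $M(0,1)=-1$, $M(1,1)=M(-1,1)=1$, other values for $n\le 1$ being $0$). $M(a,M,n)=\sum_{m\equiv a\,(\mathrm{mod}\,M)}M(m,n)$, $p(n)$ is the number of partitions of $n$, and $$D_C(a,M,k)=\sum_{n=0}^\infty\Bigl(M(a,M,Mn+k)-\frac{p(Mn+k)}{M}\Bigr)q^n .$$ $\Gamma_1(p)$ is the group of matrices $\begin{pmatrix}a&b\\c&d\end{pmatrix}\in\mathrm{SL}_2(\mathbb Z)$ with $c\equiv0$, $a\equiv d\equiv1\pmod p$. A modular function on $\Gamma_1(p)$ (with trivial multiplier system) is a function $f$ meromorphic on $\mathbb H$ with $f\left(\frac{a\tau+b}{c\tau+d}\right)=f(\tau)$ for all $\begin{pmatrix}a&b\\c&d\end{pmatrix}\in\Gamma_1(p)$ and such that $f$ is meromorphic at every cusp, i.e. for every $\gamma\in\mathrm{SL}_2(\mathbb Z)$ the expansion of $f(\gamma\tau)$ in fractional powers of $q$ has only finitely many negative exponents. *)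

theory Defs
  imports
    "HOL-Complex_Analysis.Complex_Analysis"
    "HOL-Library.Multiset"
    "HOL-Number_Theory.Number_Theory"
begin

definition partitions :: "nat \<Rightarrow> nat multiset set" where
  "partitions n = {\<pi>. 0 \<notin># \<pi> \<and> sum_mset \<pi> = n}"

definition num_partitions :: "nat \<Rightarrow> nat" where
  "num_partitions n = card (partitions n)"

definition ones :: "nat multiset \<Rightarrow> nat" where
  "ones \<pi> = count \<pi> 1"

text \<open>The inserted 0 only matters for the empty partition, whose largest part is taken to be 0.\<close>

definition largest_part :: "nat multiset \<Rightarrow> nat" where
  "largest_part \<pi> = Max (insert 0 (set_mset \<pi>))"

definition crank :: "nat multiset \<Rightarrow> int" where
  "crank \<pi> =
     (if ones \<pi> = 0 then int (largest_part \<pi>)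
      else int (size {#j \<in># \<pi>. j > ones \<pi>#}) - int (ones \<pi>))"

text \<open>
  In \<open>crank_ones\<close> the crank is the combinatorial one for every \<open>n\<close>; the modified values for
  \<open>n \<le> 1\<close> that make the product formula for the crank generating function hold are used only
  in \<open>crank_count\<close>.
\<close>

definition crank_ones :: "int \<Rightarrow> nat \<Rightarrow> nat \<Rightarrow> nat" where
  "crank_ones r m n = (\<Sum>\<pi> | \<pi> \<in> partitions n \<and> [crank \<pi> = r] (mod int m). ones \<pi>)"

definition crank_count :: "int \<Rightarrow> nat \<Rightarrow> int" where
  "crank_count m n =
     (if n = 0 then (if m = 0 then 1 else 0)
      else if n = 1 then (if m = 0 then - 1 else if m = 1 \<or> m = - 1 then 1 else 0)
      else int (card {\<pi> \<in> partitions n. crank \<pi> = m}))"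

text \<open>
  For each \<open>n\<close> only finitely many \<open>m\<close> have \<open>crank_count m n \<noteq> 0\<close>; restricting to the support
  keeps the index set of the sum finite.
\<close>

definition crank_count_mod :: "int \<Rightarrow> nat \<Rightarrow> nat \<Rightarrow> int" where
  "crank_count_mod a M n =
     (\<Sum>m | [m = a] (mod int M) \<and> crank_count m n \<noteq> 0. crank_count m n)"

text \<open>All series and products below are meant for \<open>norm q < 1\<close>, where they converge absolutely.\<close>

definition qpoch :: "complex \<Rightarrow> complex \<Rightarrow> complex" where
  "qpoch a q = (\<Prod>n. 1 - a * q ^ n)"

definition qpochs :: "complex list \<Rightarrow> complex \<Rightarrow> complex" where
  "qpochs as q = (\<Prod>a\<leftarrow>as. qpoch a q)"

definition crank_deviation :: "int \<Rightarrow> nat \<Rightarrow> nat \<Rightarrow> complex \<Rightarrow> complex" where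
  "crank_deviation a M k q =
     (\<Sum>n. (of_int (crank_count_mod a M (M * n + k))
             - of_nat (num_partitions (M * n + k)) / of_nat M) * q ^ n)"

text \<open>
  The function \<open>M\<^sub>p(s,k)\<close>, i.e. the solution of the defining equation
  \<open>(\<Sum>n. (M\<^sub>\<omega>(s,p,pn+k) - M\<^sub>\<omega>(p-s,p,pn+k)) q^n)
    = (\<Sum>r=1..p-1. (p-2r)/(2p) D\<^sub>C(r-s,p,k)) + M\<^sub>p(s,k)\<close>.
\<close>

definition crank_ones_remainder :: "nat \<Rightarrow> nat \<Rightarrow> nat \<Rightarrow> complex \<Rightarrow> complex" where
  "crank_ones_remainder p s k q =
     (\<Sum>n. (of_nat (crank_ones (int s) p (p * n + k))
             - of_nat (crank_ones (int p - int s) p (p * n + k))) * q ^ n)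
     - (\<Sum>r = 1..p - 1. (of_nat p - 2 * of_nat r) / (2 * of_nat p)
                           * crank_deviation (int r - int s) p k q)"

definition G_quot :: "nat \<Rightarrow> complex \<Rightarrow> complex" where
  "G_quot p q =
     qpochs [q ^ ((p - 1) div 2), q ^ ((p + 1) div 2)] (q ^ p)
       / qpochs [q ^ ((p - 3) div 2), q ^ ((p + 3) div 2)] (q ^ p)"

definition upper_half_plane :: "complex set" where
  "upper_half_plane = {\<tau>. Im \<tau> > 0}"

definition nome :: "complex \<Rightarrow> complex" where
  "nome \<tau> = exp (2 * of_real pi * \<i> * \<tau>)"

definition SL2Z :: "(int ^ 2 ^ 2) set" where
  "SL2Z = {A. det A = 1}"

definition Gamma1 :: "nat \<Rightarrow> (int ^ 2 ^ 2) set" where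
  "Gamma1 N = {A \<in> SL2Z. [A $ 2 $ 1 = 0] (mod int N) \<and>
                 [A $ 1 $ 1 = 1] (mod int N) \<and> [A $ 2 $ 2 = 1] (mod int N)}"

definition mat_act :: "int ^ 2 ^ 2 \<Rightarrow> complex \<Rightarrow> complex" where
  "mat_act A = moebius (of_int (A $ 1 $ 1)) (of_int (A $ 1 $ 2))
                       (of_int (A $ 2 $ 1)) (of_int (A $ 2 $ 2))"

text \<open>
  \<open>f\<close> has, near \<open>\<i>\<infinity>\<close>, an expansion in powers of \<open>q^(1/N)\<close> for some \<open>N > 0\<close> with only
  finitely many negative exponents. It is required only for large imaginary part, since \<open>f\<close> may
  have poles in the upper half-plane.
\<close>

definition meromorphic_at_infinity :: "(complex \<Rightarrow> complex) \<Rightarrow> bool" where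
  "meromorphic_at_infinity f \<longleftrightarrow>
     (\<exists>N::nat. N > 0 \<and> (\<exists>(n0::int) (c::int \<Rightarrow> complex) (y::real). \<forall>\<tau>. Im \<tau> > y \<and> Im \<tau> > 0 \<longrightarrow>
        ((\<lambda>n. c n * nome (of_int n * \<tau> / of_nat N)) has_sum f \<tau>) {n0..}))"

text \<open>
  A meromorphic function is represented by its canonical total function
  (\<open>nicely_meromorphic_on\<close>: removable singularities removed, value 0 at poles), so that the
  transformation law can be stated pointwise.
\<close>

definition modular_function_Gamma1 :: "nat \<Rightarrow> (complex \<Rightarrow> complex) \<Rightarrow> bool" where
  "modular_function_Gamma1 N f \<longleftrightarrow>
     f nicely_meromorphic_on upper_half_plane \<and>
     (\<forall>A\<in>Gamma1 N. \<forall>\<tau>\<in>upper_half_plane. f (mat_act A \<tau>) = f \<tau>) \<and>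
     (\<forall>A\<in>SL2Z. meromorphic_at_infinity (\<lambda>\<tau>. f (mat_act A \<tau>)))"

end

theory Submission
  imports Defs
begin

text \<open>
  The part of the crank generating function that is weighted by the number of ones is found by
  differentiating the \<open>q\<close>-binomial theorem. On \<open>p\<close>-th roots of unity its odd part is
  \<open>C(z; q)\<close> times the logarithmic derivative of the theta function, up to the elementary term
  \<open>(1 + z) / (2 (1 - z))\<close>, whose finite Fourier coefficients \<open>(p - 2r) / (2p)\<close>
  produce exactly the subtracted combination of crank deviations. Hence the remainder
  \<open>M\<^sub>p(s, k)\<close> is a \<open>p\<close>-dissection of a combination of \<open>\<kappa>' / \<kappa>\<^sup>2\<close> at \<open>p\<close>-division points,
  divided by the Euler product, where \<open>\<kappa> = \<theta> / \<theta>'(0)\<close>.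

  The normalised theta function \<open>\<kappa>\<close> transforms under the modular group without a multiplier
  system, by Liouville's theorem. All factors, including the quotient
  \<open>\<eta>(p\<^sup>2 \<tau>) / \<eta>(\<tau>)\<close>, are products of division values of \<open>\<kappa>\<close>, so their characters
  on \<open>\<Gamma>\<^sub>1(p)\<close> are explicit roots of unity, and these cancel. At the cusps it is enough that the
  function is bounded by \<open>exp (K (1 + Im \<tau> + 1 / Im \<tau>))\<close>.
\<close>

section \<open>q-Pochhammer symbols\<close>

text \<open>For a matrix \<open>(a, b; c, d)\<close> in \<open>Gamma1 p\<close> put
  \<open>e = nome (b / p)\<close>. The dissection sums over the points
  \<open>(\<tau> + l) / p\<close>, which the matrix permutes through matrices whose lower left entry
  is divisible by \<open>p\<^sup>2\<close>. Every undissected ingredient is therefore studied on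
  that smaller group, where the eta quotient and the division values \<open>kappa\<close>,
  \<open>kappa'\<close> have trivial character. The permutation of the summands leaves weight 2 and
  the character \<open>e ^ (k + s_p)\<close>. The square of the Klein form of index 1 contributes
  weight -2 and \<open>e\<close>, and each quotient of Klein forms in \<open>G_quot\<close>
  contributes weight 0 and \<open>inverse e\<close>: this balance forces the exponent
  \<open>k + s_p + 1\<close>. The same count for powers of \<open>nome (\<tau> / p)\<close> explains
  the factor \<open>1 / q\<close>. The Euler product in \<open>nome (p\<^sup>2 \<tau>)\<close> is
  introduced because at all the points \<open>(\<tau> + l) / p\<close> it becomes the same function,
  the Euler product in \<open>q ^ p\<close>; it can thus be taken out of the dissection, while
  together with the denominator of the crank generating function it forms an eta quotient.\<close>

lemma qpoch_summable:
  fixes a q :: complex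
  assumes "norm q < 1"
  shows "summable (\<lambda>n. norm (a * q ^ n))"
  using assms by (auto simp: norm_mult norm_power intro!: summable_mult summable_geometric)

lemma qpoch_convergent_prod:
  fixes a q :: complex
  assumes "norm q < 1"
  shows "convergent_prod (\<lambda>n. 1 - a * q ^ n)"
proof -
  have "abs_convergent_prod (\<lambda>n. 1 - a * q ^ n)"
    using qpoch_summable[OF assms, of a] by (simp add: abs_convergent_prod_conv_summable norm_minus_commute)
  thus ?thesis by (rule abs_convergent_prod_imp_convergent_prod)
qed

lemma qpoch_has_prod:
  assumes "norm q < 1"
  shows "(\<lambda>n. 1 - a * q ^ n) has_prod qpoch a q"
  using qpoch_convergent_prod[OF assms] unfolding qpoch_def by (rule convergent_prod_has_prod)

lemma qpoch_tendsto:
  assumes "norm q < 1"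
  shows "(\<lambda>n. \<Prod>i<n. 1 - a * q ^ i) \<longlonglongrightarrow> qpoch a q"
  using has_prod_imp_tendsto'[OF qpoch_has_prod[OF assms]] .

lemma qpoch_rec:
  assumes "norm q < 1"
  shows "qpoch a q = (1 - a) * qpoch (a * q) q"
proof -
  have "(\<lambda>n. \<Prod>i<Suc n. 1 - a * q ^ i) \<longlonglongrightarrow> qpoch a q"
    using qpoch_tendsto[OF assms, of a] by (rule filterlim_compose) (rule filterlim_Suc)
  moreover have "(\<lambda>n. \<Prod>i<Suc n. 1 - a * q ^ i) = (\<lambda>n. (1 - a) * (\<Prod>i<n. 1 - (a * q) * q ^ i))"
    by (subst prod.lessThan_Suc_shift) (simp add: mult.assoc)
  moreover have "(\<lambda>n. (1 - a) * (\<Prod>i<n. 1 - (a * q) * q ^ i)) \<longlonglongrightarrow> (1 - a) * qpoch (a * q) q"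
    by (intro tendsto_intros qpoch_tendsto assms)
  ultimately show ?thesis using LIMSEQ_unique by metis
qed

lemma qpoch_nonzero:
  assumes "norm q < 1" "\<And>n. a * q ^ n \<noteq> 1"
  shows "qpoch a q \<noteq> 0"
  unfolding qpoch_def by (rule prodinf_nonzero) (use qpoch_convergent_prod assms in auto)

lemma qpoch_nonzero':
  assumes "norm q < 1" "norm a < 1"
  shows "qpoch a q \<noteq> 0"
proof (rule qpoch_nonzero[OF assms(1)])
  fix n
  have "norm (a * q ^ n) \<le> norm a * 1"
    unfolding norm_mult norm_power using assms by (intro mult_left_mono power_le_one) auto
  thus "a * q ^ n \<noteq> 1" using assms by auto
qed

lemma qpoch_0 [simp]: "qpoch 0 q = 1"
  by (simp add: qpoch_def)

text \<open>Each factor is at most the exponential of \<open>norm (a * q ^ i)\<close>, and these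
  exponents form a geometric series.\<close>

lemma qpoch_norm_le:
  assumes "norm q < 1"
  shows "norm (qpoch a q) \<le> exp (norm a / (1 - norm q))"
proof (rule LIMSEQ_le_const2[OF tendsto_norm[OF qpoch_tendsto[OF assms, of a]]])
  have "norm (\<Prod>i<n. 1 - a * q ^ i) \<le> exp (norm a / (1 - norm q))" for n
  proof -
    have "norm (\<Prod>i<n. 1 - a * q ^ i) \<le> (\<Prod>i<n. 1 + norm (a * q ^ i))"
      unfolding prod_norm[symmetric]
      using norm_triangle_ineq4[of "1 :: complex" "a * q ^ _"] by (intro prod_mono) auto
    also have "\<dots> \<le> exp (\<Sum>i<n. norm (a * q ^ i))"
      by (rule prod_le_exp_sum) auto
    also have "(\<Sum>i<n. norm (a * q ^ i)) \<le> (\<Sum>i. norm (a * q ^ i))"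
      by (intro sum_le_suminf qpoch_summable assms) auto
    also have "(\<Sum>i. norm (a * q ^ i)) = norm a / (1 - norm q)"
      using assms by (simp add: norm_mult norm_power suminf_mult summable_geometric suminf_geometric)
    finally show ?thesis by simp
  qed
  thus "\<exists>N. \<forall>n\<ge>N. norm (\<Prod>i<n. 1 - a * q ^ i) \<le> exp (norm a / (1 - norm q))" by blast
qed

text \<open>Both the argument and the base may vary, since later \<open>q\<close> itself is a
  function of \<open>\<tau>\<close>. The reason is locally uniform convergence of the partial
  products.\<close>

lemma qpoch_holomorphic [holomorphic_intros]:
  assumes "a holomorphic_on A" "q holomorphic_on A" "open A" "\<And>t. t \<in> A \<Longrightarrow> norm (q t) < 1"
  shows "(\<lambda>t. qpoch (a t) (q t)) holomorphic_on A"
proof (rule holomorphic_uniform_sequence[OF assms(3)])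
  show "(\<lambda>t. \<Prod>i<n. 1 - a t * q t ^ i) holomorphic_on A" for n
    by (intro holomorphic_intros assms)
next
  fix t assume "t \<in> A"
  then obtain d where d: "d > 0" "cball t d \<subseteq> A"
    using assms(3) open_contains_cball by blast
  have contq: "continuous_on (cball t d) q" and conta: "continuous_on (cball t d) a"
    using holomorphic_on_imp_continuous_on assms(1,2) d(2) continuous_on_subset by blast+
  \<comment> \<open>The maximum of \<open>norm (q y)\<close> on the closed disc is attained, so it
    is less than 1 and can serve as the ratio of one geometric majorant for the whole disc.\<close>
  have "compact ((\<lambda>x. norm (q x)) ` cball t d)" "(\<lambda>x. norm (q x)) ` cball t d \<noteq> {}"
    using d by (auto intro!: compact_continuous_image continuous_intros contq)
  then obtain x where x: "x \<in> cball t d" "\<And>y. y \<in> cball t d \<Longrightarrow> norm (q y) \<le> norm (q x)"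
    using compact_attains_sup[of "(\<lambda>x. norm (q x)) ` cball t d"] by auto
  have x1: "norm (q x) < 1" using x d assms(4) by auto
  have "bounded (a ` cball t d)"
    by (intro compact_imp_bounded compact_continuous_image conta) auto
  then obtain B where B: "\<And>y. y \<in> cball t d \<Longrightarrow> norm (a y) \<le> B"
    unfolding bounded_iff by blast
  have "uniformly_convergent_on (cball t d) (\<lambda>N x. \<Prod>n<N. 1 - a x * q x ^ n)"
  proof (rule uniformly_convergent_on_prod')
    show "continuous_on (cball t d) (\<lambda>x. 1 - a x * q x ^ n)" for n
      by (intro continuous_intros conta contq)
    have "uniformly_convergent_on (cball t d) (\<lambda>N y. \<Sum>n<N. norm (a y * q y ^ n))"
    proof (rule Weierstrass_m_test')
      fix n y assume y: "y \<in> cball t d"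
      have "norm (q y) \<le> norm (q x)" "norm (a y) \<le> B" "0 \<le> B"
        using x(2) y B[OF y] norm_ge_zero order_trans by blast+
      thus "norm (norm (a y * q y ^ n)) \<le> B * norm (q x) ^ n"
        by (auto simp: norm_mult norm_power intro!: mult_mono power_mono)
    next
      show "summable (\<lambda>n. B * norm (q x) ^ n)"
        using x1 by (intro summable_mult summable_geometric) auto
    qed
    thus "uniformly_convergent_on (cball t d) (\<lambda>N x. \<Sum>n<N. norm (1 - a x * q x ^ n - 1))"
      by simp
  qed auto
  then obtain g where g: "uniform_limit (cball t d) (\<lambda>N x. \<Prod>n<N. 1 - a x * q x ^ n) g sequentially"
    unfolding uniformly_convergent_on_def by auto
  have "g y = qpoch (a y) (q y)" if "y \<in> cball t d" for y
    using tendsto_uniform_limitI[OF g that] qpoch_tendsto[of "q y" "a y"] LIMSEQ_unique that d assms(4)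
    by blast
  hence "uniform_limit (cball t d) (\<lambda>N x. \<Prod>n<N. 1 - a x * q x ^ n) (\<lambda>t. qpoch (a t) (q t)) sequentially"
    using uniform_limit_cong'[of "cball t d" "\<lambda>N x. \<Prod>n<N. 1 - a x * q x ^ n" "\<lambda>N x. \<Prod>n<N. 1 - a x * q x ^ n" g "\<lambda>t. qpoch (a t) (q t)"] g by blast
  thus "\<exists>d>0. cball t d \<subseteq> A \<and> uniform_limit (cball t d) (\<lambda>N x. \<Prod>n<N. 1 - a x * q x ^ n) (\<lambda>t. qpoch (a t) (q t)) sequentially"
    using d by blast
qed

text \<open>The geometric sum in \<open>1 - r ^ m = (1 - r) * (1 + ... + r ^ (m - 1))\<close> has
  \<open>m\<close> terms, each at least \<open>r ^ m\<close>. In the logarithm of an Euler product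
  this trades \<open>r ^ m / (1 - r ^ m)\<close> for \<open>1 / (m * (1 - r))\<close>; the remaining
  sum over \<open>1 / m ^ 2\<close> is the source of the constant
  \<open>pi\<^sup>2 / 6\<close>.\<close>

lemma one_minus_power_ge:
  fixes r :: real
  assumes "0 \<le> r" "r \<le> 1"
  shows "real m * (1 - r) * r ^ m \<le> 1 - r ^ m"
proof -
  have "real m * r ^ m = (\<Sum>i<m. r ^ m)" by simp
  also have "\<dots> \<le> (\<Sum>i<m. r ^ i)"
    using assms by (intro sum_mono power_decreasing) auto
  finally have "(1 - r) * (real m * r ^ m) \<le> (1 - r) * (\<Sum>i<m. r ^ i)"
    using assms by (intro mult_left_mono) auto
  thus ?thesis by (simp add: one_diff_power_eq mult_ac)
qed

text \<open>
  The logarithm of the partial product is expanded and summed over \<open>n\<close> first; this gives the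
  exponent \<open>O(1 / (1 - r))\<close>, whereas estimating the factors one by one would lose a logarithm.
\<close>

lemma prod_one_minus_power_ge:
  fixes r :: real
  assumes "0 < r" "r < 1"
  shows "(\<Prod>n<N. 1 - r ^ Suc n) \<ge> exp (- (pi\<^sup>2 / 6) / (1 - r))"
proof -
  have s: "(\<lambda>m. (r ^ Suc n) ^ Suc m / real (Suc m)) sums (- ln (1 - r ^ Suc n))" for n
  proof -
    have r: "r ^ Suc n < 1" "r ^ Suc n > 0" using power_Suc_less_one[of r n] assms by auto
    have "(\<lambda>m. - ((- (- (r ^ Suc n))) ^ m) / of_nat m) sums ln (1 + (- (r ^ Suc n)))"
      using r by (intro ln_series') auto
    hence "(\<lambda>m. - ((r ^ Suc n) ^ m / real m)) sums ln (1 - (r ^ Suc n))"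
      by simp
    from sums_minus[OF this] have "(\<lambda>m. (r ^ Suc n) ^ m / real m) sums (- ln (1 - r ^ Suc n))" by simp
    thus ?thesis using sums_Suc_iff[of "\<lambda>m. (r ^ Suc n) ^ m / real m"] by simp
  qed
  have pr: "1 - r ^ Suc n > 0" for n using power_Suc_less_one[of r n] assms by simp
  have "- ln (\<Prod>n<N. 1 - r ^ Suc n) = (\<Sum>n<N. - ln (1 - r ^ Suc n))"
    using pr by (subst ln_prod) (simp_all add: sum_negf less_imp_neq[symmetric] del: power_Suc)
  also have "\<dots> = (\<Sum>n<N. \<Sum>m. (r ^ Suc n) ^ Suc m / real (Suc m))"
    using s by (intro sum.cong) (auto simp: sums_iff)
  also have "\<dots> = (\<Sum>m. \<Sum>n<N. (r ^ Suc n) ^ Suc m / real (Suc m))"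
    by (rule suminf_sum[symmetric]) (use s in \<open>auto simp: sums_iff\<close>)
  also have "\<dots> \<le> (\<Sum>m. 1 / (1 - r) * (1 / real (Suc m) ^ 2))"
  proof (rule suminf_le)
    fix m
    let ?x = "r ^ Suc m"
    have x: "0 < ?x" "?x < 1" using power_Suc_less_one[of r m] assms by auto
    have "(\<Sum>n<N. ?x ^ Suc n) = ?x * (\<Sum>n<N. ?x ^ n)" by (simp add: sum_distrib_left)
    also have "\<dots> \<le> ?x * (1 / (1 - ?x))"
    proof (intro mult_left_mono)
      have "(\<Sum>n<N. ?x ^ n) \<le> (\<Sum>n. ?x ^ n)" using x by (intro sum_le_suminf summable_geometric) auto
      thus "(\<Sum>n<N. ?x ^ n) \<le> 1 / (1 - ?x)" using x by (simp add: suminf_geometric)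
    qed (use x in auto)
    also have "\<dots> \<le> 1 / (real (Suc m) * (1 - r))"
    proof -
      have "real (Suc m) * (1 - r) * ?x \<le> 1 - ?x" using one_minus_power_ge[of r "Suc m"] assms by simp
      moreover have "real (Suc m) * (1 - r) > 0" using assms by simp
      ultimately show ?thesis using x by (simp add: field_simps)
    qed
    finally have *: "(\<Sum>n<N. ?x ^ Suc n) \<le> 1 / (real (Suc m) * (1 - r))" .
    have "(\<Sum>n<N. (r ^ Suc n) ^ Suc m / real (Suc m)) = (\<Sum>n<N. ?x ^ Suc n) / real (Suc m)"
      unfolding sum_divide_distrib power_mult[symmetric] by (simp only: mult.commute)
    also have "\<dots> \<le> 1 / (real (Suc m) * (1 - r)) / real (Suc m)"
      using * by (intro divide_right_mono) auto
    finally show "(\<Sum>n<N. (r ^ Suc n) ^ Suc m / real (Suc m)) \<le> 1 / (1 - r) * (1 / real (Suc m) ^ 2)"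
      by (simp add: power2_eq_square field_simps)
  next
    show "summable (\<lambda>m. \<Sum>n<N. (r ^ Suc n) ^ Suc m / real (Suc m))"
      by (rule summable_sum) (use s in \<open>auto simp: sums_iff\<close>)
    show "summable (\<lambda>m. 1 / (1 - r) * (1 / real (Suc m) ^ 2))"
      using inverse_squares_sums by (intro summable_mult) (auto simp: sums_iff add.commute)
  qed
  also have "\<dots> = 1 / (1 - r) * (pi\<^sup>2 / 6)"
  proof -
    have "summable (\<lambda>m. 1 / real (Suc m) ^ 2)" "(\<Sum>m. 1 / real (Suc m) ^ 2) = pi\<^sup>2 / 6"
      using inverse_squares_sums by (simp_all add: sums_iff add.commute)
    thus ?thesis by (simp only: suminf_mult)
  qed
  finally have "- ln (\<Prod>n<N. 1 - r ^ Suc n) \<le> 1 / (1 - r) * (pi\<^sup>2 / 6)" .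
  moreover have "1 / (1 - r) * (pi\<^sup>2 / 6) = - (- (pi\<^sup>2 / 6) / (1 - r))" by simp
  ultimately have "ln (\<Prod>n<N. 1 - r ^ Suc n) \<ge> - (pi\<^sup>2 / 6) / (1 - r)" by linarith
  moreover have "(\<Prod>n<N. 1 - r ^ Suc n) > 0" using pr by (intro prod_pos) auto
  ultimately show ?thesis by (metis exp_le_cancel_iff exp_ln)
qed

text \<open>Factor by factor, \<open>norm (1 - a * q ^ i)\<close> is at least
  \<open>1 - r ^ (i + 1)\<close>, so the real Euler product at \<open>r\<close> is a minorant. This
  controls the denominators near the real axis.\<close>

lemma qpoch_norm_ge:
  assumes "norm q \<le> r" "norm a \<le> r" "0 < r" "r < 1"
  shows "norm (qpoch a q) \<ge> exp (- (pi\<^sup>2 / 6) / (1 - r))"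
proof (rule LIMSEQ_le_const[OF tendsto_norm[OF qpoch_tendsto[of q a]]])
  have "norm (\<Prod>i<n. 1 - a * q ^ i) \<ge> exp (- (pi\<^sup>2 / 6) / (1 - r))" for n
  proof -
    have "exp (- (pi\<^sup>2 / 6) / (1 - r)) \<le> (\<Prod>i<n. 1 - r ^ Suc i)"
      using prod_one_minus_power_ge assms by blast
    also have "\<dots> \<le> (\<Prod>i<n. norm (1 - a * q ^ i))"
    proof (intro prod_mono conjI)
      fix i
      have "norm (a * q ^ i) \<le> r * r ^ i"
        unfolding norm_mult norm_power using assms by (intro mult_mono power_mono) auto
      thus "1 - r ^ Suc i \<le> norm (1 - a * q ^ i)"
        using norm_triangle_ineq2[of 1 "a * q ^ i"] by simp
      show "0 \<le> 1 - r ^ Suc i" using power_Suc_less_one[of r i] assms by simp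
    qed
    finally show ?thesis by (simp add: prod_norm)
  qed
  thus "\<exists>N. \<forall>n\<ge>N. exp (- (pi\<^sup>2 / 6) / (1 - r)) \<le> norm (\<Prod>i<n. 1 - a * q ^ i)" by blast
qed (use assms in auto)

section \<open>Generating functions of partitions\<close>

abbreviation msets :: "nat set \<Rightarrow> nat multiset set" where
  "msets S \<equiv> {\<pi>. set_mset \<pi> \<subseteq> S}"

text \<open>A completely multiplicative weight turns a sum over multisets into an Euler product.
  Crank statistics are encoded by \<open>w j = q ^ j\<close>, with an extra \<open>z\<close> on the
  parts to be counted.\<close>

definition mset_weight :: "(nat \<Rightarrow> 'a::comm_monoid_mult) \<Rightarrow> nat multiset \<Rightarrow> 'a" where
  "mset_weight w \<pi> = (\<Prod>j\<in>#\<pi>. w j)"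

lemma mset_weight_empty [simp]: "mset_weight w {#} = 1"
  and mset_weight_add: "mset_weight w (\<pi> + \<rho>) = mset_weight w \<pi> * mset_weight w \<rho>"
  and mset_weight_add_mset [simp]: "mset_weight w (add_mset a \<pi>) = w a * mset_weight w \<pi>"
  and mset_weight_replicate [simp]: "mset_weight w (replicate_mset n a) = w a ^ n"
  by (simp_all add: mset_weight_def)

lemma norm_mset_weight:
  fixes w :: "nat \<Rightarrow> 'a::real_normed_field"
  shows "norm (mset_weight w \<pi>) = mset_weight (\<lambda>j. norm (w j)) \<pi>"
  by (induction \<pi>) (simp_all add: norm_mult)

lemma mset_weight_mult:
  "mset_weight (\<lambda>j. v j * w j) \<pi> = mset_weight v \<pi> * mset_weight w \<pi>"
  by (induction \<pi>) (simp_all add: mult_ac)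

lemma mset_weight_power: "mset_weight (\<lambda>j. x ^ j) \<pi> = x ^ sum_mset \<pi>"
  by (induction \<pi>) (simp_all add: power_add)

lemma msets_insert_bij:
  assumes "a \<notin> S"
  shows "bij_betw (\<lambda>(n, \<sigma>). replicate_mset n a + \<sigma>) (UNIV \<times> msets S) (msets (insert a S))"
proof (rule bij_betwI[where g = "\<lambda>\<pi>. (count \<pi> a, filter_mset (\<lambda>x. x \<noteq> a) \<pi>)"])
  fix x :: "nat \<times> nat multiset" assume "x \<in> UNIV \<times> msets S"
  then obtain n \<sigma> where x: "x = (n, \<sigma>)" "set_mset \<sigma> \<subseteq> S" by auto
  hence "a \<notin># \<sigma>" using assms by auto
  moreover from this have "filter_mset (\<lambda>x. x \<noteq> a) \<sigma> = \<sigma>"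
    by (intro filter_mset_eq_conv[THEN iffD2]) auto
  ultimately show "(case case x of (n, \<sigma>) \<Rightarrow> replicate_mset n a + \<sigma> of \<pi> \<Rightarrow>
      (count \<pi> a, filter_mset (\<lambda>x. x \<noteq> a) \<pi>)) = x"
    using x by (auto simp: not_in_iff)
next
  fix \<pi> assume "\<pi> \<in> msets (insert a S)"
  show "(case (count \<pi> a, filter_mset (\<lambda>x. x \<noteq> a) \<pi>) of (n, \<sigma>) \<Rightarrow> replicate_mset n a + \<sigma>) = \<pi>"
    by (auto intro!: multiset_eqI)
qed (auto split: if_splits)

text \<open>Splitting off the multiplicity of one part gives a geometric series at each induction
  step. Absolute summability is carried along because evaluating the sum over the product set
  iteratively requires it.\<close>

lemma msets_gf_finite:
  fixes w :: "nat \<Rightarrow> 'a::{real_normed_field,banach}"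
  assumes "finite S" "\<And>j. j \<in> S \<Longrightarrow> norm (w j) < 1"
  shows "(mset_weight w has_sum (\<Prod>j\<in>S. 1 / (1 - w j))) (msets S) \<and>
         (\<lambda>\<pi>. norm (mset_weight w \<pi>)) summable_on msets S"
  using assms
proof (induction S rule: finite_induct)
  case empty
  have "msets {} = {{#}}" by auto
  thus ?case by (auto intro: has_sum_finiteI)
next
  case (insert a S)
  have IH: "(mset_weight w has_sum (\<Prod>j\<in>S. 1 / (1 - w j))) (msets S)"
    "(\<lambda>\<pi>. norm (mset_weight w \<pi>)) summable_on msets S"
    using insert by auto
  have a: "norm (w a) < 1" "w a \<noteq> 1" using insert.prems by force+
  define f where "f = (\<lambda>(n, \<sigma>). w a ^ n * mset_weight w \<sigma>)"
  define I where "I = infsum (\<lambda>\<pi>. norm (mset_weight w \<pi>)) (msets S)"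
  have abs: "(\<lambda>x. norm (f x)) summable_on (UNIV \<times> msets S)"
  proof (rule summable_on_SigmaI)
    show "((\<lambda>\<sigma>. norm (f (n, \<sigma>))) has_sum (norm (w a) ^ n * I)) (msets S)" for n
      unfolding f_def I_def using IH(2)
      by (auto simp: norm_mult norm_power intro!: has_sum_cmult_right)
    show "(\<lambda>n. norm (w a) ^ n * I) summable_on UNIV"
      using a by (intro summable_on_cmult_left summable_nonneg_imp_summable_on)
        (auto intro: summable_geometric)
  qed auto
  have hs: "(f has_sum (1 / (1 - w a) * (\<Prod>j\<in>S. 1 / (1 - w j)))) (UNIV \<times> msets S)"
  proof (rule has_sum_SigmaI)
    show "((\<lambda>\<sigma>. f (n, \<sigma>)) has_sum (w a ^ n * (\<Prod>j\<in>S. 1 / (1 - w j)))) (msets S)" for n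
      unfolding f_def using IH(1) by (auto intro!: has_sum_cmult_right)
    have "((\<lambda>n. w a ^ n) has_sum (1 / (1 - w a))) UNIV"
      using a by (intro norm_summable_imp_has_sum geometric_sums)
        (auto simp: norm_power intro: summable_geometric)
    thus "((\<lambda>n. w a ^ n * (\<Prod>j\<in>S. 1 / (1 - w j))) has_sum
            (1 / (1 - w a) * (\<Prod>j\<in>S. 1 / (1 - w j)))) UNIV"
      by (rule has_sum_cmult_left)
    show "f summable_on (UNIV \<times> msets S)" using abs by (rule abs_summable_summable)
  qed
  have feq: "f = (\<lambda>x. mset_weight w (case x of (n, \<sigma>) \<Rightarrow> replicate_mset n a + \<sigma>))"
    by (auto simp: f_def mset_weight_add fun_eq_iff)
  note bij = msets_insert_bij[OF insert.hyps(2)]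
  have "(mset_weight w has_sum (1 / (1 - w a) * (\<Prod>j\<in>S. 1 / (1 - w j)))) (msets (insert a S))"
    using hs unfolding feq has_sum_reindex_bij_betw[OF bij] .
  moreover have "(\<lambda>\<pi>. norm (mset_weight w \<pi>)) summable_on (msets (insert a S))"
    using abs unfolding feq
      summable_on_reindex_bij_betw[OF bij, of "\<lambda>\<pi>. norm (mset_weight w \<pi>)"] .
  ultimately show ?case using insert.hyps by simp
qed

lemma finite_subset_incseq_Union:
  assumes "finite F" "F \<subseteq> (\<Union>n. B n)" "incseq B"
  shows "\<exists>N. F \<subseteq> B N"
  using assms(1,2)
proof (induction F rule: finite_induct)
  case (insert x F)
  then obtain N M where NM: "F \<subseteq> B N" "x \<in> B M" by auto
  have "B N \<subseteq> B (max N M)" "B M \<subseteq> B (max N M)"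
    by (rule incseqD[OF assms(3)], simp)+
  with NM show ?case by blast
qed auto

text \<open>The exhausting sets may be infinite. A finite set that fixes the sum up to
  \<open>e / 2\<close> lies in some \<open>B N\<close>, and the sum over any later
  \<open>B n\<close> is a limit over finite sets containing it.\<close>

lemma has_sum_increasing_limit:
  fixes f :: "'a \<Rightarrow> 'b::banach"
  assumes "f summable_on A" "\<And>n. (f has_sum g n) (B n)" "incseq B" "(\<Union>n. B n) = A" "g \<longlonglongrightarrow> l"
  shows "(f has_sum l) A"
proof -
  obtain s where s: "(f has_sum s) A" using assms(1) by (auto simp: summable_on_def)
  have "g \<longlonglongrightarrow> s"
    unfolding LIMSEQ_def
  proof safe
    fix e :: real assume "e > 0"
    hence "eventually (\<lambda>F. dist (sum f F) s < e / 2) (finite_subsets_at_top A)"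
      using s unfolding has_sum_def tendsto_iff by (auto dest: spec[of _ "e/2"])
    then obtain F where F: "finite F" "F \<subseteq> A"
      "\<And>G. finite G \<Longrightarrow> F \<subseteq> G \<Longrightarrow> G \<subseteq> A \<Longrightarrow> dist (sum f G) s < e / 2"
      unfolding eventually_finite_subsets_at_top by auto
    have "\<exists>N. F \<subseteq> B N"
      by (rule finite_subset_incseq_Union[OF F(1) _ assms(3)]) (use F(2) assms(4) in simp)
    then obtain N where N: "F \<subseteq> B N" by blast
    have "dist (g n) s < e" if "n \<ge> N" for n
    proof -
      have FB: "F \<subseteq> B n" using N incseqD[OF assms(3) that] by auto
      have "eventually (\<lambda>G. finite G \<and> F \<subseteq> G \<and> G \<subseteq> B n) (finite_subsets_at_top (B n))"
        unfolding eventually_finite_subsets_at_top using F(1) FB by auto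
      hence "eventually (\<lambda>G. dist (sum f G) s \<le> e / 2) (finite_subsets_at_top (B n))"
        by eventually_elim (use F(3) assms(4) in \<open>blast intro: less_imp_le\<close>)
      moreover have "((\<lambda>G. dist (sum f G) s) \<longlongrightarrow> dist (g n) s) (finite_subsets_at_top (B n))"
        using assms(2)[of n] unfolding has_sum_def by (intro tendsto_intros)
      ultimately have "dist (g n) s \<le> e / 2"
        by (intro tendsto_upperbound[where F = "finite_subsets_at_top (B n)"]) auto
      thus ?thesis using \<open>e > 0\<close> by simp
    qed
    thus "\<exists>N. \<forall>n\<ge>N. dist (g n) s < e" by blast
  qed
  with assms(5) s show ?thesis using LIMSEQ_unique by blast
qed

text \<open>A multiset is finite, hence supported in some \<open>S \<inter> {..<n}\<close>. The
  bound \<open>K\<close> on the products of norms gives absolute summability, after which the value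
  follows from the partial products alone.\<close>

lemma msets_gf:
  fixes w :: "nat \<Rightarrow> 'a::{real_normed_field,banach}"
  assumes "\<And>j. j \<in> S \<Longrightarrow> norm (w j) < 1"
    and K: "\<And>n. (\<Prod>j\<in>S \<inter> {..<n}. 1 / (1 - norm (w j))) \<le> K"
  shows "(\<lambda>\<pi>. norm (mset_weight w \<pi>)) summable_on msets S"
    and "infsum (\<lambda>\<pi>. norm (mset_weight w \<pi>)) (msets S) \<le> K"
    and "(\<lambda>n. \<Prod>j\<in>S \<inter> {..<n}. 1 / (1 - w j)) \<longlonglongrightarrow> l \<Longrightarrow> (mset_weight w has_sum l) (msets S)"
proof -
  let ?B = "\<lambda>n. msets (S \<inter> {..<n})"
  have inc: "incseq ?B"
  proof (rule incseq_SucI)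
    show "?B n \<subseteq> ?B (Suc n)" for n using less_SucI by blast
  qed
  have Un: "(\<Union>n. ?B n) = msets S"
  proof (intro equalityI subsetI)
    fix \<pi> assume "\<pi> \<in> msets S"
    moreover have "\<exists>n. \<forall>x\<in>set_mset \<pi>. x < n"
      using finite_nat_set_iff_bounded[of "set_mset \<pi>"] by auto
    ultimately show "\<pi> \<in> (\<Union>n. ?B n)" by auto
  qed auto
  have fin: "(mset_weight (\<lambda>j. norm (w j)) has_sum (\<Prod>j\<in>S \<inter> {..<n}. 1 / (1 - norm (w j)))) (?B n)" for n
    using assms(1) by (intro conjunct1[OF msets_gf_finite]) auto
  have le: "sum (\<lambda>\<pi>. norm (mset_weight w \<pi>)) F \<le> K" if F: "finite F" "F \<subseteq> msets S" for F
  proof -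
    have "\<exists>N. F \<subseteq> ?B N"
      by (rule finite_subset_incseq_Union[OF F(1) _ inc]) (use F(2) Un in simp)
    then obtain N where N: "F \<subseteq> ?B N" by blast
    have "sum (mset_weight (\<lambda>j. norm (w j))) F \<le> (\<Prod>j\<in>S \<inter> {..<N}. 1 / (1 - norm (w j)))"
      by (rule finite_sum_le_has_sum[OF fin F(1) N]) (simp add: norm_mset_weight[symmetric])
    also have "\<dots> \<le> K" by (rule K)
    finally show ?thesis by (simp add: norm_mset_weight)
  qed
  show abs: "(\<lambda>\<pi>. norm (mset_weight w \<pi>)) summable_on msets S"
  proof (rule nonneg_bdd_above_summable_on)
    show "bdd_above (sum (\<lambda>\<pi>. norm (mset_weight w \<pi>)) ` {F. F \<subseteq> msets S \<and> finite F})"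
      using le by (intro bdd_aboveI2[where M = K]) auto
  qed auto
  show "infsum (\<lambda>\<pi>. norm (mset_weight w \<pi>)) (msets S) \<le> K"
    by (rule infsum_le_finite_sums[OF abs le])
  show "(mset_weight w has_sum l) (msets S)"
    if "(\<lambda>n. \<Prod>j\<in>S \<inter> {..<n}. 1 / (1 - w j)) \<longlonglongrightarrow> l"
  proof (rule has_sum_increasing_limit[OF abs_summable_summable[OF abs] _ inc Un that])
    show "(mset_weight w has_sum (\<Prod>j\<in>S \<inter> {..<n}. 1 / (1 - w j))) (?B n)" for n
      using assms(1) by (intro conjunct1[OF msets_gf_finite]) auto
  qed
qed

text \<open>Parts missing from \<open>S\<close> would only contribute factors that are at least 1,
  so the full partition product at \<open>r\<close> dominates. This supplies the constant
  \<open>K\<close> of \<open>msets_gf\<close>.\<close>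

lemma msets_prod_bound:
  fixes w :: "nat \<Rightarrow> 'a::real_normed_field"
  assumes "0 < r" "r < 1" "S \<subseteq> {1..}" "\<And>j. j \<in> S \<Longrightarrow> norm (w j) \<le> r ^ j"
  shows "(\<Prod>j\<in>S \<inter> {..<n}. 1 / (1 - norm (w j))) \<le> exp ((pi\<^sup>2 / 6) / (1 - r))"
proof -
  have r1: "r ^ j < 1" if "j \<ge> 1" for j using assms that by (auto simp: power_less_one_iff)
  have "(\<Prod>j\<in>S \<inter> {..<n}. 1 / (1 - norm (w j))) \<le> (\<Prod>j\<in>S \<inter> {..<n}. 1 / (1 - r ^ j))"
  proof (intro prod_mono conjI)
    fix j assume "j \<in> S \<inter> {..<n}"
    hence "norm (w j) \<le> r ^ j" "r ^ j < 1" using assms r1 by auto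
    thus "1 / (1 - norm (w j)) \<le> 1 / (1 - r ^ j)" "0 \<le> 1 / (1 - norm (w j))"
      by (auto intro!: divide_left_mono)
  qed
  also have "\<dots> \<le> (\<Prod>j\<in>{1..<Suc n}. 1 / (1 - r ^ j))"
  proof (rule prod_mono2)
    fix j assume "j \<in> {1..<Suc n} - (S \<inter> {..<n})"
    thus "1 \<le> 1 / (1 - r ^ j)" using r1[of j] assms by (auto simp: field_simps)
  next
    fix j assume "j \<in> S \<inter> {..<n}"
    thus "0 \<le> 1 / (1 - r ^ j)" using r1[of j] assms by fastforce
  qed (use assms in auto)
  also have "\<dots> = inverse (\<Prod>j\<in>{1..<Suc n}. 1 - r ^ j)"
    by (simp add: prod_dividef inverse_eq_divide)
  also have "(\<Prod>j\<in>{1..<Suc n}. 1 - r ^ j) = (\<Prod>i<n. 1 - r ^ Suc i)"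
    by (induction n) simp_all
  also have "inverse \<dots> \<le> inverse (exp (- (pi\<^sup>2 / 6) / (1 - r)))"
    using prod_one_minus_power_ge[OF assms(1,2)] by (intro le_imp_inverse_le) auto
  also have "\<dots> = exp ((pi\<^sup>2 / 6) / (1 - r))"
    by (simp add: exp_minus[symmetric])
  finally show ?thesis .
qed

section \<open>The q-binomial theorem and its logarithmic derivative\<close>

definition qfac :: "complex \<Rightarrow> complex \<Rightarrow> nat \<Rightarrow> complex" where
  "qfac a q n = (\<Prod>i<n. 1 - a * q ^ i)"

lemma qfac_0 [simp]: "qfac a q 0 = 1" and qfac_Suc: "qfac a q (Suc n) = qfac a q n * (1 - a * q ^ n)"
  by (simp_all add: qfac_def)

lemma qpoch_qfac:
  assumes "norm q < 1"
  shows "qpoch a q = qfac a q n * qpoch (a * q ^ n) q"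
proof (induction n)
  case (Suc n)
  thus ?case using qpoch_rec[OF assms, of "a * q ^ n"] by (simp add: qfac_Suc mult_ac)
qed simp

lemma q_power_neq_1:
  fixes q :: complex
  assumes "norm q < 1" "n > 0"
  shows "q ^ n \<noteq> 1"
proof
  assume "q ^ n = 1"
  hence "norm q ^ n = 1" by (metis norm_one norm_power)
  moreover have "norm q ^ n < 1" using power_less_one_iff[of "norm q" n] assms by auto
  ultimately show False by simp
qed

lemma qfac_nonzero:
  assumes "norm q < 1"
  shows "qfac q q n \<noteq> 0"
  using q_power_neq_1[OF assms, of "Suc _"] by (auto simp: qfac_def)

text \<open>The right-hand side \<open>f\<close> satisfies
  \<open>(1 - t) * f t = (1 - a * t) * f (q * t)\<close>. For its Taylor coefficients this is a
  first-order recursion, started by \<open>f 0 = 1\<close>.\<close>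

lemma q_binomial:
  assumes q: "norm q < 1" and t: "norm t < 1"
  shows "(\<lambda>n. qfac a q n / qfac q q n * t ^ n) sums (qpoch (a * t) q / qpoch t q)"
proof -
  define f where "f = (\<lambda>t. qpoch (a * t) q / qpoch t q)"
  have hol: "f holomorphic_on ball 0 1"
    unfolding f_def using q qpoch_nonzero'[OF q]
    by (auto intro!: holomorphic_intros)
  define d where "d = (\<lambda>n. (deriv ^^ n) f 0 / fact n)"
  have s: "(\<lambda>n. d n * x ^ n) sums f x" if "norm x < 1" for x
    using holomorphic_power_series[OF hol, of x] that by (simp add: d_def)
  have feq: "(1 - x) * f x = (1 - a * x) * f (q * x)" if "norm x < 1" for x
  proof -
    have "norm (q * x) < 1" using q that
      by (metis mult_strict_mono' norm_ge_zero norm_mult mult_1)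
    hence "qpoch x q \<noteq> 0" "qpoch (q * x) q \<noteq> 0" "1 - x \<noteq> 0"
      using qpoch_nonzero'[OF q] that by auto
    thus ?thesis unfolding f_def
      using qpoch_rec[OF q, of "a * x"] qpoch_rec[OF q, of x]
      by (simp add: mult_ac)
  qed
  have ev: "eventually (\<lambda>u::complex. norm u < 1) (nhds 0)"
    using eventually_nhds_in_open[of "ball 0 1" "0::complex"] by simp
  have ev_eq: "eventually (\<lambda>x. (1 - x) * f x = (1 - a * x) * f (q * x)) (nhds 0)"
    using ev by eventually_elim (rule feq)
  define F where "F = Abs_fps d"
  define F' where "F' = Abs_fps (\<lambda>n. q ^ n * d n)"
  have "f has_fps_expansion F"
    by (rule has_fps_expansionI, rule eventually_mono[OF ev]) (use s in \<open>auto simp: F_def\<close>)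
  hence F: "(\<lambda>x. (1 - x) * f x) has_fps_expansion (1 - fps_X) * F"
    by (intro fps_expansion_intros)
  have "(\<lambda>x. f (q * x)) has_fps_expansion F'"
  proof (rule has_fps_expansionI, rule eventually_mono[OF ev])
    fix u :: complex assume u: "norm u < 1"
    hence "norm (q * u) < 1" using q
      by (metis mult_strict_mono' norm_ge_zero norm_mult mult_1)
    from s[OF this] show "(\<lambda>n. fps_nth F' n * u ^ n) sums f (q * u)"
      by (simp add: F'_def power_mult_distrib mult_ac)
  qed
  hence F': "(\<lambda>x. (1 - a * x) * f (q * x)) has_fps_expansion (1 - fps_const a * fps_X) * F'"
    by (intro fps_expansion_intros)
  have "(\<lambda>x. (1 - x) * f x) has_fps_expansion (1 - fps_const a * fps_X) * F'"
    using F' has_fps_expansion_cong[OF ev_eq refl] by blast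
  hence eq: "(1 - fps_X) * F = (1 - fps_const a * fps_X) * F'"
    using fps_expansion_unique_complex[OF F] by simp
  have "d n = qfac a q n / qfac q q n" for n
  proof (induction n)
    case 0
    have "d 0 = f 0" by (simp add: d_def)
    thus ?case by (simp add: f_def)
  next
    case (Suc n)
    have "fps_nth ((1 - fps_X) * F) (Suc n) = d (Suc n) - d n"
      by (simp add: left_diff_distrib F_def)
    moreover have "fps_nth ((1 - fps_const a * fps_X) * F') (Suc n) = q ^ Suc n * d (Suc n) - a * (q ^ n * d n)"
      by (simp add: left_diff_distrib mult.assoc F'_def)
    ultimately have "d (Suc n) - d n = q ^ Suc n * d (Suc n) - a * (q ^ n * d n)"
      using eq by metis
    hence "d (Suc n) * (1 - q ^ Suc n) = d n * (1 - a * q ^ n)"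
      by (simp add: algebra_simps)
    thus ?case using Suc q_power_neq_1[OF q, of "Suc n"] qfac_nonzero[OF q, of n]
      by (simp add: qfac_Suc divide_simps) (simp add: mult_ac)
  qed
  with s[OF t] show ?thesis by (simp add: f_def)
qed

text \<open>The operator \<open>a * d/da\<close> applied to the logarithm of
  \<open>qpoch a q\<close>. In this normalisation the logarithmic derivative of
  \<open>qpoch (q * nome x) q\<close> in \<open>x\<close> is \<open>2 * pi * \<i>\<close> times
  \<open>qlog\<close>, without denominators.\<close>

definition qlog :: "complex \<Rightarrow> complex \<Rightarrow> complex" where
  "qlog a q = a * deriv (\<lambda>x. qpoch x q) a / qpoch a q"

lemma qpoch_has_field_derivative:
  assumes "norm q < 1" "qpoch a q \<noteq> 0" "a \<noteq> 0"
  shows "((\<lambda>x. qpoch x q) has_field_derivative (qlog a q * qpoch a q / a)) (at a)"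
proof -
  have "(\<lambda>x. qpoch x q) holomorphic_on UNIV"
    using assms by (intro holomorphic_intros) auto
  hence "((\<lambda>x. qpoch x q) has_field_derivative (deriv (\<lambda>x. qpoch x q) a)) (at a)"
    using holomorphic_derivI by blast
  thus ?thesis using assms by (simp add: qlog_def)
qed

text \<open>Applying \<open>t * d/dt\<close> to the q-binomial theorem brings down the factor
  \<open>n\<close>, which will be the number of ones of a partition.\<close>

lemma q_binomial_deriv:
  assumes q: "norm q < 1" and t: "norm t < 1" "t \<noteq> 0" "a \<noteq> 0" "qpoch (a * t) q \<noteq> 0"
  shows "(\<lambda>n. of_nat n * (qfac a q n / qfac q q n * t ^ n)) sums
           (qpoch (a * t) q / qpoch t q * (qlog (a * t) q - qlog t q))"
proof -
  define c where "c = (\<lambda>n. qfac a q n / qfac q q n)"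
  define f where "f = (\<lambda>t. qpoch (a * t) q / qpoch t q)"
  have s: "(\<lambda>n. c n * x ^ n) sums f x" if "norm x < 1" for x
    using q_binomial[OF q that, of a] by (simp add: c_def f_def)
  have t0: "qpoch t q \<noteq> 0" using qpoch_nonzero'[OF q t(1)] .
  have "(f has_field_derivative f t * (qlog (a * t) q - qlog t q) / t) (at t)"
  proof -
    have "((\<lambda>x. qpoch (a * x) q) has_field_derivative (qlog (a * t) q * qpoch (a * t) q / (a * t) * a)) (at t)"
      by (rule DERIV_chain'[where g = "\<lambda>x. qpoch x q" and f = "\<lambda>x. a * x", THEN DERIV_cong])
        (use qpoch_has_field_derivative[OF q t(4)] t in \<open>auto intro!: derivative_eq_intros\<close>)
    from DERIV_divide[OF this qpoch_has_field_derivative[OF q t0 t(2)] t0]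
    show ?thesis unfolding f_def
      by (rule DERIV_cong) (use t t0 in \<open>simp add: field_simps\<close>)
  qed
   from this have "(\<lambda>n. diffs c n * t ^ n) sums (f t * (qlog (a * t) q - qlog t q) / t)"
    using termdiffs_sums_strong[of 1 c f, OF s] t by blast
  hence "(\<lambda>n. t * (diffs c n * t ^ n)) sums (t * (f t * (qlog (a * t) q - qlog t q) / t))"
    by (rule sums_mult)
  hence "(\<lambda>n. of_nat (Suc n) * (c (Suc n) * t ^ Suc n)) sums (f t * (qlog (a * t) q - qlog t q))"
    using t by (simp add: diffs_def mult_ac)
  thus ?thesis unfolding f_def c_def by (subst (asm) sums_Suc_iff) simp
qed

section \<open>The crank generating function\<close>

lemma n_power_le:
  fixes x :: real
  assumes "0 \<le> x" "x < 1"
  shows "real n * x ^ n \<le> 1 / (1 - x)"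
proof -
  have "real n * (1 - x) * x ^ n \<le> 1 - x ^ n" using assms by (intro one_minus_power_ge) auto
  also have "\<dots> \<le> 1" using assms by simp
  finally show ?thesis using assms by (simp add: field_simps)
qed

lemma msets_power_summable:
  fixes x :: real
  assumes "0 < x" "x < 1"
  shows "(\<lambda>\<pi>. x ^ sum_mset \<pi>) summable_on msets {1..}"
    and "infsum (\<lambda>\<pi>. x ^ sum_mset \<pi>) (msets {1..}) \<le> exp ((pi\<^sup>2 / 6) / (1 - x))"
proof -
  have less: "norm (x ^ j) < 1" if "j \<in> {1..}" for j using assms that by (auto simp: power_less_one_iff)
  have bound: "(\<Prod>j\<in>{1..} \<inter> {..<n}. 1 / (1 - norm (x ^ j))) \<le> exp ((pi\<^sup>2 / 6) / (1 - x))" for n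
    by (rule msets_prod_bound) (use assms in auto)
  note msets_gf(1)[OF less bound] msets_gf(2)[OF less bound]
  moreover have "(\<lambda>\<pi>. norm (mset_weight (\<lambda>j. x ^ j) \<pi>)) = (\<lambda>\<pi>. x ^ sum_mset \<pi>)"
    using assms by (intro ext) (simp add: mset_weight_power norm_power)
  ultimately show "(\<lambda>\<pi>. x ^ sum_mset \<pi>) summable_on msets {1..}"
    "infsum (\<lambda>\<pi>. x ^ sum_mset \<pi>) (msets {1..}) \<le> exp ((pi\<^sup>2 / 6) / (1 - x))"
    by simp_all
qed

text \<open>Half of the power, \<open>sqrt R ^ n\<close>, absorbs the linear factor; the other half
  stays summable over all partitions.\<close>

lemma ones_weight_le:
  fixes R :: real
  assumes "0 < R" "R < 1"
  shows "real (sum_mset \<pi>) * R ^ sum_mset \<pi> \<le> 1 / (1 - sqrt R) * sqrt R ^ sum_mset \<pi>"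
proof -
  have "real (sum_mset \<pi>) * R ^ sum_mset \<pi> = (real (sum_mset \<pi>) * sqrt R ^ sum_mset \<pi>) * sqrt R ^ sum_mset \<pi>"
    using assms by (simp add: power_mult_distrib[symmetric])
  also have "\<dots> \<le> 1 / (1 - sqrt R) * sqrt R ^ sum_mset \<pi>"
    using assms by (intro mult_right_mono n_power_le) auto
  finally show ?thesis .
qed

lemma ones_le_sum: "ones \<pi> \<le> sum_mset \<pi>"
proof -
  have "count \<pi> 1 \<le> sum_mset \<pi>"
    by (induction \<pi>) auto
  thus ?thesis by (simp add: ones_def)
qed

definition crank_gf :: "complex \<Rightarrow> complex \<Rightarrow> complex" where
  "crank_gf q z = qpoch q q / (qpoch (z * q) q * qpoch (q / z) q)"

lemma msets_1_bij:
  "bij_betw (\<lambda>(n, \<sigma>). replicate_mset n 1 + \<sigma>) (UNIV \<times> msets {2..}) (msets {1..})"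
proof -
  have "insert 1 {2..} = {1::nat..}" by auto
  thus ?thesis using msets_insert_bij[of 1 "{2..}"] by simp
qed

text \<open>For a nonempty partition without ones the crank is the largest part, hence the
  decomposition by that part. The empty multiset is added back separately.\<close>

lemma msets_largest_bij:
  "bij_betw (\<lambda>(L, \<sigma>). add_mset L \<sigma>) (SIGMA L:{2..}. msets {2..L}) (msets {2..} - {{#}})"
proof (rule bij_betwI[where g = "\<lambda>\<pi>. (Max (set_mset \<pi>), \<pi> - {#Max (set_mset \<pi>)#})"])
  fix x :: "nat \<times> nat multiset" assume "x \<in> (SIGMA L:{2..}. msets {2..L})"
  then obtain L \<sigma> where x: "x = (L, \<sigma>)" "L \<ge> 2" "set_mset \<sigma> \<subseteq> {2..L}" by auto
  hence "Max (insert L (set_mset \<sigma>)) = L" by (intro Max_eqI) auto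
  thus "(Max (set_mset (case x of (L, \<sigma>) \<Rightarrow> add_mset L \<sigma>)), (case x of (L, \<sigma>) \<Rightarrow> add_mset L \<sigma>)
          - {#Max (set_mset (case x of (L, \<sigma>) \<Rightarrow> add_mset L \<sigma>))#}) = x"
    using x by simp
next
  fix \<pi> :: "nat multiset" assume "\<pi> \<in> msets {2..} - {{#}}"
  hence "Max (set_mset \<pi>) \<in># \<pi>" by (intro Max_in) auto
  thus "(case (Max (set_mset \<pi>), \<pi> - {#Max (set_mset \<pi>)#}) of (L, \<sigma>) \<Rightarrow> add_mset L \<sigma>) = \<pi>" by simp
next
  show "(\<lambda>\<pi>. (Max (set_mset \<pi>), \<pi> - {#Max (set_mset \<pi>)#})) \<in> msets {2..} - {{#}} \<rightarrow> (SIGMA L:{2..}. msets {2..L})"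
  proof safe
    fix \<pi> :: "nat multiset" assume \<pi>: "set_mset \<pi> \<subseteq> {2..}" "\<pi> \<noteq> {#}"
    hence "Max (set_mset \<pi>) \<in># \<pi>" by (intro Max_in) auto
    thus "2 \<le> Max (set_mset \<pi>)" using \<pi> by (metis atLeast_iff subsetD)
    fix x assume "x \<in># \<pi> - {#Max (set_mset \<pi>)#}"
    hence "x \<in># \<pi>" by (rule in_diffD)
    thus "x \<in> {2..Max (set_mset \<pi>)}" using \<pi> by (auto intro: Max_ge)
  qed
qed (auto simp: atLeastAtMost_def; fastforce)

lemma mset_weight_if:
  fixes z :: "'a::comm_monoid_mult"
  shows "mset_weight (\<lambda>j. if P j then z else 1) \<sigma> = z ^ size (filter_mset P \<sigma>)"
  by (induction \<sigma>) auto

context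
  fixes q z :: complex
  assumes q: "norm q < 1" "q \<noteq> 0" and z: "norm z = 1"
begin

lemma zq_less: "norm (z * q ^ Suc n) < 1"
  using power_Suc_less_one[of "norm q" n] z q by (simp add: norm_mult norm_power)

lemma qpoch_zq_nz: "qpoch (z * q) q \<noteq> 0"
  using qpoch_nonzero'[OF q(1), of "z * q"] zq_less[of 0] by simp

text \<open>The multiplier supplies exactly the missing factors: \<open>1 - q\<close> completes the
  parts up to \<open>m\<close> to \<open>qfac q q m\<close>, and \<open>qfac (z * q) q m\<close>
  completes the parts above \<open>m\<close> to \<open>qfac (z * q) q (m + n)\<close>.\<close>

lemma prod_small_large_parts:
  assumes "m \<ge> 1"
  shows "(\<Prod>j\<in>{2..<m + 1 + n}. 1 - q ^ j * (if j > m then z else 1)) * ((1 - q) * qfac (z * q) q m)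
           = qfac q q m * qfac (z * q) q (m + n)"
proof (induction n)
  case 0
  have "(\<Prod>j\<in>{2..<m + 1}. 1 - q ^ j * (if j > m then z else 1)) = (\<Prod>j\<in>{2..<m + 1}. 1 - q ^ j)"
    by (intro prod.cong) auto
  moreover have "(\<Prod>j\<in>{2..<m + 1}. 1 - q ^ j) * (1 - q) = qfac q q m"
    using assms by (induction m rule: dec_induct) (auto simp: qfac_Suc qfac_def)
  ultimately show ?case by (simp add: mult_ac)
next
  case (Suc n)
  have "{2..<m + 1 + Suc n} = insert (m + 1 + n) {2..<m + 1 + n}" using assms by auto
  thus ?case using Suc by (simp add: qfac_Suc mult_ac)
qed

text \<open>In a partition with \<open>m\<close> ones the crank counts the parts above
  \<open>m\<close>, and these carry the extra \<open>z\<close>. The dependence on \<open>m\<close>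
  takes the form of a coefficient in the q-binomial series with \<open>a = z * q\<close>.\<close>

lemma msets_small_large_parts:
  assumes "m \<ge> 1"
  shows "(mset_weight (\<lambda>j. q ^ j * (if j > m then z else 1)) has_sum
           ((1 - q) / qpoch (z * q) q * (qfac (z * q) q m / qfac q q m))) (msets {2..})"
proof (rule msets_gf(3))
  let ?w = "\<lambda>j. q ^ j * (if j > m then z else 1)"
  have w: "norm (?w j) = norm q ^ j" for j using z by (auto simp: norm_mult norm_power)
  show "norm (?w j) < 1" if "j \<in> {2..}" for j
    unfolding w using q that by (simp add: power_less_one_iff)
  show "(\<Prod>j\<in>{2..} \<inter> {..<n}. 1 / (1 - norm (?w j))) \<le> exp ((pi\<^sup>2 / 6) / (1 - norm q))" for n
    by (rule msets_prod_bound) (use q z in \<open>auto simp: norm_mult norm_power\<close>)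
  have nz: "qfac (z * q) q n \<noteq> 0" for n
    using qpoch_qfac[OF q(1), of "z * q" n] qpoch_zq_nz by auto
  have aux: "1 / P = a / C * (A / B)" if "P * (a * A) = B * C" "a \<noteq> 0" "A \<noteq> 0" "B \<noteq> 0" "C \<noteq> 0"
    for P a A B C :: complex
  proof -
    have "P \<noteq> 0" using that by auto
    thus ?thesis using that by (simp add: field_simps)
  qed
  have nz': "qfac q q m \<noteq> 0" "1 - q \<noteq> 0" using qfac_nonzero q(1) by auto
  have "(\<lambda>n. (1 - q) / qfac (z * q) q (m + n) * (qfac (z * q) q m / qfac q q m)) \<longlonglongrightarrow>
          (1 - q) / qpoch (z * q) q * (qfac (z * q) q m / qfac q q m)"
  proof (intro tendsto_intros qpoch_zq_nz)
    have "(\<lambda>n. qfac (z * q) q n) \<longlonglongrightarrow> qpoch (z * q) q"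
      using qpoch_tendsto[OF q(1)] by (simp add: qfac_def)
    thus "(\<lambda>n. qfac (z * q) q (m + n)) \<longlonglongrightarrow> qpoch (z * q) q"
      using LIMSEQ_ignore_initial_segment[of _ _ m] by (simp add: add.commute)
  qed
  \<comment> \<open>From the bound \<open>m + 1\<close> on, the products contain all small parts and
    have a uniform closed form; the offset does not change the limit.\<close>
  moreover have "(\<Prod>j\<in>{2..} \<inter> {..<n + (m + 1)}. 1 / (1 - ?w j)) =
      (1 - q) / qfac (z * q) q (m + n) * (qfac (z * q) q m / qfac q q m)" for n
  proof -
    let ?P = "\<Prod>j\<in>{2..<m + 1 + n}. 1 - ?w j"
    have "?P * ((1 - q) * qfac (z * q) q m) = qfac q q m * qfac (z * q) q (m + n)"
      by (rule prod_small_large_parts[OF assms])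
    hence "1 / ?P = (1 - q) / qfac (z * q) q (m + n) * (qfac (z * q) q m / qfac q q m)"
      by (rule aux) (use nz nz' in auto)
    moreover have "{2..} \<inter> {..<n + (m + 1)} = {2..<m + 1 + n}" by auto
    moreover have "(\<Prod>j\<in>{2..<m + 1 + n}. 1 / (1 - ?w j)) = 1 / ?P" by (simp add: prod_dividef)
    ultimately show ?thesis by metis
  qed
  ultimately have "(\<lambda>n. (\<Prod>j\<in>{2..} \<inter> {..<n + (m + 1)}. 1 / (1 - ?w j))) \<longlonglongrightarrow>
      (1 - q) / qpoch (z * q) q * (qfac (z * q) q m / qfac q q m)" by simp
  thus "(\<lambda>n. (\<Prod>j\<in>{2..} \<inter> {..<n}. 1 / (1 - ?w j))) \<longlonglongrightarrow>
      (1 - q) / qpoch (z * q) q * (qfac (z * q) q m / qfac q q m)"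
    by (rule LIMSEQ_offset)
qed

text \<open>The ones contribute \<open>q ^ m\<close> to the size and \<open>- m\<close> to the
  crank, which together give \<open>(q / z) ^ m\<close>.\<close>

lemma crank_summand:
  assumes "m \<ge> 1" "\<sigma> \<in> msets {2..}"
  defines "\<pi> \<equiv> replicate_mset m 1 + \<sigma>"
  shows "z powi crank \<pi> * q ^ sum_mset \<pi> =
           (q / z) ^ m * mset_weight (\<lambda>j. q ^ j * (if j > m then z else 1)) \<sigma>"
    and "ones \<pi> = m"
proof -
  have z0: "z \<noteq> 0" using z by auto
  have "1 \<notin># \<sigma>" using assms by auto
  thus ones: "ones \<pi> = m" by (simp add: ones_def \<pi>_def not_in_iff)
  have "{#j \<in># \<pi>. j > m#} = {#j \<in># \<sigma>. j > m#}"
    using assms(1) by (auto simp: \<pi>_def filter_mset_eq_conv[of _ "replicate_mset m 1"])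
  hence "crank \<pi> = int (size {#j \<in># \<sigma>. j > m#}) - int m"
    using assms(1) by (simp add: crank_def ones)
  hence "z powi crank \<pi> = z ^ size {#j \<in># \<sigma>. j > m#} / z ^ m"
    using z0 by (simp add: power_int_diff)
  moreover have "q ^ sum_mset \<pi> = q ^ m * q ^ sum_mset \<sigma>"
    by (simp add: \<pi>_def power_add)
  ultimately show "z powi crank \<pi> * q ^ sum_mset \<pi> =
           (q / z) ^ m * mset_weight (\<lambda>j. q ^ j * (if j > m then z else 1)) \<sigma>"
    by (simp add: mset_weight_mult mset_weight_power mset_weight_if power_divide)
qed

lemma norm_z_powi [simp]: "norm (z powi n) = 1"
  using z by (simp add: norm_power_int)

text \<open>On the unit circle the power of \<open>z\<close> has norm 1 whatever the sign of the
  crank, and the number of ones is at most the size of the partition.\<close>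

lemma crank_ones_summable:
  "(\<lambda>\<pi>. norm (of_nat (ones \<pi>) * z powi crank \<pi> * q ^ sum_mset \<pi>)) summable_on msets {1..}"
proof (rule Infinite_Sum.abs_summable_on_comparison_test')
  show "(\<lambda>\<pi>. 1 / (1 - sqrt (norm q)) * sqrt (norm q) ^ sum_mset \<pi>) summable_on msets {1..}"
    using q by (intro summable_on_cmult_right msets_power_summable) auto
  fix \<pi> :: "nat multiset"
  have "norm (of_nat (ones \<pi>) * z powi crank \<pi> * q ^ sum_mset \<pi>) = real (ones \<pi>) * norm q ^ sum_mset \<pi>"
    by (simp add: norm_mult norm_power)
  also have "\<dots> \<le> real (sum_mset \<pi>) * norm q ^ sum_mset \<pi>"
    by (intro mult_right_mono of_nat_mono ones_le_sum) auto
  also have "\<dots> \<le> 1 / (1 - sqrt (norm q)) * sqrt (norm q) ^ sum_mset \<pi>"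
    using q by (intro ones_weight_le) auto
  finally show "norm (of_nat (ones \<pi>) * z powi crank \<pi> * q ^ sum_mset \<pi>) \<le> \<dots>" .
qed

lemma crank_summable:
  "(\<lambda>\<pi>. norm (z powi crank \<pi> * q ^ sum_mset \<pi>)) summable_on msets {1..}"
  using msets_power_summable(1)[of "norm q"] q by (simp add: norm_mult norm_power)

lemma qz_less: "norm (q / z) < 1" using q z by (simp add: norm_divide)

text \<open>Summation over the number \<open>m\<close> of ones gives the differentiated q-binomial
  series with \<open>a = z * q\<close> and \<open>t = q / z\<close>. Here
  \<open>a * t = q\<^sup>2\<close> is free of \<open>z\<close>, and the factor \<open>1 - q\<close>
  completes \<open>qpoch (q\<^sup>2) q\<close> to the numerator of \<open>crank_gf\<close>.\<close>

lemma crank_ones_gf_has_sum: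
  "((\<lambda>\<pi>. of_nat (ones \<pi>) * z powi crank \<pi> * q ^ sum_mset \<pi>) has_sum
      (crank_gf q z * (qlog (q\<^sup>2) q - qlog (q / z) q))) (msets {1..})"
proof -
  define g where "g = (\<lambda>\<pi>. of_nat (ones \<pi>) * z powi crank \<pi> * q ^ sum_mset \<pi>)"
  have z0: "z \<noteq> 0" using z by auto
  obtain A where A: "(g has_sum A) (msets {1..})"
    using abs_summable_summable[OF crank_ones_summable] unfolding g_def summable_on_def by blast
  hence A': "((\<lambda>x. g (case x of (n, \<sigma>) \<Rightarrow> replicate_mset n 1 + \<sigma>)) has_sum A) (UNIV \<times> msets {2..})"
    by (subst has_sum_reindex_bij_betw[OF msets_1_bij])
  define b where "b = (\<lambda>m. of_nat m * ((1 - q) / qpoch (z * q) q * (qfac (z * q) q m / qfac q q m * (q / z) ^ m)))"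
  have "(b has_sum A) UNIV"
  proof (rule has_sum_SigmaD[OF A'])
    fix m
    show "((\<lambda>\<sigma>. g (case (m, \<sigma>) of (n, \<sigma>) \<Rightarrow> replicate_mset n 1 + \<sigma>)) has_sum b m) (msets {2..})"
    proof (cases "m = 0")
      case True
      have "ones \<sigma> = 0" if "\<sigma> \<in> msets {2..}" for \<sigma>
        using that by (auto simp: ones_def not_in_iff[symmetric])
      hence "((\<lambda>\<sigma>. g \<sigma>) has_sum 0) (msets {2..})"
        by (intro has_sum_0) (auto simp: g_def)
      thus ?thesis using True by (simp add: b_def)
    next
      case False
      hence m: "m \<ge> 1" by simp
      have "((\<lambda>\<sigma>. of_nat m * (q / z) ^ m * mset_weight (\<lambda>j. q ^ j * (if j > m then z else 1)) \<sigma>) has_sum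
          (of_nat m * (q / z) ^ m * ((1 - q) / qpoch (z * q) q * (qfac (z * q) q m / qfac q q m)))) (msets {2..})"
        by (intro has_sum_cmult_right msets_small_large_parts m)
      also have "of_nat m * (q / z) ^ m * ((1 - q) / qpoch (z * q) q * (qfac (z * q) q m / qfac q q m)) = b m"
        by (simp add: b_def mult_ac)
      finally show ?thesis
        by (rule has_sum_cong[THEN iffD1, rotated])
          (use crank_summand[OF m] in \<open>simp add: g_def mult.assoc\<close>)
    qed
  qed
  hence "b sums A" by (rule has_sum_imp_sums)
  moreover have "b sums ((1 - q) / qpoch (z * q) q *
      (qpoch (z * q * (q / z)) q / qpoch (q / z) q * (qlog (z * q * (q / z)) q - qlog (q / z) q)))"
  proof -
    have "z * q * (q / z) = q ^ 2" using z0 by (simp add: power2_eq_square)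
    moreover have "qpoch (q ^ 2) q \<noteq> 0"
      using q by (intro qpoch_nonzero') (auto simp: norm_power power_less_one_iff)
    ultimately have "qpoch (z * q * (q / z)) q \<noteq> 0" by simp
    from sums_mult[OF q_binomial_deriv[OF q(1) qz_less _ _ this], of "(1 - q) / qpoch (z * q) q"] z0 q
    show ?thesis unfolding b_def by (simp add: mult_ac)
  qed
  ultimately have "A = (1 - q) / qpoch (z * q) q *
      (qpoch (z * q * (q / z)) q / qpoch (q / z) q * (qlog (z * q * (q / z)) q - qlog (q / z) q))"
    by (rule sums_unique2)
  also have "z * q * (q / z) = q\<^sup>2" using z0 by (simp add: power2_eq_square)
  also have "(1 - q) / qpoch (z * q) q * (qpoch (q\<^sup>2) q / qpoch (q / z) q * (qlog (q\<^sup>2) q - qlog (q / z) q))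
      = crank_gf q z * (qlog (q\<^sup>2) q - qlog (q / z) q)"
    using qpoch_rec[OF q(1), of q] by (simp add: crank_gf_def power2_eq_square)
  finally show ?thesis using A by (simp add: g_def)
qed

text \<open>The largest part \<open>L \<ge> 2\<close> gives the terms of the q-binomial series with
  \<open>a = 0\<close>. The terms for \<open>L = 0\<close> and \<open>L = 1\<close> are
  \<open>1 - q\<close> and \<open>z * q\<close>, whereas the empty partition contributes 1; the
  balance is the correction \<open>- (z - 1) * q\<close>.\<close>

lemma no_ones_gf:
  "((\<lambda>\<pi>. z powi crank \<pi> * q ^ sum_mset \<pi>) has_sum ((1 - q) / qpoch (z * q) q - (z - 1) * q)) (msets {2..})"
proof -
  define h where "h = (\<lambda>\<pi>. z powi crank \<pi> * q ^ sum_mset \<pi>)"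
  define b where "b = (\<lambda>L. (1 - q) * ((z * q) ^ L / qfac q q L))"
  have "(\<lambda>\<pi>. norm (h \<pi>)) summable_on (msets {2..} - {{#}})"
    using crank_summable unfolding h_def by (rule summable_on_subset_banach) auto
  then obtain s where s: "(h has_sum s) (msets {2..} - {{#}})"
    using abs_summable_summable unfolding summable_on_def by blast
  hence s': "((\<lambda>x. h (case x of (L, \<sigma>) \<Rightarrow> add_mset L \<sigma>)) has_sum s) (SIGMA L:{2..}. msets {2..L})"
    by (subst has_sum_reindex_bij_betw[OF msets_largest_bij])
  have "(b has_sum s) {2..}"
  proof (rule has_sum_SigmaD[OF s'])
    fix L :: nat assume L: "L \<in> {2..}"
    have "((\<lambda>\<sigma>. (z * q) ^ L * mset_weight (\<lambda>j. q ^ j) \<sigma>) has_sum ((z * q) ^ L * (\<Prod>j\<in>{2..L}. 1 / (1 - q ^ j)))) (msets {2..L})"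
      by (intro has_sum_cmult_right conjunct1[OF msets_gf_finite]) (use q in \<open>auto simp: norm_power power_less_one_iff\<close>)
    also have "(\<Prod>j\<in>{2..L}. 1 / (1 - q ^ j)) = (1 - q) / qfac q q L"
    proof -
      have "(\<Prod>j\<in>{2..L}. 1 - q ^ j) * (1 - q) = qfac q q L"
        using L[simplified] by (induction L rule: dec_induct) (auto simp: qfac_Suc qfac_def numeral_2_eq_2)
      moreover have "1 / P = (1 - q) / F" if "P * (1 - q) = F" "F \<noteq> 0" for P F
      proof -
        have "P \<noteq> 0" using that by auto
        thus ?thesis using that by (simp add: divide_simps mult_ac)
      qed
      ultimately have "1 / (\<Prod>j\<in>{2..L}. 1 - q ^ j) = (1 - q) / qfac q q L"
        using qfac_nonzero[OF q(1)] by blast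
      thus ?thesis by (simp add: prod_dividef)
    qed
    also have "(z * q) ^ L * ((1 - q) / qfac q q L) = b L" by (simp add: b_def)
    finally show "((\<lambda>\<sigma>. h (case (L, \<sigma>) of (L, \<sigma>) \<Rightarrow> add_mset L \<sigma>)) has_sum b L) (msets {2..L})"
    proof (rule has_sum_cong[THEN iffD1, rotated])
      fix \<sigma> assume \<sigma>: "\<sigma> \<in> msets {2..L}"
      have "ones (add_mset L \<sigma>) = 0" using \<sigma> L by (auto simp: ones_def not_in_iff[symmetric])
      moreover have "largest_part (add_mset L \<sigma>) = L"
        unfolding largest_part_def using \<sigma> by (intro Max_eqI) auto
      ultimately have "crank (add_mset L \<sigma>) = int L" by (simp add: crank_def)
      thus "(z * q) ^ L * mset_weight (\<lambda>j. q ^ j) \<sigma> = h (case (L, \<sigma>) of (L, \<sigma>) \<Rightarrow> add_mset L \<sigma>)"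
        by (simp add: h_def mset_weight_power power_add power_mult_distrib)
    qed
  qed
  moreover have "(b has_sum sum b {0,1}) {0,1}" by (rule has_sum_finite) auto
  ultimately have "(b has_sum (s + sum b {0,1})) ({2..} \<union> {0,1})"
    by (rule has_sum_Un_disjoint) auto
  moreover have "{2..} \<union> {0,1} = (UNIV :: nat set)" by auto
  ultimately have "b sums (s + sum b {0,1})" using has_sum_imp_sums by metis
  moreover have "b sums ((1 - q) * (1 / qpoch (z * q) q))"
    using sums_mult[OF q_binomial[OF q(1), of "z * q" 0], of "1 - q"] zq_less[of 0]
    by (simp add: b_def qfac_def[of 0])
  ultimately have "s + sum b {0,1} = (1 - q) / qpoch (z * q) q"
    using sums_unique2 by fastforce
  moreover have "sum b {0,1} = (1 - q) + z * q"
    using q by (auto simp: b_def qfac_def)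
  ultimately have "s + ((1 - q) + z * q) = (1 - q) / qpoch (z * q) q" by metis
  hence s_eq: "s + 1 = (1 - q) / qpoch (z * q) q - (z - 1) * q" by (simp add: algebra_simps)
  have "(h has_sum h {#}) {{#}}" by (rule has_sum_finiteI) auto
  with s have "(h has_sum (s + h {#})) ((msets {2..} - {{#}}) \<union> {{#}})"
    by (rule has_sum_Un_disjoint) auto
  moreover have "(msets {2..} - {{#}}) \<union> {{#}} = msets {2..}" by auto
  moreover have "h {#} = 1" by (simp add: h_def crank_def ones_def largest_part_def)
  ultimately show ?thesis using s_eq by (simp add: h_def)
qed

text \<open>The term \<open>(z - 1) * q\<close> measures the convention at size 1: the product has
  the coefficient \<open>z + 1 / z - 1\<close> there, while the partition of 1 has crank -1 and
  contributes \<open>1 / z\<close>.\<close>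

lemma crank_gf_has_sum:
  "((\<lambda>\<pi>. z powi crank \<pi> * q ^ sum_mset \<pi>) has_sum (crank_gf q z - (z - 1) * q)) (msets {1..})"
proof -
  define g where "g = (\<lambda>\<pi>. z powi crank \<pi> * q ^ sum_mset \<pi>)"
  have z0: "z \<noteq> 0" using z by auto
  obtain A where A: "(g has_sum A) (msets {1..})"
    using abs_summable_summable[OF crank_summable] unfolding g_def summable_on_def by blast
  hence A': "((\<lambda>x. g (case x of (n, \<sigma>) \<Rightarrow> replicate_mset n 1 + \<sigma>)) has_sum A) (UNIV \<times> msets {2..})"
    by (subst has_sum_reindex_bij_betw[OF msets_1_bij])
  define b where "b = (\<lambda>m. (1 - q) / qpoch (z * q) q * (qfac (z * q) q m / qfac q q m * (q / z) ^ m))"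
  define b' where "b' = (\<lambda>m. b m - (if m = 0 then (z - 1) * q else 0))"
  have "(b' has_sum A) UNIV"
  proof (rule has_sum_SigmaD[OF A'])
    fix m
    show "((\<lambda>\<sigma>. g (case (m, \<sigma>) of (n, \<sigma>) \<Rightarrow> replicate_mset n 1 + \<sigma>)) has_sum b' m) (msets {2..})"
    proof (cases "m = 0")
      case True
      thus ?thesis using no_ones_gf by (simp add: b'_def b_def g_def)
    next
      case False
      hence m: "m \<ge> 1" by simp
      have "((\<lambda>\<sigma>. (q / z) ^ m * mset_weight (\<lambda>j. q ^ j * (if j > m then z else 1)) \<sigma>) has_sum
          ((q / z) ^ m * ((1 - q) / qpoch (z * q) q * (qfac (z * q) q m / qfac q q m)))) (msets {2..})"
        by (intro has_sum_cmult_right msets_small_large_parts m)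
      also have "(q / z) ^ m * ((1 - q) / qpoch (z * q) q * (qfac (z * q) q m / qfac q q m)) = b' m"
        using False by (simp add: b'_def b_def mult_ac)
      finally show ?thesis
        by (rule has_sum_cong[THEN iffD1, rotated])
          (use crank_summand[OF m] in \<open>simp add: g_def mult.assoc\<close>)
    qed
  qed
  hence "b' sums A" by (rule has_sum_imp_sums)
  moreover have "b sums ((1 - q) / qpoch (z * q) q * (qpoch (z * q * (q / z)) q / qpoch (q / z) q))"
    unfolding b_def by (intro sums_mult q_binomial q(1) qz_less)
  hence "b' sums ((1 - q) / qpoch (z * q) q * (qpoch (z * q * (q / z)) q / qpoch (q / z) q) - (z - 1) * q)"
    unfolding b'_def by (intro sums_diff) (use sums_single[of 0 "\<lambda>_. (z - 1) * q"] in simp_all)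
  ultimately have "A = (1 - q) / qpoch (z * q) q * (qpoch (z * q * (q / z)) q / qpoch (q / z) q) - (z - 1) * q"
    by (rule sums_unique2)
  also have "z * q * (q / z) = q\<^sup>2" using z0 by (simp add: power2_eq_square)
  also have "(1 - q) / qpoch (z * q) q * (qpoch (q\<^sup>2) q / qpoch (q / z) q) = crank_gf q z"
    using qpoch_rec[OF q(1), of q] by (simp add: crank_gf_def power2_eq_square)
  finally show ?thesis using A by (simp add: g_def)
qed

end

section \<open>Fourier analysis modulo p\<close>

lemma partitions_subset: "partitions n \<subseteq> msets {1..}"
  by (auto simp: partitions_def Suc_le_eq intro!: gr0I)

lemma finite_partitions [simp]: "finite (partitions n)"
proof (rule ccontr)
  assume "infinite (partitions n)"
  hence "\<not> (\<lambda>_. (1 / 2 :: real) ^ n) summable_on partitions n"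
    by (intro infsum_diverge_constant) auto
  moreover have "(\<lambda>\<pi>. (1 / 2 :: real) ^ sum_mset \<pi>) summable_on partitions n"
    by (rule summable_on_subset_banach[OF msets_power_summable(1) partitions_subset]) auto
  hence "(\<lambda>_. (1 / 2 :: real) ^ n) summable_on partitions n"
    by (rule summable_on_cong[THEN iffD1, rotated]) (auto simp: partitions_def)
  ultimately show False by blast
qed

lemma has_sum_partitions:
  fixes g :: "nat multiset \<Rightarrow> 'a::banach"
  assumes "(g has_sum A) (msets {1..})"
  shows "((\<lambda>n. \<Sum>\<pi>\<in>partitions n. g \<pi>) has_sum A) UNIV"
proof -
  have "bij_betw (\<lambda>(n, \<pi>). \<pi>) (SIGMA n:UNIV. partitions n) (msets {1..})"
    by (rule bij_betwI[where g = "\<lambda>\<pi>. (sum_mset \<pi>, \<pi>)"])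
      (auto simp: partitions_def Suc_le_eq subset_iff intro!: gr0I)
  hence "((\<lambda>x. g (case x of (n, \<pi>) \<Rightarrow> \<pi>)) has_sum A) (SIGMA n:UNIV. partitions n)"
    using assms by (subst has_sum_reindex_bij_betw)
  thus ?thesis
    by (rule has_sum_SigmaD) (auto intro: has_sum_finite)
qed

definition crank_ones_poly :: "nat \<Rightarrow> complex \<Rightarrow> complex" where
  "crank_ones_poly n z = (\<Sum>\<pi>\<in>partitions n. of_nat (ones \<pi>) * z powi crank \<pi>)"

text \<open>The summand \<open>z - 1\<close> at \<open>n = 1\<close> restores the conventional
  values used by \<open>crank_count\<close>. It vanishes at \<open>z = 1\<close>, so the value there
  is still the number of partitions.\<close>

definition crank_poly :: "nat \<Rightarrow> complex \<Rightarrow> complex" where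
  "crank_poly n z = (\<Sum>\<pi>\<in>partitions n. z powi crank \<pi>) + (if n = 1 then z - 1 else 0)"

lemma crank_ones_poly_sums:
  assumes "norm q < 1" "q \<noteq> 0" "norm z = 1"
  shows "(\<lambda>n. crank_ones_poly n z * q ^ n) sums (crank_gf q z * (qlog (q\<^sup>2) q - qlog (q / z) q))"
proof -
  have "((\<lambda>n. \<Sum>\<pi>\<in>partitions n. of_nat (ones \<pi>) * z powi crank \<pi> * q ^ sum_mset \<pi>)
           has_sum (crank_gf q z * (qlog (q\<^sup>2) q - qlog (q / z) q))) UNIV"
    by (rule has_sum_partitions[OF crank_ones_gf_has_sum[OF assms]])
  also have "(\<lambda>n. \<Sum>\<pi>\<in>partitions n. of_nat (ones \<pi>) * z powi crank \<pi> * q ^ sum_mset \<pi>) =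
      (\<lambda>n. crank_ones_poly n z * q ^ n)"
    by (intro ext) (auto simp: crank_ones_poly_def sum_distrib_right partitions_def intro!: sum.cong)
  finally show ?thesis by (rule has_sum_imp_sums)
qed

lemma crank_poly_sums:
  assumes "norm q < 1" "q \<noteq> 0" "norm z = 1"
  shows "(\<lambda>n. crank_poly n z * q ^ n) sums crank_gf q z"
proof -
  have "((\<lambda>n. \<Sum>\<pi>\<in>partitions n. z powi crank \<pi> * q ^ sum_mset \<pi>)
           has_sum (crank_gf q z - (z - 1) * q)) UNIV"
    by (rule has_sum_partitions[OF crank_gf_has_sum[OF assms]])
  also have "(\<lambda>n. \<Sum>\<pi>\<in>partitions n. z powi crank \<pi> * q ^ sum_mset \<pi>) =
      (\<lambda>n. (\<Sum>\<pi>\<in>partitions n. z powi crank \<pi>) * q ^ n)"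
    by (intro ext) (auto simp: sum_distrib_right partitions_def intro!: sum.cong)
  finally have "(\<lambda>n. (\<Sum>\<pi>\<in>partitions n. z powi crank \<pi>) * q ^ n) sums (crank_gf q z - (z - 1) * q)"
    by (rule has_sum_imp_sums)
  from sums_add[OF this sums_single[of 1 "\<lambda>n. (z - 1) * q ^ n"]]
  have "(\<lambda>n. (\<Sum>\<pi>\<in>partitions n. z powi crank \<pi>) * q ^ n + (if n = 1 then (z - 1) * q ^ n else 0)) sums crank_gf q z"
    by simp
  also have "(\<lambda>n. (\<Sum>\<pi>\<in>partitions n. z powi crank \<pi>) * q ^ n + (if n = 1 then (z - 1) * q ^ n else 0)) =
     (\<lambda>n. crank_poly n z * q ^ n)"
    by (auto simp: crank_poly_def algebra_simps)
  finally show ?thesis .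
qed

lemma partitions_0: "partitions 0 = {{#}}"
proof -
  have "\<pi> = {#}" if "0 \<notin># \<pi>" "sum_mset \<pi> = 0" for \<pi> :: "nat multiset"
    using that by (cases \<pi>) auto
  thus ?thesis by (auto simp: partitions_def)
qed

lemma partitions_1: "partitions 1 = {{#1#}}"
proof -
  have "\<pi> = {#1#}" if "0 \<notin># \<pi>" "sum_mset \<pi> = 1" for \<pi> :: "nat multiset"
  proof (cases \<pi>)
    case (add x \<sigma>)
    hence "x + sum_mset \<sigma> = 1" "x > 0" "0 \<notin># \<sigma>" using that by auto
    hence "x = 1" "sum_mset \<sigma> = 0" "0 \<notin># \<sigma>" by linarith+
    moreover from this have "\<sigma> = {#}" by (cases \<sigma>) auto
    ultimately show ?thesis using add by simp
  qed (use that in auto)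
  thus ?thesis by (auto simp: partitions_def)
qed

lemma crank_poly_eq:
  assumes "z \<noteq> 0"
  shows "finite {m. crank_count m n \<noteq> 0}"
    and "crank_poly n z = (\<Sum>m | crank_count m n \<noteq> 0. of_int (crank_count m n) * z powi m)"
proof -
  consider "n = 0" | "n = 1" | "n \<ge> 2" by linarith
  hence "finite {m. crank_count m n \<noteq> 0} \<and>
    crank_poly n z = (\<Sum>m | crank_count m n \<noteq> 0. of_int (crank_count m n) * z powi m)"
  proof cases
    case 1
    hence "{m. crank_count m n \<noteq> 0} = {0}" by (auto simp: crank_count_def)
    thus ?thesis using 1
      by (simp add: crank_poly_def partitions_0 crank_count_def crank_def ones_def largest_part_def)
  next
    case 2
    hence "{m. crank_count m n \<noteq> 0} = {0, 1, -1}" by (auto simp: crank_count_def)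
    thus ?thesis using 2
      by (simp add: crank_poly_def partitions_1[simplified] crank_count_def crank_def ones_def)
  next
    case 3
    have supp: "{m. crank_count m n \<noteq> 0} = crank ` partitions n"
      using 3 by (auto simp: crank_count_def card_eq_0_iff)
    have "crank_poly n z = (\<Sum>m\<in>crank ` partitions n. \<Sum>\<pi> | \<pi> \<in> partitions n \<and> crank \<pi> = m. z powi crank \<pi>)"
      using 3 by (simp add: crank_poly_def sum.image_gen[of _ _ crank])
    also have "\<dots> = (\<Sum>m\<in>crank ` partitions n. of_int (crank_count m n) * z powi m)"
      using 3 by (intro sum.cong) (auto simp: crank_count_def)
    finally show ?thesis using supp by simp
  qed
  thus "finite {m. crank_count m n \<noteq> 0}"
    "crank_poly n z = (\<Sum>m | crank_count m n \<noteq> 0. of_int (crank_count m n) * z powi m)" by auto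
qed

lemma crank_poly_1: "crank_poly n 1 = of_nat (num_partitions n)"
  by (simp add: crank_poly_def num_partitions_def)

section \<open>Exponentials, roots of unity and their orthogonality\<close>

lemma nome_add: "nome (x + y) = nome x * nome y"
  by (simp add: nome_def ring_distribs exp_add)

lemma nome_minus: "nome (- x) = inverse (nome x)"
  by (simp add: nome_def exp_minus)

lemma nome_diff: "nome (x - y) = nome x / nome y"
  by (simp add: nome_def ring_distribs exp_diff)

lemma nome_nonzero [simp]: "nome x \<noteq> 0"
  by (simp add: nome_def)

lemma nome_0 [simp]: "nome 0 = 1"
  by (simp add: nome_def)

lemma nome_of_int [simp]: "nome (of_int n) = 1"
  unfolding nome_def using exp_integer_2pi[of "of_int n"] by (simp add: mult_ac)

lemma nome_1 [simp]: "nome 1 = 1"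
  using nome_of_int[of 1] by simp

lemma nome_of_nat [simp]: "nome (of_nat n) = 1"
  using nome_of_int[of "int n"] by simp

lemma nome_powi: "nome x powi n = nome (of_int n * x)"
  by (cases n rule: int_cases4)
    (simp_all add: nome_def power_int_def mult_ac flip: exp_of_nat_mult exp_minus)

lemma nome_power: "nome x ^ n = nome (of_nat n * x)"
  using nome_powi[of x "int n"] by simp

lemma norm_nome: "norm (nome x) = exp (- 2 * pi * Im x)"
  by (simp add: nome_def norm_exp_eq_Re)

lemma nome_eq_1_iff: "nome x = 1 \<longleftrightarrow> x \<in> \<int>"
proof
  assume "nome x = 1"
  then obtain n :: int where "2 * of_real pi * \<i> * x = 2 * of_int n * of_real pi * \<i>"
    unfolding nome_def exp_eq_1 by (auto simp: complex_eq_iff)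
  hence "x = of_int n" by simp
  thus "x \<in> \<int>" by simp
qed (auto elim!: Ints_cases)

lemma nome_frac_neq_1:
  assumes "j \<in> {1..p-1}"
  shows "nome (of_nat j / of_nat p) \<noteq> 1"
proof
  have p: "p > 0" using assms by (cases p) auto
  assume "nome (of_nat j / of_nat p) = 1"
  then obtain k where "of_nat j / of_nat p = (of_int k :: complex)"
    unfolding nome_eq_1_iff by (auto elim: Ints_cases)
  hence "(of_int (int j) :: complex) = of_int (k * int p)" using p by (simp add: field_simps)
  hence "int j = k * int p" using of_int_eq_iff by blast
  hence "int p dvd int j" by simp
  hence "p dvd j" by simp
  thus False using assms by (auto dest!: dvd_imp_le)
qed

lemma norm_nome_frac [simp]: "norm (nome (of_nat j / of_nat p)) = 1"
  by (simp add: norm_nome)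

lemma root_filter:
  assumes "p > 0"
  shows "(\<Sum>j<p. nome (of_nat j * of_int m / of_nat p)) = (if int p dvd m then of_nat p else 0)"
proof -
  define w where "w = nome (of_int m / of_nat p)"
  have eq: "(\<Sum>j<p. nome (of_nat j * of_int m / of_nat p)) = (\<Sum>j<p. w ^ j)"
    by (simp add: w_def nome_power)
  have wp: "w ^ p = 1" using assms by (simp add: w_def nome_power)
  show ?thesis
  proof (cases "int p dvd m")
    case True
    then obtain k where "m = int p * k" by auto
    hence "w = 1" using assms by (simp add: w_def)
    thus ?thesis using True by (simp add: eq)
  next
    case False
    have "w \<noteq> 1"
    proof
      assume "w = 1"
      then obtain k where "of_int m / of_nat p = (of_int k :: complex)"
        unfolding w_def nome_eq_1_iff by (auto elim: Ints_cases)
      hence "(of_int m :: complex) = of_int (int p * k)" using assms by (simp add: field_simps)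
      hence "m = int p * k" using of_int_eq_iff by blast
      thus False using False by simp
    qed
    hence "(\<Sum>j<p. w ^ j) = 0" using wp by (simp add: geometric_sum)
    thus ?thesis using False eq by simp
  qed
qed

lemma root_filter_powi:
  assumes "p > 0"
  shows "(\<Sum>j<p. nome (- (of_nat j * of_int r / of_nat p)) * nome (of_nat j / of_nat p) powi m) =
           (if [m = r] (mod int p) then of_nat p else 0)"
proof -
  have "nome (- (of_nat j * of_int r / of_nat p)) * nome (of_nat j / of_nat p) powi m =
          nome (of_nat j * of_int (m - r) / of_nat p)" for j
    by (simp add: nome_powi flip: nome_add) (simp add: algebra_simps diff_divide_distrib)
  hence "(\<Sum>j<p. nome (- (of_nat j * of_int r / of_nat p)) * nome (of_nat j / of_nat p) powi m) =
           (if int p dvd m - r then of_nat p else 0)"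
    using root_filter[OF assms, of "m - r"] by simp
  thus ?thesis by (simp add: cong_iff_dvd_diff)
qed

lemma fourier_swap:
  assumes "p > 0" "finite X"
  shows "(\<Sum>j<p. nome (- (of_nat j * of_int r / of_nat p)) * (\<Sum>x\<in>X. c x * nome (of_nat j / of_nat p) powi m x))
     = of_nat p * (\<Sum>x | x \<in> X \<and> [m x = r] (mod int p). c x)"
proof -
  have "(\<Sum>j<p. nome (- (of_nat j * of_int r / of_nat p)) * (\<Sum>x\<in>X. c x * nome (of_nat j / of_nat p) powi m x))
     = (\<Sum>j<p. \<Sum>x\<in>X. c x * (nome (- (of_nat j * of_int r / of_nat p)) * nome (of_nat j / of_nat p) powi m x))"
    by (simp add: sum_distrib_left mult_ac)
  also have "\<dots> = (\<Sum>x\<in>X. c x * (\<Sum>j<p. (nome (- (of_nat j * of_int r / of_nat p)) * nome (of_nat j / of_nat p) powi m x)))"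
    by (subst sum.swap) (simp add: sum_distrib_left)
  also have "\<dots> = (\<Sum>x\<in>X. if [m x = r] (mod int p) then of_nat p * c x else 0)"
    unfolding root_filter_powi[OF assms(1)] by (intro sum.cong) auto
  also have "\<dots> = (\<Sum>x | x \<in> X \<and> [m x = r] (mod int p). of_nat p * c x)"
    using assms(2) by (subst sum.inter_filter) auto
  finally show ?thesis by (simp add: sum_distrib_left)
qed

lemma crank_ones_fourier:
  assumes "p > 0"
  shows "of_nat (crank_ones r p n) =
    (\<Sum>j<p. nome (- (of_nat j * of_int r / of_nat p)) * crank_ones_poly n (nome (of_nat j / of_nat p))) / of_nat p"
  unfolding crank_ones_poly_def using assms
  by (subst fourier_swap) (auto simp: crank_ones_def)

lemma crank_count_mod_fourier:
  assumes "p > 0"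
  shows "of_int (crank_count_mod a p n) =
    (\<Sum>j<p. nome (- (of_nat j * of_int a / of_nat p)) * crank_poly n (nome (of_nat j / of_nat p))) / of_nat p"
proof -
  have "{m. crank_count m n \<noteq> 0 \<and> [m = a] (mod int p)} = {m. [m = a] (mod int p) \<and> crank_count m n \<noteq> 0}"
    by auto
  thus ?thesis
    unfolding crank_poly_eq(2)[OF nome_nonzero] using assms crank_poly_eq(1)[of 1 n]
    by (subst fourier_swap) (auto simp: crank_count_mod_def)
qed

text \<open>The term \<open>j = 0\<close> of the Fourier expansion is
  \<open>crank_poly n 1 / p\<close>, exactly the mean value that the deviation subtracts.\<close>

lemma crank_deviation_fourier:
  assumes "p > 0"
  shows "of_int (crank_count_mod a p n) - of_nat (num_partitions n) / of_nat p =
    (\<Sum>j=1..p-1. nome (- (of_nat j * of_int a / of_nat p)) * crank_poly n (nome (of_nat j / of_nat p))) / of_nat p"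
proof -
  have "{..<p} = insert 0 {1..p-1}" using assms by auto
  thus ?thesis
    unfolding crank_count_mod_fourier[OF assms] by (simp add: crank_poly_1 add_divide_distrib)
qed

text \<open>The weights are the sawtooth \<open>1 / 2 - r / p\<close>, whose finite Fourier
  transform is a cotangent: for \<open>z = nome x\<close> the right-hand side equals
  \<open>\<i> / 2 * cot (pi * x)\<close>. This is the contribution of the sine factor to the
  logarithmic derivative of the theta function.\<close>

lemma sawtooth_sum:
  fixes z :: complex
  assumes "z ^ p = 1" "z \<noteq> 1" "p > 0"
  shows "(\<Sum>r=1..p-1. (of_nat p - 2 * of_nat r) / (2 * of_nat p) * z ^ r) = (1 + z) / (2 * (1 - z))"
proof -
  \<comment> \<open>Telescoping; at \<open>n = p\<close> the geometric sum vanishes and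
    \<open>z ^ p = 1\<close>, which leaves \<open>- p\<close>.\<close>
  have A: "(1 - z) * (\<Sum>r<n. of_nat r * z ^ r) = (\<Sum>r<n. z ^ r) - 1 - (of_nat n - 1) * z ^ n" for n
    by (induction n) (simp_all add: algebra_simps)
  have B: "(\<Sum>r<p. z ^ r) = 0" using assms by (simp add: geometric_sum)
  have C: "(1 - z) * (\<Sum>r<p. of_nat r * z ^ r) = - of_nat p"
    using A[of p] B assms by simp
  have D: "{..<p} = insert 0 {1..p-1}" using assms by auto
  have "(\<Sum>r=1..p-1. (of_nat p - 2 * of_nat r) / (2 * of_nat p) * z ^ r) =
        (\<Sum>r<p. (of_nat p - 2 * of_nat r) / (2 * of_nat p) * z ^ r) - 1 / 2"
    unfolding D using assms by simp
  also have "(\<Sum>r<p. (of_nat p - 2 * of_nat r) / (2 * of_nat p) * z ^ r) =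
      (\<Sum>r<p. 1 / 2 * z ^ r - 1 / of_nat p * (of_nat r * z ^ r))"
    using assms by (intro sum.cong) (auto simp: field_simps)
  also have "\<dots> = 1 / 2 * (\<Sum>r<p. z ^ r) - 1 / of_nat p * (\<Sum>r<p. of_nat r * z ^ r)"
    by (simp only: sum_subtractf sum_distrib_left)
  also have "(\<Sum>r<p. of_nat r * z ^ r) = - of_nat p / (1 - z)"
    using C assms by (simp add: field_simps)
  finally show ?thesis using assms B by (simp add: field_simps)
qed

text \<open>The coefficient before dissection: \<open>crank_ones_remainder\<close> collects the
  values at the indices \<open>p * n + k\<close>.\<close>

definition remainder_coeff :: "nat \<Rightarrow> nat \<Rightarrow> nat \<Rightarrow> complex" where
  "remainder_coeff p s n =
     (of_nat (crank_ones (int s) p n) - of_nat (crank_ones (int p - int s) p n))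
     - (\<Sum>r = 1..p - 1. (of_nat p - 2 * of_nat r) / (2 * of_nat p)
          * (of_int (crank_count_mod (int r - int s) p n) - of_nat (num_partitions n) / of_nat p))"

lemma sum_reflect:
  fixes f :: "nat \<Rightarrow> 'a::comm_monoid_add"
  shows "(\<Sum>j=1..p-1. f j) = (\<Sum>j=1..p-1. f (p - j))"
  by (rule sum.reindex_bij_witness[of _ "\<lambda>j. p - j" "\<lambda>j. p - j"]) auto

text \<open>In the Fourier expansions the reflection of \<open>j\<close> to \<open>p - j\<close>
  exchanges a root of unity with its inverse and the class \<open>p - s\<close> with
  \<open>s\<close>. The terms \<open>j = 0\<close> cancel between the two counts of ones and are
  absent from the deviations. The sum over \<open>r\<close> is then the sawtooth sum at each
  root.\<close>

lemma remainder_coeff_eq: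
  assumes p: "p > 0"
  shows "remainder_coeff p s n = (\<Sum>j=1..p-1. nome (- (of_nat j * of_nat s / of_nat p)) *
     (crank_ones_poly n (nome (of_nat j / of_nat p)) - crank_ones_poly n (inverse (nome (of_nat j / of_nat p)))
      - crank_poly n (inverse (nome (of_nat j / of_nat p)))
          * ((1 + nome (of_nat j / of_nat p)) / (2 * (1 - nome (of_nat j / of_nat p)))))) / of_nat p"
proof -
  let ?z = "\<lambda>j. nome (of_nat j / of_nat p)"
  let ?w = "\<lambda>j. nome (- (of_nat j * of_nat s / of_nat p))"
  have z_refl: "?z (p - j) = inverse (?z j)" if "j \<in> {1..p-1}" for j
  proof -
    have "of_nat (p - j) = (of_nat p - of_nat j :: complex)" using that by (intro of_nat_diff) auto
    thus ?thesis using p by (simp add: diff_divide_distrib nome_diff inverse_eq_divide)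
  qed
  have w_refl: "inverse (?w (p - j)) = ?w j" if "j \<in> {1..p-1}" for j
  proof -
    have "of_nat (p - j) * of_nat s / of_nat p = of_nat s - (of_nat j * of_nat s / of_nat p :: complex)"
    proof -
      have of_diff: "of_nat (p - j) = (of_nat p - of_nat j :: complex)" using that by (intro of_nat_diff) auto
      show ?thesis unfolding of_diff using p by (simp add: field_simps)
    qed
    thus ?thesis by (simp add: nome_minus nome_diff)
  qed
  have D: "{..<p} = insert 0 {1..p-1}" using p by auto
  have *: "nome (- (of_nat j * of_int (int p - int s) / of_nat p)) = inverse (?w j)" for j
  proof -
    have "- (of_nat j * of_int (int p - int s) / of_nat p) =
        of_nat j * of_nat s / of_nat p - (of_nat j :: complex)" using p by (simp add: field_simps)
    thus ?thesis by (simp add: nome_diff nome_minus)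
  qed
  have "of_nat (crank_ones (int s) p n) - of_nat (crank_ones (int p - int s) p n) =
    ((\<Sum>j=1..p-1. ?w j * crank_ones_poly n (?z j)) - (\<Sum>j=1..p-1. inverse (?w j) * crank_ones_poly n (?z j))) / of_nat p"
    unfolding crank_ones_fourier[OF p] * D by (simp add: diff_divide_distrib add_divide_distrib)
  also have "(\<Sum>j=1..p-1. inverse (?w j) * crank_ones_poly n (?z j)) =
      (\<Sum>j=1..p-1. ?w j * crank_ones_poly n (inverse (?z j)))"
    by (subst sum_reflect) (intro sum.cong refl; simp add: z_refl w_refl)
  finally have 1: "of_nat (crank_ones (int s) p n) - of_nat (crank_ones (int p - int s) p n) =
    ((\<Sum>j=1..p-1. ?w j * crank_ones_poly n (?z j)) - (\<Sum>j=1..p-1. ?w j * crank_ones_poly n (inverse (?z j)))) / of_nat p" .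
  have "(\<Sum>r = 1..p - 1. (of_nat p - 2 * of_nat r) / (2 * of_nat p)
          * (of_int (crank_count_mod (int r - int s) p n) - of_nat (num_partitions n) / of_nat p)) =
      (\<Sum>r = 1..p - 1. \<Sum>j=1..p-1. (of_nat p - 2 * of_nat r) / (2 * of_nat p) *
          (inverse (?w j) * inverse (?z j) ^ r * crank_poly n (?z j)) / of_nat p)"
  proof (intro sum.cong refl)
    fix r
    have "nome (- (of_nat j * of_int (int r - int s) / of_nat p)) = inverse (?w j) * inverse (?z j) ^ r" for j
    proof -
      have "- (of_nat j * of_int (int r - int s) / of_nat p) =
        of_nat j * of_nat s / of_nat p - (of_nat r * (of_nat j / of_nat p) :: complex)" using p by (simp add: field_simps)
      thus ?thesis by (simp add: nome_diff nome_minus nome_power power_inverse) (simp add: field_simps)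
    qed
    thus "(of_nat p - 2 * of_nat r) / (2 * of_nat p)
          * (of_int (crank_count_mod (int r - int s) p n) - of_nat (num_partitions n) / of_nat p) =
       (\<Sum>j=1..p-1. (of_nat p - 2 * of_nat r) / (2 * of_nat p) *
          (inverse (?w j) * inverse (?z j) ^ r * crank_poly n (?z j)) / of_nat p)"
      unfolding crank_deviation_fourier[OF p] by (simp add: sum_distrib_left sum_divide_distrib)
  qed
  also have "\<dots> = (\<Sum>j=1..p-1. inverse (?w j) * crank_poly n (?z j) *
        (\<Sum>r = 1..p - 1. (of_nat p - 2 * of_nat r) / (2 * of_nat p) * inverse (?z j) ^ r)) / of_nat p"
    by (subst sum.swap) (simp add: sum_distrib_left sum_divide_distrib mult_ac)
  also have "(\<Sum>j=1..p-1. inverse (?w j) * crank_poly n (?z j) *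
        (\<Sum>r = 1..p - 1. (of_nat p - 2 * of_nat r) / (2 * of_nat p) * inverse (?z j) ^ r)) =
      (\<Sum>j=1..p-1. ?w j * crank_poly n (inverse (?z j)) *
        (\<Sum>r = 1..p - 1. (of_nat p - 2 * of_nat r) / (2 * of_nat p) * ?z j ^ r))"
    by (subst sum_reflect) (intro sum.cong refl; simp add: z_refl w_refl)
  also have "\<dots> = (\<Sum>j=1..p-1. ?w j * crank_poly n (inverse (?z j)) * ((1 + ?z j) / (2 * (1 - ?z j))))"
  proof (intro sum.cong refl)
    fix j assume j: "j \<in> {1..p-1}"
    have "?z j \<noteq> 1" by (rule nome_frac_neq_1[OF j])
    thus "?w j * crank_poly n (inverse (?z j)) * (\<Sum>r = 1..p - 1. (of_nat p - 2 * of_nat r) / (2 * of_nat p) * ?z j ^ r) =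
        ?w j * crank_poly n (inverse (?z j)) * ((1 + ?z j) / (2 * (1 - ?z j)))"
      using p by (subst sawtooth_sum) (auto simp: nome_power)
  qed
  finally show ?thesis unfolding remainder_coeff_def 1
    by (simp add: right_diff_distrib sum_subtractf diff_divide_distrib mult.assoc)
qed

lemma crank_gf_inverse: "crank_gf q (inverse z) = crank_gf q z"
  by (simp add: crank_gf_def divide_inverse mult_ac)

text \<open>Since \<open>crank_gf\<close> is invariant under inversion of \<open>z\<close>, the term
  \<open>qlog (q\<^sup>2) q\<close> cancels and only the part odd under inversion survives.\<close>

lemma remainder_coeff_sums:
  assumes p: "p > 0" and q: "norm q < 1" "q \<noteq> 0"
  shows "(\<lambda>n. remainder_coeff p s n * q ^ n) sums
    ((\<Sum>j=1..p-1. nome (- (of_nat j * of_nat s / of_nat p)) * crank_gf q (nome (of_nat j / of_nat p)) *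
       (qlog (q * nome (of_nat j / of_nat p)) q - qlog (q / nome (of_nat j / of_nat p)) q
         - (1 + nome (of_nat j / of_nat p)) / (2 * (1 - nome (of_nat j / of_nat p))))) / of_nat p)"
proof -
  let ?z = "\<lambda>j. nome (of_nat j / of_nat p)"
  let ?w = "\<lambda>j. nome (- (of_nat j * of_nat s / of_nat p))"
  have z: "norm (?z j) = 1" "norm (inverse (?z j)) = 1" for j
    by (simp_all add: norm_inverse)
  have "(\<lambda>n. (\<Sum>j=1..p-1. ?w j * ((crank_ones_poly n (?z j) * q ^ n - crank_ones_poly n (inverse (?z j)) * q ^ n)
      - (crank_poly n (inverse (?z j)) * q ^ n) * ((1 + ?z j) / (2 * (1 - ?z j))))) / of_nat p) sums
      ((\<Sum>j=1..p-1. ?w j * ((crank_gf q (?z j) * (qlog (q\<^sup>2) q - qlog (q / ?z j) q) -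
            crank_gf q (inverse (?z j)) * (qlog (q\<^sup>2) q - qlog (q / inverse (?z j)) q))
      - crank_gf q (inverse (?z j)) * ((1 + ?z j) / (2 * (1 - ?z j))))) / of_nat p)"
    by (intro sums_divide sums_sum sums_mult sums_diff sums_mult2 crank_ones_poly_sums crank_poly_sums q z)
  also have "(\<lambda>n. (\<Sum>j=1..p-1. ?w j * ((crank_ones_poly n (?z j) * q ^ n - crank_ones_poly n (inverse (?z j)) * q ^ n)
      - (crank_poly n (inverse (?z j)) * q ^ n) * ((1 + ?z j) / (2 * (1 - ?z j))))) / of_nat p) =
      (\<lambda>n. remainder_coeff p s n * q ^ n)"
    unfolding remainder_coeff_eq[OF p] times_divide_eq_left sum_distrib_right
    by (intro ext arg_cong2[where f = "(/)"] sum.cong refl) (simp add: algebra_simps)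
  also have "(\<Sum>j=1..p-1. ?w j * ((crank_gf q (?z j) * (qlog (q\<^sup>2) q - qlog (q / ?z j) q) -
            crank_gf q (inverse (?z j)) * (qlog (q\<^sup>2) q - qlog (q / inverse (?z j)) q))
      - crank_gf q (inverse (?z j)) * ((1 + ?z j) / (2 * (1 - ?z j))))) =
     (\<Sum>j=1..p-1. ?w j * crank_gf q (?z j) *
       (qlog (q * ?z j) q - qlog (q / ?z j) q - (1 + ?z j) / (2 * (1 - ?z j))))"
  proof -
    have "q / inverse x = q * x" for x :: complex by (simp add: divide_inverse)
    thus ?thesis unfolding crank_gf_inverse by (intro sum.cong refl) (simp add: algebra_simps)
  qed
  finally show ?thesis .
qed

section \<open>The normalised theta function\<close>

text \<open>The sine times the two products is Jacobi's theta function up to a factor independent of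
  \<open>x\<close>. The division by \<open>pi\<close> and by the squared Euler product makes the
  derivative at 0 equal to 1.\<close>

definition kappa :: "complex \<Rightarrow> complex \<Rightarrow> complex" where
  "kappa x \<tau> = sin (of_real pi * x) / of_real pi *
     (qpoch (nome \<tau> * nome x) (nome \<tau>) * qpoch (nome \<tau> / nome x) (nome \<tau>)) / qpoch (nome \<tau>) (nome \<tau>) ^ 2"

lemma norm_nome_less_1: "Im \<tau> > 0 \<Longrightarrow> norm (nome \<tau>) < 1"
  by (simp add: norm_nome)

lemma nome_holomorphic [holomorphic_intros]:
  "f holomorphic_on A \<Longrightarrow> (\<lambda>x. nome (f x)) holomorphic_on A"
  unfolding nome_def by (intro holomorphic_intros)

lemma kappa_holomorphic [holomorphic_intros]:
  assumes "f holomorphic_on A" "g holomorphic_on A" "open A" "\<And>x. x \<in> A \<Longrightarrow> Im (g x) > 0"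
  shows "(\<lambda>x. kappa (f x) (g x)) holomorphic_on A"
  unfolding kappa_def using assms qpoch_nonzero' norm_nome_less_1
  by (intro holomorphic_intros) (auto simp: norm_nome_less_1 qpoch_nonzero')

lemma sin_nome: "sin (of_real pi * x) = nome (- x / 2) * (nome x - 1) / (2 * \<i>)"
proof -
  have "nome (- x / 2) * (nome x - 1) = exp (\<i> * (of_real pi * x)) - exp (- (\<i> * (of_real pi * x)))"
    by (simp add: nome_def algebra_simps flip: exp_add)
  thus ?thesis by (simp add: sin_exp_eq)
qed

lemma nome_half_int: "nome (of_int k / 2) = (if even k then 1 else -1)"
proof (cases "even k")
  case True
  then obtain m where "k = 2 * m" by auto
  thus ?thesis by simp
next
  case False
  then obtain m where k: "k = 2 * m + 1" by (rule oddE)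
  have "nome (1 / 2) = -1" by (simp add: nome_def mult.commute)
  thus ?thesis by (simp add: k add_divide_distrib nome_add)
qed

lemma kappa_0 [simp]: "kappa 0 \<tau> = 0"
  by (simp add: kappa_def)

lemma kappa_add_1: "kappa (x + 1) \<tau> = - kappa x \<tau>"
  using nome_half_int[of 1]
  by (simp add: kappa_def sin_nome nome_add nome_diff nome_minus add_divide_distrib diff_divide_distrib)

text \<open>The shift multiplies \<open>z\<close> by \<open>q\<close>. The new sine factor
  \<open>z * q - 1\<close> cancels against the factor leaving the first product, and the factor
  \<open>1 - 1 / z\<close> entering the second product restores the old sine factor up to a
  monomial.\<close>

lemma kappa_add_tau:
  assumes "Im \<tau> > 0"
  shows "kappa (x + \<tau>) \<tau> = - nome (- x - \<tau> / 2) * kappa x \<tau>"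
proof -
  define q z where "q = nome \<tau>" and "z = nome x"
  have q: "norm q < 1" "q \<noteq> 0" "z \<noteq> 0" using assms by (auto simp: q_def z_def norm_nome_less_1)
  have 1: "qpoch (q * z) q = (1 - q * z) * qpoch (q * (z * q)) q"
    using qpoch_rec[OF q(1), of "q * z"] by (simp add: mult_ac)
  have 2: "qpoch (q / (z * q)) q = (1 - 1 / z) * qpoch (q / z) q"
    using qpoch_rec[OF q(1), of "1 / z"] q by simp
  have "nome (- (x + \<tau>) / 2) * (z * q - 1) * (qpoch (q * (z * q)) q * qpoch (q / (z * q)) q) =
        nome (- (x + \<tau>) / 2) * (1 / z) * (- (z - 1) * (((1 - q * z) * qpoch (q * (z * q)) q) * qpoch (q / z) q))"
  proof -
    have "1 - 1 / z = 1 / z * (z - 1)" using q by (simp add: field_simps)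
    moreover have "N * (z * q - 1) * (A * ((Z * (z - 1)) * B)) = N * Z * (- (z - 1) * (((1 - q * z) * A) * B))"
      for N Z A B by (simp add: algebra_simps)
    ultimately show ?thesis unfolding 2 by metis
  qed
  also have "\<dots> = - (nome (- (x + \<tau>) / 2) * (1 / z)) * (z - 1) * (qpoch (q * z) q * qpoch (q / z) q)"
  proof -
    have "N * Z * (- (z - 1) * (X * B)) = - (N * Z) * (z - 1) * (X * B)" for N Z X B
      by (simp add: algebra_simps)
    thus ?thesis unfolding 1 by metis
  qed
  also have "nome (- (x + \<tau>) / 2) * (1 / z) = nome (- x - \<tau> / 2) * nome (- x / 2)"
  proof -
    have "nome (- (x + \<tau>) / 2) * (1 / z) = nome (- (x + \<tau>) / 2 - x)" by (simp add: nome_diff z_def)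
    also have "- (x + \<tau>) / 2 - x = (- x - \<tau> / 2) + (- x / 2)" by (simp add: field_simps)
    finally show ?thesis by (simp only: nome_add)
  qed
  finally have main: "nome (- (x + \<tau>) / 2) * (z * q - 1) * (qpoch (q * (z * q)) q * qpoch (q / (z * q)) q) =
      - (nome (- x - \<tau> / 2) * nome (- x / 2)) * (z - 1) * (qpoch (q * z) q * qpoch (q / z) q)" .
  define U where "U = 1 / (2 * \<i>) / of_real pi / qpoch q q ^ 2"
  have kap: "kappa y \<tau> = nome (- y / 2) * (nome y - 1) * (qpoch (q * nome y) q * qpoch (q / nome y) q) * U" for y
    by (simp add: kappa_def sin_nome U_def q_def)
  have "nome (x + \<tau>) = z * q" by (simp add: nome_add q_def z_def)
  hence "kappa (x + \<tau>) \<tau> = (nome (- (x + \<tau>) / 2) * (z * q - 1) * (qpoch (q * (z * q)) q * qpoch (q / (z * q)) q)) * U"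
    by (simp only: kap)
  also have "\<dots> = (- (nome (- x - \<tau> / 2) * nome (- x / 2)) * (z - 1) * (qpoch (q * z) q * qpoch (q / z) q)) * U"
    by (simp only: main)
  also have "\<dots> = - nome (- x - \<tau> / 2) * kappa x \<tau>"
    unfolding kap z_def by simp
  finally show ?thesis .
qed

lemma kappa_shift_tau:
  assumes "Im \<tau> > 0"
  shows "kappa (x + of_int m * \<tau>) \<tau> = nome (of_int m / 2 - of_int m * x - of_int m ^ 2 * \<tau> / 2) * kappa x \<tau>"
proof (induction m rule: int_induct[where k = 0])
  case base
  thus ?case by simp
next
  case (step1 i)
  have "kappa (x + of_int (i + 1) * \<tau>) \<tau> = kappa ((x + of_int i * \<tau>) + \<tau>) \<tau>" by (simp add: algebra_simps)
  also have "\<dots> = nome (1 / 2) * nome (- (x + of_int i * \<tau>) - \<tau> / 2) *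
      (nome (of_int i / 2 - of_int i * x - of_int i ^ 2 * \<tau> / 2) * kappa x \<tau>)"
    using nome_half_int[of 1] by (simp add: kappa_add_tau[OF assms] step1.IH)
  also have "\<dots> = nome (1 / 2 + (- (x + of_int i * \<tau>) - \<tau> / 2) +
      (of_int i / 2 - of_int i * x - of_int i ^ 2 * \<tau> / 2)) * kappa x \<tau>"
    by (simp only: nome_add mult.assoc)
  also have "1 / 2 + (- (x + of_int i * \<tau>) - \<tau> / 2) + (of_int i / 2 - of_int i * x - of_int i ^ 2 * \<tau> / 2) =
      of_int (i + 1) / 2 - of_int (i + 1) * x - of_int (i + 1) ^ 2 * \<tau> / 2"
    by (simp add: field_simps power2_eq_square)
  finally show ?case .
next
  case (step2 i)
  have "kappa (x + of_int i * \<tau>) \<tau> = kappa ((x + of_int (i - 1) * \<tau>) + \<tau>) \<tau>" by (simp add: algebra_simps)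
  also have "\<dots> = nome (1 / 2) * nome (- (x + of_int (i - 1) * \<tau>) - \<tau> / 2) * kappa (x + of_int (i - 1) * \<tau>) \<tau>"
    using nome_half_int[of 1] by (simp add: kappa_add_tau[OF assms])
  also have "\<dots> = nome (1 / 2 + (- (x + of_int (i - 1) * \<tau>) - \<tau> / 2)) * kappa (x + of_int (i - 1) * \<tau>) \<tau>"
    by (simp only: nome_add)
  finally have "kappa (x + of_int (i - 1) * \<tau>) \<tau> =
      kappa (x + of_int i * \<tau>) \<tau> / nome (1 / 2 + (- (x + of_int (i - 1) * \<tau>) - \<tau> / 2))" by simp
  also have "\<dots> = nome ((of_int i / 2 - of_int i * x - of_int i ^ 2 * \<tau> / 2) -
      (1 / 2 + (- (x + of_int (i - 1) * \<tau>) - \<tau> / 2))) * kappa x \<tau>"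
    unfolding step2.IH by (simp add: nome_diff)
  also have "(of_int i / 2 - of_int i * x - of_int i ^ 2 * \<tau> / 2) - (1 / 2 + (- (x + of_int (i - 1) * \<tau>) - \<tau> / 2)) =
      of_int (i - 1) / 2 - of_int (i - 1) * x - of_int (i - 1) ^ 2 * \<tau> / 2"
    by (simp add: field_simps power2_eq_square)
  finally show ?case .
qed

lemma kappa_shift_int: "kappa (x + of_int n) \<tau> = nome (of_int n / 2) * kappa x \<tau>"
proof (induction n rule: int_induct[where k = 0])
  case base
  thus ?case by simp
next
  case (step1 i)
  have "kappa (x + of_int (i + 1)) \<tau> = kappa ((x + of_int i) + 1) \<tau>" by (simp add: algebra_simps)
  also have "\<dots> = - (nome (of_int i / 2) * kappa x \<tau>)" unfolding kappa_add_1 step1.IH ..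
  finally show ?case using nome_half_int[of i] nome_half_int[of "i + 1"] by simp
next
  case (step2 i)
  have "kappa (x + of_int i) \<tau> = kappa ((x + of_int (i - 1)) + 1) \<tau>" by (simp add: algebra_simps)
  also have "\<dots> = - kappa (x + of_int (i - 1)) \<tau>" unfolding kappa_add_1 ..
  finally have "kappa (x + of_int (i - 1)) \<tau> = - nome (of_int i / 2) * kappa x \<tau>" using step2.IH by simp
  thus ?case using nome_half_int[of i] nome_half_int[of "i - 1"] by (simp split: if_splits)
qed

text \<open>Signs are kept as values of \<^const>\<open>nome\<close> at half-integers, so that the automorphy factors combine additively.\<close>

lemma kappa_shift:
  assumes "Im \<tau> > 0"
  shows "kappa (x + of_int m * \<tau> + of_int n) \<tau> =
           nome (of_int (m + n) / 2 - of_int m * x - of_int m ^ 2 * \<tau> / 2) * kappa x \<tau>"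
proof -
  have "kappa (x + of_int m * \<tau> + of_int n) \<tau> = nome (of_int n / 2) *
     (nome (of_int m / 2 - of_int m * x - of_int m ^ 2 * \<tau> / 2) * kappa x \<tau>)"
    unfolding kappa_shift_int kappa_shift_tau[OF assms] ..
  also have "\<dots> = nome (of_int n / 2 + (of_int m / 2 - of_int m * x - of_int m ^ 2 * \<tau> / 2)) * kappa x \<tau>"
    by (simp only: nome_add mult.assoc)
  also have "of_int n / 2 + (of_int m / 2 - of_int m * x - of_int m ^ 2 * \<tau> / 2) =
      of_int (m + n) / 2 - of_int m * x - of_int m ^ 2 * \<tau> / 2"
    by (simp add: field_simps)
  finally show ?thesis .
qed

lemma kappa_eq_0D:
  assumes "Im \<tau> > 0" "kappa x \<tau> = 0"
  shows "\<exists>m n :: int. x = of_int m * \<tau> + of_int n"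
proof -
  have q: "norm (nome \<tau>) < 1" using assms norm_nome_less_1 by blast
  have "qpoch (nome \<tau>) (nome \<tau>) \<noteq> 0" using qpoch_nonzero'[OF q q] .
  then consider "nome x = 1" | "qpoch (nome \<tau> * nome x) (nome \<tau>) = 0" | "qpoch (nome \<tau> / nome x) (nome \<tau>) = 0"
    using assms(2) by (auto simp: kappa_def sin_nome)
  thus ?thesis
  proof cases
    case 1
    then obtain n where "x = of_int n" unfolding nome_eq_1_iff by (auto elim: Ints_cases)
    thus ?thesis by (intro exI[of _ 0] exI[of _ n]) simp
  next
    case 2
    then obtain n where "nome \<tau> * nome x * nome \<tau> ^ n = 1"
      using qpoch_nonzero[OF q] by blast
    hence "nome (of_nat (Suc n) * \<tau> + x) = 1" by (simp add: nome_add nome_power algebra_simps)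
    then obtain m :: int where m: "of_nat (Suc n) * \<tau> + x = of_int m"
      unfolding nome_eq_1_iff by (auto elim: Ints_cases)
    have "x = (of_nat (Suc n) * \<tau> + x) - of_nat (Suc n) * \<tau>" by simp
    hence "x = of_int (- int (Suc n)) * \<tau> + of_int m" unfolding m by (simp add: algebra_simps)
    thus ?thesis by blast
  next
    case 3
    then obtain n where "nome \<tau> / nome x * nome \<tau> ^ n = 1"
      using qpoch_nonzero[OF q] by blast
    hence "nome (of_nat (Suc n) * \<tau> - x) = 1" by (simp add: nome_add nome_diff nome_power algebra_simps)
    then obtain m :: int where m: "of_nat (Suc n) * \<tau> - x = of_int m"
      unfolding nome_eq_1_iff by (auto elim: Ints_cases)
    have "x = of_nat (Suc n) * \<tau> - (of_nat (Suc n) * \<tau> - x)" by simp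
    hence "x = of_int (int (Suc n)) * \<tau> + of_int (- m)" unfolding m by (simp add: algebra_simps)
    thus ?thesis by blast
  qed
qed

lemma kappa_deriv_0:
  assumes "Im \<tau> > 0"
  shows "((\<lambda>x. kappa x \<tau>) has_field_derivative 1) (at 0)"
proof -
  define g where "g = (\<lambda>x. (qpoch (nome \<tau> * nome x) (nome \<tau>) * qpoch (nome \<tau> / nome x) (nome \<tau>)) / qpoch (nome \<tau>) (nome \<tau>) ^ 2)"
  have q: "norm (nome \<tau>) < 1" using assms norm_nome_less_1 by blast
  have nz: "qpoch (nome \<tau>) (nome \<tau>) \<noteq> 0" using qpoch_nonzero'[OF q q] .
  have "g holomorphic_on UNIV" unfolding g_def using q nz by (intro holomorphic_intros) auto
  hence "(g has_field_derivative deriv g 0) (at 0)" using holomorphic_derivI by blast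
  moreover have "((\<lambda>x. sin (of_real pi * x) / of_real pi) has_field_derivative 1) (at (0::complex))"
    by (auto intro!: derivative_eq_intros)
  ultimately have "((\<lambda>x. sin (of_real pi * x) / of_real pi * g x) has_field_derivative
      (1 * g 0 + deriv g 0 * (sin (of_real pi * 0) / of_real pi))) (at 0)"
    by (rule DERIV_mult[rotated])
  moreover have "g 0 = 1" using nz by (simp add: g_def power2_eq_square)
  moreover have "(\<lambda>x. kappa x \<tau>) = (\<lambda>x. sin (of_real pi * x) / of_real pi * g x)"
    by (simp add: kappa_def g_def fun_eq_iff)
  ultimately show ?thesis by simp
qed

section \<open>Uniqueness of theta functions and the modular transformation\<close>

lemma lattice_periodic:
  fixes f :: "complex \<Rightarrow> 'a"
  assumes "\<And>z. f (z + 1) = f z" "\<And>z. f (z + \<tau>) = f z"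
  shows "f (z + of_int m * \<tau> + of_int n) = f z"
proof -
  have A: "f (z + of_int n * w) = f z" if w: "\<And>z. f (z + w) = f z" for z w and n :: int
  proof (induction n rule: int_induct[where k = 0])
    case (step1 i)
    have "f (z + of_int (i + 1) * w) = f ((z + of_int i * w) + w)" by (simp add: algebra_simps)
    thus ?case using step1 w by simp
  next
    case (step2 i)
    have "f (z + of_int i * w) = f ((z + of_int (i - 1) * w) + w)" by (simp add: algebra_simps)
    thus ?case using step2 w by simp
  qed auto
  show ?thesis using A[of \<tau> z m] A[of 1 "z + of_int m * \<tau>" n] assms by simp
qed

lemma lattice_reduce:
  assumes "Im \<tau> > 0"
  obtains m n :: int and s t where "z = of_real s + of_real t * \<tau> + of_int m * \<tau> + of_int n" "s \<in> {0..1}" "t \<in> {0..1}"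
proof -
  define T where "T = Im z / Im \<tau>"
  define S where "S = Re z - T * Re \<tau>"
  have "z = of_real S + of_real T * \<tau>"
    using assms by (simp add: complex_eq_iff S_def T_def)
  also have "\<dots> = of_real (frac S) + of_real (frac T) * \<tau> + of_int \<lfloor>T\<rfloor> * \<tau> + of_int \<lfloor>S\<rfloor>"
    by (simp add: frac_def algebra_simps)
  finally show ?thesis
    by (rule that) (auto simp: frac_lt_1 less_imp_le)
qed

text \<open>
  The quotient is entire and doubly periodic, hence constant by Liouville's theorem.
\<close>

lemma theta_unique:
  fixes f g :: "complex \<Rightarrow> complex"
  assumes \<tau>: "Im \<tau> > 0"
    and hol: "f holomorphic_on UNIV" "g holomorphic_on UNIV"
    and per1: "\<And>z. f (z + 1) = u z * f z" "\<And>z. g (z + 1) = u z * g z" "\<And>z. u z \<noteq> 0"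
    and per2: "\<And>z. f (z + \<tau>) = v z * f z" "\<And>z. g (z + \<tau>) = v z * g z" "\<And>z. v z \<noteq> 0"
    and zero: "\<And>z. f z = 0 \<Longrightarrow> \<exists>m n :: int. z = of_int m * \<tau> + of_int n"
    and at0: "f 0 = 0" "g 0 = 0" "(f has_field_derivative 1) (at 0)" "(g has_field_derivative 1) (at 0)"
  shows "g z = f z"
proof -
  \<comment> \<open>The value 1 at the zeros of \<open>f\<close> is the limit of the quotient at 0,
    as both derivatives are 1 there; periodicity carries it to all lattice points.\<close>
  define h where "h = (\<lambda>z. if f z = 0 then 1 else g z / f z)"
  have h1: "h (z + 1) = h z" and h2: "h (z + \<tau>) = h z" for z
    using per1 per2 by (simp_all add: h_def)
  have hper: "h (z + of_int m * \<tau> + of_int n) = h z" for z m n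
    by (rule lattice_periodic) (rule h1 h2)+
  have lim_f: "((\<lambda>z. f z / z) \<longlongrightarrow> 1) (at 0)" and lim_g: "((\<lambda>z. g z / z) \<longlongrightarrow> 1) (at 0)"
    using at0 by (simp_all add: has_field_derivative_iff)
  have "eventually (\<lambda>z. f z / z \<noteq> 0) (at 0)"
    using tendsto_imp_eventually_ne[OF lim_f, of 0] by simp
  hence ev: "eventually (\<lambda>z. f z \<noteq> 0) (at 0)" by eventually_elim auto
  then obtain e where e: "e > 0" "\<And>z. z \<in> ball 0 e - {0} \<Longrightarrow> f z \<noteq> 0"
    unfolding eventually_at by (auto simp: dist_commute)
  have "((\<lambda>z. (g z / z) / (f z / z)) \<longlongrightarrow> 1 / 1) (at 0)"
    by (intro tendsto_divide lim_f lim_g) auto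
  moreover have "eventually (\<lambda>z. (g z / z) / (f z / z) = h z) (at 0)"
    using ev eventually_neq_at_within[of 0] by eventually_elim (simp add: h_def)
  ultimately have "(h \<longlongrightarrow> 1) (at 0)" by (simp cong: filterlim_cong)
  hence cont: "isCont h 0" using at0 by (simp add: isCont_def h_def)
  have holq: "h holomorphic_on (ball 0 e - {0})"
  proof -
    have "(\<lambda>z. g z / f z) holomorphic_on (ball 0 e - {0})"
      using e(2) by (intro holomorphic_intros holomorphic_on_subset[OF hol(1)] holomorphic_on_subset[OF hol(2)]) auto
    thus ?thesis by (rule holomorphic_transform) (use e(2) in \<open>simp add: h_def\<close>)
  qed
  have "h holomorphic_on ball 0 e"
  proof (rule no_isolated_singularity[where K = "{0}"])
    show "continuous_on (ball 0 e) h"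
    proof (rule continuous_at_imp_continuous_on, intro ballI)
      fix x :: complex assume x: "x \<in> ball 0 e"
      show "isCont h x"
      proof (cases "x = 0")
        case False
        thus ?thesis using holomorphic_on_imp_continuous_on[OF holq] x
          by (simp add: continuous_on_eq_continuous_at open_delete)
      qed (use cont in simp)
    qed
  qed (use holq in auto)
  hence d0: "h field_differentiable at 0"
    using e(1) by (simp add: holomorphic_on_imp_differentiable_at)
  have dz: "h field_differentiable at z" for z
  proof (cases "f z = 0")
    case True
    then obtain m n where mn: "z = of_int m * \<tau> + of_int n" using zero by blast
    have "(\<lambda>x. h (x - z)) = h"
      using hper[of _ m n] by (intro ext) (metis mn add.assoc diff_add_cancel)
    moreover have "(h \<circ> (\<lambda>x. x - z)) field_differentiable at z"
      by (rule field_differentiable_compose) (use d0 in \<open>auto intro!: derivative_intros\<close>)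
    ultimately show ?thesis by (simp add: o_def)
  next
    case False
    have "open {z. f z \<noteq> 0}"
      using holomorphic_on_imp_continuous_on[OF hol(1)]
      by (intro open_Collect_neq continuous_on_const) auto
    moreover have "(\<lambda>z. g z / f z) holomorphic_on {z. f z \<noteq> 0}"
      by (intro holomorphic_intros holomorphic_on_subset[OF hol(1)] holomorphic_on_subset[OF hol(2)]) auto
    hence "h holomorphic_on {z. f z \<noteq> 0}"
      by (rule holomorphic_transform) (simp add: h_def)
    ultimately show ?thesis using False by (simp add: holomorphic_on_imp_differentiable_at)
  qed
  hence holh: "h holomorphic_on UNIV" by (simp add: holomorphic_on_def field_differentiable_at_within)
  \<comment> \<open>A closed period parallelogram: compact, and by periodicity \<open>h\<close>
    takes all its values on it.\<close>
  define K where "K = (\<lambda>(s, t). of_real s + of_real t * \<tau>) ` ({0..1} \<times> {0..1::real})"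
  have "compact K" unfolding K_def
    by (intro compact_continuous_image compact_Times) (auto simp: case_prod_beta intro!: continuous_intros)
  hence "bounded (h ` K)"
    using holomorphic_on_imp_continuous_on[OF holh]
    by (intro compact_imp_bounded compact_continuous_image) (auto intro: continuous_on_subset)
  moreover have "range h \<subseteq> h ` K"
  proof safe
    fix z
    obtain m n s t where *: "z = of_real s + of_real t * \<tau> + of_int m * \<tau> + of_int n" "s \<in> {0..1}" "t \<in> {0..1}"
      using lattice_reduce[OF \<tau>] by metis
    have "h z = h (of_real s + of_real t * \<tau>)" unfolding *(1) by (rule hper)
    thus "h z \<in> h ` K" using * by (force simp: K_def)
  qed
  ultimately have "bounded (range h)" by (rule bounded_subset)
  hence "h constant_on UNIV" by (rule Liouville_theorem[OF holh])
  hence const: "h z = h 0" unfolding constant_on_def by auto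
  show ?thesis
  proof (cases "f z = 0")
    case True
    then obtain m n where mn: "z = of_int m * \<tau> + of_int n" using zero by blast
    have "(g (0 + of_int m * \<tau> + of_int n) = 0) = (g 0 = 0)"
      by (rule lattice_periodic) (simp_all add: per1 per2)
    thus ?thesis using mn at0 True by simp
  next
    case False
    thus ?thesis using const at0 by (simp add: h_def)
  qed
qed

lemma of_int_det:
  fixes a b c d :: int
  assumes "a * d - b * c = 1"
  shows "of_int a * of_int d - of_int b * of_int c = (1::complex)"
  using assms by (metis of_int_1 of_int_diff of_int_mult)

lemma Im_moebius:
  fixes a b c d :: int
  assumes \<tau>: "Im \<tau> > 0" and det: "a * d - b * c = 1"
  defines "j \<equiv> of_int c * \<tau> + of_int d"
  shows "j \<noteq> 0" "Im ((of_int a * \<tau> + of_int b) / j) = Im \<tau> / (norm j)\<^sup>2"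
proof -
  have det_r: "of_int a * of_int d - of_int b * of_int c = (1::real)"
    using det by (metis of_int_1 of_int_diff of_int_mult)
  show "j \<noteq> 0"
  proof
    assume "j = 0"
    hence "Im j = 0" "Re j = 0" by auto
    hence "c = 0" "d = 0" using \<tau> by (auto simp: j_def)
    thus False using det by simp
  qed
  have "Im ((of_int a * \<tau> + of_int b) / j) = Im ((of_int a * \<tau> + of_int b) * cnj j) / (norm j)\<^sup>2"
    by (simp add: Im_complex_div_eq_0 complex_div_cnj[of _ j] Im_divide_of_real flip: of_real_power)
  also have "Im ((of_int a * \<tau> + of_int b) * cnj j) = (of_int a * of_int d - of_int b * of_int c) * Im \<tau>"
    by (simp add: j_def algebra_simps)
  finally show "Im ((of_int a * \<tau> + of_int b) / j) = Im \<tau> / (norm j)\<^sup>2" by (simp add: det_r)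
qed

text \<open>Translating \<open>z\<close> by 1 or \<open>\<tau>\<close> translates
  \<open>z / j\<close> by a period of the transformed lattice. The Gaussian factor in
  \<open>G\<close> converts the resulting multipliers into those of \<open>kappa z \<tau>\<close>,
  so uniqueness applies; the derivative 1 at 0 fixes the constant, and no root of unity can
  enter.\<close>

lemma kappa_modular:
  fixes a b c d :: int
  assumes \<tau>: "Im \<tau> > 0" and det: "a * d - b * c = 1"
  defines "j \<equiv> of_int c * \<tau> + of_int d"
  shows "kappa (z / j) ((of_int a * \<tau> + of_int b) / j) = nome (of_int c * z\<^sup>2 / (2 * j)) / j * kappa z \<tau>"
    and "j \<noteq> 0" and "Im ((of_int a * \<tau> + of_int b) / j) > 0"
proof -
  define \<tau>' where "\<tau>' = (of_int a * \<tau> + of_int b) / j"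
  note det' = of_int_det[OF det]
  show j: "j \<noteq> 0" using Im_moebius(1)[OF \<tau> det] by (simp add: j_def)
  have \<tau>': "Im \<tau>' > 0" using Im_moebius[OF \<tau> det] \<tau> by (simp add: \<tau>'_def j_def)
  thus "Im ((of_int a * \<tau> + of_int b) / j) > 0" by (simp add: \<tau>'_def)
  define G where "G = (\<lambda>z. j * nome (- (of_int c * z\<^sup>2 / (2 * j))) * kappa (z / j) \<tau>')"
  have sh: "G (z + w) = nome (- (of_int c * (2 * z * w + w\<^sup>2) / (2 * j)) +
        (of_int (m + n) / 2 - of_int m * (z / j) - of_int m ^ 2 * \<tau>' / 2)) * G z"
    if w: "w / j = of_int m * \<tau>' + of_int n" for z w m n
  proof -
    have "(z + w) / j = z / j + of_int m * \<tau>' + of_int n" using w by (simp add: add_divide_distrib)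
    hence "kappa ((z + w) / j) \<tau>' = nome (of_int (m + n) / 2 - of_int m * (z / j) - of_int m ^ 2 * \<tau>' / 2) * kappa (z / j) \<tau>'"
      using kappa_shift[OF \<tau>', of "z / j" m n] by metis
    moreover have "- (of_int c * (z + w)\<^sup>2 / (2 * j)) =
        - (of_int c * (2 * z * w + w\<^sup>2) / (2 * j)) + - (of_int c * z\<^sup>2 / (2 * j))"
      by (simp add: power2_eq_square algebra_simps flip: add_divide_distrib)
    ultimately show ?thesis unfolding G_def by (simp only: nome_add) (simp only: mult_ac)
  qed
  \<comment> \<open>Determinant 1 prevents \<open>a, c\<close> and likewise \<open>b, d\<close> from
    being both even; these parities produce the signs of the two quasi-periods.\<close>
  have odd1: "odd (a - c - a * c)" and odd2: "odd (d - b - b * d)"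
  proof -
    have "odd (a * d - b * c)" using det by simp
    thus "odd (a - c - a * c)" "odd (d - b - b * d)" by auto
  qed
  have G1: "G (z + 1) = - 1 * G z" for z
  proof -
    have "1 / j = of_int (- c) * \<tau>' + of_int a"
      using j det' unfolding \<tau>'_def by (simp add: divide_simps) (simp add: j_def algebra_simps)
    from sh[OF this, of z] have "G (z + 1) = nome (- (of_int c * (2 * z * 1 + 1\<^sup>2) / (2 * j)) +
        (of_int (- c + a) / 2 - of_int (- c) * (z / j) - of_int (- c) ^ 2 * \<tau>' / 2)) * G z" .
    also have "- (of_int c * (2 * z * 1 + 1\<^sup>2) / (2 * j)) +
        (of_int (- c + a) / 2 - of_int (- c) * (z / j) - of_int (- c) ^ 2 * \<tau>' / 2) = of_int (a - c - a * c) / 2"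
    proof -
      have "of_int c + of_int c ^ 2 * (of_int a * \<tau> + of_int b) = of_int a * of_int c * j"
      proof -
        have "of_int a * of_int d = (1 + of_int b * of_int c :: complex)" using det' by (simp add: algebra_simps)
        hence "of_int c * (of_int a * of_int d) = (of_int c * (1 + of_int b * of_int c) :: complex)" by simp
        thus ?thesis unfolding j_def by (simp add: algebra_simps power2_eq_square)
      qed
      hence "of_int c + of_int c ^ 2 * (\<tau>' * j) = of_int a * of_int c * j" using j by (simp add: \<tau>'_def)
      hence "(of_int c * (2 * z * 1 + 1\<^sup>2) - 2 * of_int c * z + of_int c ^ 2 * (\<tau>' * j)) / (2 * j)
          = of_int a * of_int c * j / (2 * j)" by (intro arg_cong2[where f = "(/)"]) (simp_all add: algebra_simps)
      also have "\<dots> = of_int a * of_int c / 2" using j by simp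
      finally show ?thesis using j
        by (simp add: ring_distribs add_divide_distrib diff_divide_distrib mult_ac) (simp add: algebra_simps)
    qed
    finally show ?thesis using odd1 by (simp only: nome_half_int) simp
  qed
  have G2: "G (z + \<tau>) = - nome (- z - \<tau> / 2) * G z" for z
  proof -
    have "\<tau> / j = of_int d * \<tau>' + of_int (- b)"
      using j det' unfolding \<tau>'_def by (simp add: divide_simps) (simp add: j_def algebra_simps)
    from sh[OF this, of z] have "G (z + \<tau>) = nome (- (of_int c * (2 * z * \<tau> + \<tau>\<^sup>2) / (2 * j)) +
        (of_int (d + - b) / 2 - of_int d * (z / j) - of_int d ^ 2 * \<tau>' / 2)) * G z" .
    also have "- (of_int c * (2 * z * \<tau> + \<tau>\<^sup>2) / (2 * j)) +
        (of_int (d + - b) / 2 - of_int d * (z / j) - of_int d ^ 2 * \<tau>' / 2) =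
        of_int (d - b - b * d) / 2 + (- z - \<tau> / 2)"
    proof -
      have "of_int c * \<tau>\<^sup>2 + of_int d ^ 2 * (of_int a * \<tau> + of_int b) = (\<tau> + of_int b * of_int d) * j"
      proof -
        have "of_int a * of_int d = (1 + of_int b * of_int c :: complex)" using det' by (simp add: algebra_simps)
        hence "of_int d * \<tau> * (of_int a * of_int d) = (of_int d * \<tau> * (1 + of_int b * of_int c) :: complex)" by simp
        thus ?thesis unfolding j_def by (simp add: algebra_simps power2_eq_square)
      qed
      moreover have "of_int c * (2 * z * \<tau>) + 2 * of_int d * z = 2 * z * j"
        by (simp add: j_def algebra_simps)
      ultimately have "of_int c * \<tau>\<^sup>2 + of_int d ^ 2 * (of_int a * \<tau> + of_int b) + (of_int c * (2 * z * \<tau>) + 2 * of_int d * z)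
          = (\<tau> + of_int b * of_int d) * j + 2 * z * j" by simp
      hence "of_int c * (2 * z * \<tau> + \<tau>\<^sup>2) + 2 * of_int d * z + of_int d ^ 2 * (of_int a * \<tau> + of_int b)
          = (\<tau> + of_int b * of_int d + 2 * z) * j" by (simp add: algebra_simps)
      hence "of_int c * (2 * z * \<tau> + \<tau>\<^sup>2) + 2 * of_int d * z + of_int d ^ 2 * (\<tau>' * j)
          = (\<tau> + of_int b * of_int d + 2 * z) * j" using j by (simp add: \<tau>'_def)
      hence "(of_int c * (2 * z * \<tau> + \<tau>\<^sup>2) + 2 * of_int d * z + of_int d ^ 2 * (\<tau>' * j)) / (2 * j)
          = (\<tau> + of_int b * of_int d + 2 * z) * j / (2 * j)" by simp
      also have "\<dots> = (\<tau> + of_int b * of_int d + 2 * z) / 2" using j by simp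
      finally show ?thesis using j
        by (simp add: ring_distribs add_divide_distrib diff_divide_distrib mult_ac) (simp add: algebra_simps)
    qed
    finally show ?thesis using odd2 by (simp only: nome_add nome_half_int) simp
  qed
  have "G z = kappa z \<tau>"
  proof (rule theta_unique[OF \<tau>, where f = "\<lambda>z. kappa z \<tau>" and g = G and u = "\<lambda>_. - 1"
        and v = "\<lambda>z. - nome (- z - \<tau> / 2)"])
    show "(\<lambda>z. kappa z \<tau>) holomorphic_on UNIV" using \<tau> by (intro holomorphic_intros) auto
    show "G holomorphic_on UNIV" unfolding G_def using \<tau>' j by (intro holomorphic_intros) auto
    show "kappa (z + 1) \<tau> = - 1 * kappa z \<tau>" for z by (simp add: kappa_add_1)
    show "kappa (z + \<tau>) \<tau> = - nome (- z - \<tau> / 2) * kappa z \<tau>" for z by (rule kappa_add_tau[OF \<tau>])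
    show "\<exists>m n :: int. z = of_int m * \<tau> + of_int n" if "kappa z \<tau> = 0" for z
      by (rule kappa_eq_0D[OF \<tau> that])
    show "((\<lambda>z. kappa z \<tau>) has_field_derivative 1) (at 0)" by (rule kappa_deriv_0[OF \<tau>])
    show "(G has_field_derivative 1) (at 0)"
    proof -
      have 1: "((\<lambda>z. kappa (z / j) \<tau>') has_field_derivative (1 * (1 / j))) (at 0)"
        using kappa_deriv_0[OF \<tau>'] j
        by (intro DERIV_chain'[where g = "\<lambda>x. kappa x \<tau>'"]) (auto intro!: derivative_eq_intros)
      have "(\<lambda>z. j * nome (- (of_int c * z\<^sup>2 / (2 * j)))) holomorphic_on UNIV"
        using j by (intro holomorphic_intros) auto
      hence 2: "((\<lambda>z. j * nome (- (of_int c * z\<^sup>2 / (2 * j)))) has_field_derivative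
          deriv (\<lambda>z. j * nome (- (of_int c * z\<^sup>2 / (2 * j)))) 0) (at 0)"
        using holomorphic_derivI by blast
      show ?thesis unfolding G_def
        using DERIV_mult[OF 2 1] j by simp
    qed
    show "G 0 = 0" by (simp add: G_def)
  qed (use G1 G2 in auto)
  hence "nome (of_int c * z\<^sup>2 / (2 * j)) / j * G z = nome (of_int c * z\<^sup>2 / (2 * j)) / j * kappa z \<tau>" by simp
  moreover have "nome (of_int c * z\<^sup>2 / (2 * j)) / j * G z = kappa (z / j) \<tau>'"
    using j by (simp add: G_def nome_minus)
  ultimately show "kappa (z / j) ((of_int a * \<tau> + of_int b) / j) = nome (of_int c * z\<^sup>2 / (2 * j)) / j * kappa z \<tau>"
    using j by (auto simp: \<tau>'_def)
qed

section \<open>Division values of the theta function\<close>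

text \<open>Up to a constant factor, the Klein form of index \<open>(g / p, 0)\<close> at \<open>p \<tau>\<close>.\<close>

definition klein :: "nat \<Rightarrow> nat \<Rightarrow> complex \<Rightarrow> complex" where
  "klein p g \<tau> = nome (of_nat g ^ 2 * \<tau> / (2 * of_nat p)) * kappa (of_nat g * \<tau>) (of_nat p * \<tau>)"

text \<open>If \<open>x\<close> is odd then \<open>1 + p * x\<close> is even, and the determinant
  forces \<open>b\<close> and \<open>c\<close> to be odd. This settles the half-integers in the
  characters below.\<close>

lemma gamma_parity:
  fixes p x y b c :: int
  assumes "odd p" "(1 + p * x) * y - b * c = 1"
  shows "even (x * (b + 1))" "even (x * (c + 1))"
proof -
  have "odd (b * c)" if "odd x"
  proof -
    have "even ((1 + p * x) * y)" using assms(1) that by simp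
    moreover have "b * c = (1 + p * x) * y - 1" using assms(2) by simp
    ultimately show ?thesis by simp
  qed
  thus "even (x * (b + 1))" "even (x * (c + 1))" by auto
qed

text \<open>With respect to \<open>p * \<tau>\<close> the matrix acts with off-diagonal entries
  \<open>p * b\<close> and \<open>c1\<close>. The point \<open>g * (a * \<tau> + b)\<close> exceeds
  \<open>g * \<tau>\<close> by the lattice vector with coordinates \<open>g * a1\<close> along
  \<open>p * \<tau>\<close> and \<open>g * b\<close> along 1. The exponential prefactor of
  \<open>klein\<close> absorbs all terms in \<open>\<tau>\<close>, leaving a root of unity and
  \<open>1 / J\<close>.\<close>

lemma klein_modular:
  fixes a1 b c1 d :: int and \<tau> :: complex and p g :: nat
  defines "a \<equiv> 1 + int p * a1" and "c \<equiv> int p * c1"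
  defines "J \<equiv> of_int c * \<tau> + of_int d"
  assumes \<tau>: "Im \<tau> > 0" and p: "p > 0" and det: "a * d - b * c = 1"
  shows "klein p g ((of_int a * \<tau> + of_int b) / J) =
     nome (of_int (int g ^ 2 * a1 * b + int g * (a1 + b)) / 2 + of_nat g ^ 2 * of_int b / (2 * of_nat p)) / J * klein p g \<tau>"
proof -
  define \<tau>' where "\<tau>' = (of_int a * \<tau> + of_int b) / J"
  define P where "P = (of_nat p :: complex)"
  define G where "G = (of_nat g :: complex)"
  have P: "P \<noteq> 0" using p by (simp add: P_def)
  have det': "a * d - (int p * b) * c1 = 1" using det by (simp add: c_def mult_ac)
  have Im: "Im (of_nat p * \<tau>) > 0" using \<tau> p by simp
  have aC: "of_int a = 1 + P * of_int a1" by (simp add: a_def P_def)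
  have J: "of_int c1 * (of_nat p * \<tau>) + of_int d = J" by (simp add: J_def c_def mult_ac)
  note K = kappa_modular[OF Im det', unfolded J]
  have J0: "J \<noteq> 0" using K(2) .
  have aJ: "1 + P * of_int c1 * (of_int a * \<tau> + of_int b) = of_int a * J"
    using of_int_det[OF det] by (simp add: J_def c_def P_def algebra_simps)
  define z where "z = G * (of_int a * \<tau> + of_int b)"
  have z1: "z / J = G * \<tau>'" by (simp add: z_def \<tau>'_def)
  have z2: "z = G * \<tau> + of_int (int g * a1) * (of_nat p * \<tau>) + of_int (int g * b)"
    by (simp add: z_def aC G_def P_def algebra_simps)
  have "(of_int a * (of_nat p * \<tau>) + of_int (int p * b)) / J = of_nat p * \<tau>'"
    by (simp add: \<tau>'_def algebra_simps)
  from K(1)[of z, unfolded this z1]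
  have "kappa (G * \<tau>') (of_nat p * \<tau>') = nome (of_int c1 * z\<^sup>2 / (2 * J)) / J * kappa z (of_nat p * \<tau>)" .
  also have "kappa z (of_nat p * \<tau>) = nome (of_int (int g * a1 + int g * b) / 2 - of_int (int g * a1) * (G * \<tau>)
      - of_int (int g * a1) ^ 2 * (of_nat p * \<tau>) / 2) * kappa (G * \<tau>) (of_nat p * \<tau>)"
    unfolding z2 by (rule kappa_shift[OF Im])
  finally have "klein p g \<tau>' = nome (G\<^sup>2 * \<tau>' / (2 * P)) * (nome (of_int c1 * z\<^sup>2 / (2 * J)) / J *
      (nome (of_int (int g * a1 + int g * b) / 2 - of_int (int g * a1) * (G * \<tau>)
      - of_int (int g * a1) ^ 2 * (of_nat p * \<tau>) / 2) * kappa (G * \<tau>) (of_nat p * \<tau>)))"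
    by (simp add: klein_def G_def P_def)
  also have "\<dots> = nome (G\<^sup>2 * \<tau>' / (2 * P) + of_int c1 * z\<^sup>2 / (2 * J) + (of_int (int g * a1 + int g * b) / 2 - of_int (int g * a1) * (G * \<tau>)
      - of_int (int g * a1) ^ 2 * (of_nat p * \<tau>) / 2) - G\<^sup>2 * \<tau> / (2 * P)) / J * klein p g \<tau>"
    by (simp only: nome_add nome_diff klein_def G_def P_def) (simp add: field_simps)
  also have "G\<^sup>2 * \<tau>' / (2 * P) + of_int c1 * z\<^sup>2 / (2 * J) = G\<^sup>2 * of_int a * (of_int a * \<tau> + of_int b) / (2 * P)"
  proof -
    have "G\<^sup>2 * \<tau>' / (2 * P) + of_int c1 * z\<^sup>2 / (2 * J) =
        G\<^sup>2 * (of_int a * \<tau> + of_int b) * (1 + P * of_int c1 * (of_int a * \<tau> + of_int b)) / (2 * P * J)"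
      using P J0 by (simp add: \<tau>'_def z_def field_simps power2_eq_square)
    thus ?thesis unfolding aJ using J0 P by (simp add: field_simps)
  qed
  also have "G\<^sup>2 * of_int a * (of_int a * \<tau> + of_int b) / (2 * P) + (of_int (int g * a1 + int g * b) / 2 - of_int (int g * a1) * (G * \<tau>)
      - of_int (int g * a1) ^ 2 * (of_nat p * \<tau>) / 2) - G\<^sup>2 * \<tau> / (2 * P) =
     of_int (int g ^ 2 * a1 * b + int g * (a1 + b)) / 2 + G ^ 2 * of_int b / (2 * P)"
    unfolding aC using P by (simp add: G_def P_def field_simps power2_eq_square)
  finally show ?thesis by (simp add: \<tau>'_def G_def P_def)
qed

text \<open>The congruences make \<open>g / p * J\<close> equal to \<open>g / p\<close> plus the
  lattice vector with coordinates \<open>g * c2\<close> along \<open>p * \<tau>\<close> and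
  \<open>g * d1\<close> along 1, so the division point returns to itself modulo the lattice.\<close>

lemma kappa_torsion_modular:
  fixes a b c2 d1 :: int and \<tau> :: complex and p g :: nat
  defines "c \<equiv> int p ^ 2 * c2" and "d \<equiv> 1 + int p * d1"
  defines "J \<equiv> of_int c * \<tau> + of_int d"
  assumes \<tau>: "Im \<tau> > 0" and p: "p > 0" and det: "a * d - b * c = 1"
  shows "kappa (of_nat g / of_nat p) (of_nat p * ((of_int a * \<tau> + of_int b) / J)) =
     nome (of_int (int g ^ 2 * c2 * d1 + int g * (c2 + d1)) / 2 - of_nat g ^ 2 * of_int c2 / (2 * of_nat p)) / J
       * kappa (of_nat g / of_nat p) (of_nat p * \<tau>)"
proof -
  define P where "P = (of_nat p :: complex)"
  define G where "G = (of_nat g :: complex)"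
  have P: "P \<noteq> 0" using p by (simp add: P_def)
  have det': "a * d - (int p * b) * (int p * c2) = 1" using det by (simp add: c_def power2_eq_square mult_ac)
  have Im: "Im (P * \<tau>) > 0" using \<tau> p by (simp add: P_def)
  have dC: "of_int d = 1 + P * of_int d1" by (simp add: d_def P_def)
  have J: "of_int (int p * c2) * (P * \<tau>) + of_int d = J"
    by (simp add: J_def c_def P_def power2_eq_square mult_ac)
  have J': "J = P\<^sup>2 * of_int c2 * \<tau> + (1 + P * of_int d1)" by (simp add: J_def c_def dC P_def)
  note K = kappa_modular[OF Im det', unfolded J]
  have J0: "J \<noteq> 0" using K(2) .
  define z where "z = G / P * J"
  have z1: "z / J = G / P" using J0 by (simp add: z_def)
  have z2: "z = G / P + of_int (int g * c2) * (P * \<tau>) + of_int (int g * d1)"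
    using P by (simp add: z_def J' G_def P_def field_simps power2_eq_square)
  have "(of_int a * (P * \<tau>) + of_int (int p * b)) / J = P * ((of_int a * \<tau> + of_int b) / J)"
    by (simp add: P_def algebra_simps)
  from K(1)[of z, unfolded this z1]
  have "kappa (G / P) (P * ((of_int a * \<tau> + of_int b) / J)) = nome (of_int (int p * c2) * z\<^sup>2 / (2 * J)) / J * kappa z (P * \<tau>)" .
  also have "kappa z (P * \<tau>) = nome (of_int (int g * c2 + int g * d1) / 2 - of_int (int g * c2) * (G / P)
      - of_int (int g * c2) ^ 2 * (P * \<tau>) / 2) * kappa (G / P) (P * \<tau>)"
    unfolding z2 by (rule kappa_shift[OF Im])
  also have "nome (of_int (int p * c2) * z\<^sup>2 / (2 * J)) / J * (nome (of_int (int g * c2 + int g * d1) / 2 - of_int (int g * c2) * (G / P)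
      - of_int (int g * c2) ^ 2 * (P * \<tau>) / 2) * kappa (G / P) (P * \<tau>)) =
      nome (of_int (int p * c2) * z\<^sup>2 / (2 * J) + (of_int (int g * c2 + int g * d1) / 2 - of_int (int g * c2) * (G / P)
      - of_int (int g * c2) ^ 2 * (P * \<tau>) / 2)) / J * kappa (G / P) (P * \<tau>)"
    unfolding nome_add by simp
  also have "of_int (int p * c2) * z\<^sup>2 / (2 * J) = of_int c2 * G\<^sup>2 * J / (2 * P)"
    using J0 P by (simp add: z_def P_def[symmetric] field_simps power2_eq_square)
  also have "of_int c2 * G\<^sup>2 * J / (2 * P) + (of_int (int g * c2 + int g * d1) / 2 - of_int (int g * c2) * (G / P)
      - of_int (int g * c2) ^ 2 * (P * \<tau>) / 2) =
      of_int (int g ^ 2 * c2 * d1 + int g * (c2 + d1)) / 2 - G ^ 2 * of_int c2 / (2 * P)"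
    unfolding J' using P by (simp add: G_def[symmetric] field_simps power2_eq_square)
  finally show ?thesis by (simp add: G_def P_def)
qed

section \<open>First derivatives at division points\<close>

definition kappa' :: "complex \<Rightarrow> complex \<Rightarrow> complex" where
  "kappa' x \<tau> = deriv (\<lambda>x. kappa x \<tau>) x"

lemma kappa_has_field_derivative:
  assumes "Im \<tau> > 0"
  shows "((\<lambda>x. kappa x \<tau>) has_field_derivative kappa' x \<tau>) (at x)"
proof -
  have "(\<lambda>x. kappa x \<tau>) holomorphic_on UNIV" using assms by (intro holomorphic_intros) auto
  thus ?thesis unfolding kappa'_def using holomorphic_derivI by blast
qed

text \<open>For \<open>x\<close> near the division point the law reads
  \<open>kappa x \<tau>' = nome (Q x) / J * kappa (y x) \<tau>\<close>, with an affine map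
  \<open>y\<close> of slope \<open>J\<close> fixing the point. The exponent \<open>Q\<close> has
  derivative 0 there, so differentiation produces no term in \<open>kappa\<close> itself; hence
  \<open>kappa' / kappa\<^sup>2\<close> has weight 2 without quasi-modular correction.\<close>

lemma kappa_torsion_modular':
  fixes a b c2 d1 :: int and \<tau> :: complex and p g :: nat
  defines "c \<equiv> int p ^ 2 * c2" and "d \<equiv> 1 + int p * d1"
  defines "J \<equiv> of_int c * \<tau> + of_int d"
  assumes \<tau>: "Im \<tau> > 0" and p: "odd p" and det: "a * d - b * c = 1"
  shows "kappa (of_nat g / of_nat p) ((of_int a * \<tau> + of_int b) / J) = kappa (of_nat g / of_nat p) \<tau> / J"
    and "kappa' (of_nat g / of_nat p) ((of_int a * \<tau> + of_int b) / J) = kappa' (of_nat g / of_nat p) \<tau>"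
proof -
  define P where "P = (of_nat p :: complex)"
  define G where "G = (of_nat g :: complex)"
  define \<tau>' where "\<tau>' = (of_int a * \<tau> + of_int b) / J"
  have "p \<noteq> 0" using p by (cases p) auto
  hence P: "P \<noteq> 0" by (simp add: P_def)
  have dC: "of_int d = 1 + P * of_int d1" by (simp add: d_def P_def)
  have cC: "of_int c = P\<^sup>2 * of_int c2" by (simp add: c_def P_def)
  have J': "J = P\<^sup>2 * of_int c2 * \<tau> + (1 + P * of_int d1)" by (simp add: J_def cC dC)
  note K = kappa_modular[OF \<tau> det, folded J_def]
  have J0: "J \<noteq> 0" using K(2) .
  have Im': "Im \<tau>' > 0" using K(3) by (simp add: \<tau>'_def)
  \<comment> \<open>The coordinates of \<open>g / p * J - g / p\<close> in the lattice spanned by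
    \<open>\<tau>\<close> and 1.\<close>
  define m n where "m = int g * int p * c2" and "n = int g * d1"
  define y where "y = (\<lambda>x. (x - G / P) * J + G / P)"
  define Q where "Q = (\<lambda>x. of_int c * (x * J)\<^sup>2 / (2 * J) + (of_int (m + n) / 2 - of_int m * y x - of_int m ^ 2 * \<tau> / 2))"
  have y: "x * J = y x + of_int m * \<tau> + of_int n" for x
    using P by (simp add: y_def m_def n_def J' G_def P_def field_simps power2_eq_square)
  have eq: "kappa x \<tau>' = nome (Q x) / J * kappa (y x) \<tau>" for x
  proof -
    have "kappa x \<tau>' = nome (of_int c * (x * J)\<^sup>2 / (2 * J)) / J * kappa (x * J) \<tau>"
      using K(1)[of "x * J"] J0 by (simp add: \<tau>'_def)
    also have "kappa (x * J) \<tau> = nome (of_int (m + n) / 2 - of_int m * y x - of_int m ^ 2 * \<tau> / 2) * kappa (y x) \<tau>"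
      unfolding y by (rule kappa_shift[OF \<tau>])
    finally show ?thesis by (simp add: Q_def nome_add)
  qed
  have yG: "y (G / P) = G / P" by (simp add: y_def)
  have "Q (G / P) = of_int (int g ^ 2 * c2 + int g ^ 2 * c2 * int p * d1 + int g * int p * c2 + int g * d1 - 2 * int g ^ 2 * c2) / 2"
  proof -
    have "of_int c * (G / P * J)\<^sup>2 / (2 * J) = of_int c2 * G\<^sup>2 * J / 2"
      using P J0 by (simp add: cC field_simps power2_eq_square)
    hence "Q (G / P) = of_int c2 * G\<^sup>2 * J / 2 + (of_int (m + n) / 2 - of_int m * (G / P) - of_int m ^ 2 * \<tau> / 2)"
      by (simp only: Q_def yG)
    also have "\<dots> = of_int (int g ^ 2 * c2 + int g ^ 2 * c2 * int p * d1 + int g * int p * c2 + int g * d1 - 2 * int g ^ 2 * c2) / 2"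
      unfolding J' using P
      by (simp add: m_def n_def G_def P_def field_simps power2_eq_square)
    finally show ?thesis .
  qed
  also have "even (int g ^ 2 * c2 + int g ^ 2 * c2 * int p * d1 + int g * int p * c2 + int g * d1 - 2 * int g ^ 2 * c2)"
  proof -
    have "(1 + int p * d1) * a - c * b = 1" using det by (simp add: d_def mult_ac)
    from gamma_parity(1)[OF _ this] p have "even (d1 * (c2 + 1))" by (auto simp: c_def)
    thus ?thesis using p by auto
  qed
  hence "nome (of_int (int g ^ 2 * c2 + int g ^ 2 * c2 * int p * d1 + int g * int p * c2 + int g * d1 - 2 * int g ^ 2 * c2) / 2) = 1"
    by (simp only: nome_half_int if_True)
  finally have nQ: "nome (Q (G / P)) = 1" .
  show "kappa (of_nat g / of_nat p) ((of_int a * \<tau> + of_int b) / J) = kappa (of_nat g / of_nat p) \<tau> / J"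
    using eq[of "G / P"] nQ yG by (simp add: G_def P_def \<tau>'_def)
  have dy: "(y has_field_derivative J) (at (G / P))"
    unfolding y_def by (auto intro!: derivative_eq_intros)
  have dQ: "(Q has_field_derivative 0) (at (G / P))"
  proof -
    have "Q = (\<lambda>x. of_int c * J / 2 * x\<^sup>2 + (of_int (m + n) / 2 - of_int m * y x - of_int m ^ 2 * \<tau> / 2))"
      using J0 by (simp add: Q_def fun_eq_iff power2_eq_square)
    moreover have "((\<lambda>x. of_int c * J / 2 * x\<^sup>2 + (of_int (m + n) / 2 - of_int m * y x - of_int m ^ 2 * \<tau> / 2))
        has_field_derivative (of_int c * J / 2 * (2 * (G / P)) + (0 - of_int m * J - 0))) (at (G / P))"
      by (intro DERIV_add DERIV_diff DERIV_cmult dy DERIV_const) (auto intro!: derivative_eq_intros)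
    moreover have "of_int c * J / 2 * (2 * (G / P)) + (0 - of_int m * J - 0) = 0"
      using P by (simp add: cC m_def G_def P_def field_simps power2_eq_square)
    ultimately show ?thesis by simp
  qed
  have dn: "((\<lambda>x. nome (Q x)) has_field_derivative 0) (at (G / P))"
    unfolding nome_def by (rule derivative_eq_intros dQ refl | simp)+
  have dk: "((\<lambda>x. kappa (y x) \<tau>) has_field_derivative kappa' (G / P) \<tau> * J) (at (G / P))"
    using DERIV_chain'[OF dy kappa_has_field_derivative[OF \<tau>]] yG by (simp add: mult.commute)
  have "((\<lambda>x. nome (Q x) * kappa (y x) \<tau> / J) has_field_derivative
      (0 * kappa (y (G / P)) \<tau> + kappa' (G / P) \<tau> * J * nome (Q (G / P))) / J) (at (G / P))"
    by (intro DERIV_cdivide DERIV_mult dn dk)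
  hence "((\<lambda>x. kappa x \<tau>') has_field_derivative kappa' (G / P) \<tau>) (at (G / P))"
    using J0 nQ by (simp add: eq)
  hence "kappa' (G / P) \<tau>' = kappa' (G / P) \<tau>"
    using DERIV_unique kappa_has_field_derivative[OF Im'] by blast
  thus "kappa' (of_nat g / of_nat p) ((of_int a * \<tau> + of_int b) / J) = kappa' (of_nat g / of_nat p) \<tau>"
    by (simp add: G_def P_def \<tau>'_def)
qed

section \<open>The eta quotient\<close>

text \<open>Both sides are polynomials of degree at most \<open>p\<close> and agree at 0 and at the
  \<open>p\<close> distinct inverse roots.\<close>

lemma prod_one_minus_roots:
  assumes "p > 0"
  shows "(\<Prod>j<p. 1 - nome (of_nat j / of_nat p) * x) = 1 - x ^ p"
proof -
  let ?z = "\<lambda>j. nome (of_nat j / of_nat p)"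
  define F where "F = (\<Prod>j<p. [:1, - ?z j:])"
  define G where "G = 1 - Polynomial.monom (1::complex) p"
  define A where "A = insert 0 ((\<lambda>j. inverse (?z j)) ` {..<p})"
  have inj: "inj_on (\<lambda>j. inverse (?z j)) {..<p}"
  proof (rule linorder_inj_onI')
    fix i j assume ij: "i \<in> {..<p}" "j \<in> {..<p}" "i < j"
    have "?z j / ?z i = ?z (j - i)"
      using ij by (simp add: of_nat_diff diff_divide_distrib nome_diff)
    moreover have "?z (j - i) \<noteq> 1" using ij by (intro nome_frac_neq_1) auto
    ultimately show "inverse (?z i) \<noteq> inverse (?z j)" by (auto simp: field_simps)
  qed
  have "0 \<notin> (\<lambda>j. inverse (?z j)) ` {..<p}" by auto
  hence card: "card A = Suc p" by (simp add: A_def card_image[OF inj])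
  have "F = G"
  proof (rule poly_eqI_degree)
    show "poly F y = poly G y" if "y \<in> A" for y
    proof (cases "y = 0")
      case True
      thus ?thesis using assms by (simp add: F_def G_def poly_prod poly_monom)
    next
      case False
      then obtain j where j: "j < p" "y = inverse (?z j)" using \<open>y \<in> A\<close> by (auto simp: A_def)
      have "poly [:1, - ?z j:] y = 0" using j by simp
      hence "poly F y = 0" unfolding F_def poly_prod using j(1) by (intro prod_zero) auto
      moreover have "poly G y = 0" using assms j
        by (simp add: G_def poly_monom power_inverse nome_power)
      ultimately show ?thesis by simp
    qed
    have "Polynomial.degree F \<le> (\<Sum>j<p. Polynomial.degree [:1, - ?z j:])"
      unfolding F_def by (rule degree_prod_sum_le[unfolded o_def]) auto
    also have "\<dots> = p" by simp
    finally show "Polynomial.degree F < card A" using card by simp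
    have "Polynomial.degree G \<le> max (Polynomial.degree (1 :: complex poly)) (Polynomial.degree (Polynomial.monom (1::complex) p))"
      unfolding G_def by (rule degree_diff_le_max)
    thus "Polynomial.degree G < card A" using card by (simp add: degree_monom_eq)
  qed
  hence "poly F x = poly G x" by simp
  thus ?thesis by (simp add: F_def G_def poly_prod poly_monom mult.commute)
qed

lemma qpoch_prod_roots:
  assumes "p > 0" "norm Q < 1"
  shows "(\<Prod>j<p. qpoch (nome (of_nat j / of_nat p) * Q) Q) = qpoch (Q ^ p) (Q ^ p)"
proof (rule LIMSEQ_unique)
  let ?z = "\<lambda>j. nome (of_nat j / of_nat p)"
  have Qp: "norm (Q ^ p) < 1" using assms by (simp add: norm_power power_less_one_iff)
  show "(\<lambda>n. \<Prod>j<p. \<Prod>i<n. 1 - ?z j * Q * Q ^ i) \<longlonglongrightarrow> (\<Prod>j<p. qpoch (?z j * Q) Q)"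
    by (intro tendsto_prod qpoch_tendsto assms)
  have "(\<Prod>j<p. \<Prod>i<n. 1 - ?z j * Q * Q ^ i) = (\<Prod>i<n. 1 - Q ^ p * (Q ^ p) ^ i)" for n
  proof -
    have "(\<Prod>j<p. \<Prod>i<n. 1 - ?z j * Q * Q ^ i) = (\<Prod>i<n. \<Prod>j<p. 1 - ?z j * (Q * Q ^ i))"
      by (subst prod.swap) (simp add: mult.assoc)
    also have "\<dots> = (\<Prod>i<n. 1 - (Q * Q ^ i) ^ p)" by (simp add: prod_one_minus_roots[OF assms(1)])
    finally show ?thesis by (simp add: power_mult_distrib power_mult[symmetric] mult.commute)
  qed
  thus "(\<lambda>n. \<Prod>j<p. \<Prod>i<n. 1 - ?z j * Q * Q ^ i) \<longlonglongrightarrow> qpoch (Q ^ p) (Q ^ p)"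
    using qpoch_tendsto[OF Qp, of "Q ^ p"] by simp
qed

lemma qpoch_prod_residues:
  assumes "p > 0" "norm q < 1"
  shows "(\<Prod>j=1..p. qpoch (q ^ j) (q ^ p)) = qpoch q q"
proof (rule LIMSEQ_unique)
  have qp: "norm (q ^ p) < 1" using assms by (simp add: norm_power power_less_one_iff)
  show "(\<lambda>n. \<Prod>j=1..p. \<Prod>i<n. 1 - q ^ j * (q ^ p) ^ i) \<longlonglongrightarrow> (\<Prod>j=1..p. qpoch (q ^ j) (q ^ p))"
    by (intro tendsto_prod qpoch_tendsto qp)
  have "(\<Prod>j=1..p. \<Prod>i<n. 1 - q ^ j * (q ^ p) ^ i) = (\<Prod>m<n * p. 1 - q * q ^ m)" for n
  proof (induction n)
    case (Suc n)
    have qpn: "(q ^ p) ^ n = q ^ (n * p)" by (subst mult.commute) (rule power_mult[symmetric])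
    have "(\<Prod>m\<in>{n * p..<n * p + p}. 1 - q * q ^ m) = (\<Prod>j=1..p. 1 - q ^ j * (q ^ p) ^ n)"
    proof (rule prod.reindex_bij_witness[of _ "\<lambda>j. n * p + j - 1" "\<lambda>m. m - n * p + 1"])
      fix m assume "m \<in> {n * p..<n * p + p}"
      then obtain i where m: "m = n * p + i" using le_iff_add[of "n * p" m] by auto
      have "m - n * p + 1 = Suc i" by (simp add: m)
      thus "1 - q ^ (m - n * p + 1) * (q ^ p) ^ n = 1 - q * q ^ m"
        by (simp only: m power_add qpn power_Suc mult_ac)
    qed auto
    moreover have "{..<Suc n * p} = {..<n * p} \<union> {n * p..<n * p + p}" by auto
    hence "(\<Prod>m<Suc n * p. 1 - q * q ^ m) = (\<Prod>m<n * p. 1 - q * q ^ m) * (\<Prod>m\<in>{n * p..<n * p + p}. 1 - q * q ^ m)"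
      by (metis finite_lessThan finite_atLeastLessThan ivl_disj_int_one(2) prod.union_disjoint)
    ultimately have "(\<Prod>m<Suc n * p. 1 - q * q ^ m) =
        (\<Prod>m<n * p. 1 - q * q ^ m) * (\<Prod>j=1..p. 1 - q ^ j * (q ^ p) ^ n)" by (simp only:)
    thus ?case unfolding prod.lessThan_Suc prod.distrib Suc by (simp only:)
  qed simp
  moreover have "filterlim (\<lambda>n. n * p) at_top sequentially"
    using assms(1) by (intro filterlim_subseq) (simp add: strict_mono_def)
  hence "(\<lambda>n. \<Prod>m<n * p. 1 - q * q ^ m) \<longlonglongrightarrow> qpoch q q"
    by (rule filterlim_compose[OF qpoch_tendsto[OF assms(2)]])
  ultimately show "(\<lambda>n. \<Prod>j=1..p. \<Prod>i<n. 1 - q ^ j * (q ^ p) ^ i) \<longlonglongrightarrow> qpoch q q" by simp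
qed

section \<open>Euler products as products of Klein forms and of division values\<close>

lemma prod_pair:
  fixes f :: "nat \<Rightarrow> 'a::comm_monoid_mult"
  assumes "p = 2 * h + 1"
  shows "(\<Prod>j=1..p-1. f j) = (\<Prod>j=1..h. f j * f (p - j))"
proof -
  have "(\<Prod>j=1..h. f (p - j)) = (\<Prod>j=h+1..p-1. f j)"
    by (rule prod.reindex_bij_witness[of _ "\<lambda>j. p - j" "\<lambda>j. p - j"]) (use assms in auto)
  moreover have "{1..p-1} = {1..h} \<union> {h+1..p-1}" using assms by auto
  hence "(\<Prod>j=1..p-1. f j) = (\<Prod>j=1..h. f j) * (\<Prod>j=h+1..p-1. f j)"
    by (simp add: prod.union_disjoint)
  ultimately show ?thesis by (simp add: prod.distrib)
qed

text \<open>The sine factor of \<open>kappa\<close> supplies the factor \<open>1 - q ^ g\<close> by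
  which the first product differs from the one in \<open>kappa\<close>. This is the bridge from the
  products in the theorem to modular objects.\<close>

lemma klein_qpoch:
  assumes \<tau>: "Im \<tau> > 0" and g: "0 < g" "g < p"
  defines "q \<equiv> nome \<tau>"
  shows "qpoch (q ^ g) (q ^ p) * qpoch (q ^ (p - g)) (q ^ p) =
    - (2 * of_real pi * \<i>) * nome (of_nat g * \<tau> / 2 - of_nat g ^ 2 * \<tau> / (2 * of_nat p)) * qpoch (q ^ p) (q ^ p) ^ 2 * klein p g \<tau>"
proof -
  have q: "norm q < 1" "q \<noteq> 0" using \<tau> by (auto simp: q_def norm_nome_less_1)
  have qp: "norm (q ^ p) < 1" using q g by (simp add: norm_power power_less_one_iff)
  have Q: "nome (of_nat p * \<tau>) = q ^ p" and G: "nome (of_nat g * \<tau>) = q ^ g"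
    by (simp_all add: q_def nome_power)
  have nz: "qpoch (q ^ p) (q ^ p) \<noteq> 0" using qpoch_nonzero'[OF qp qp] .
  have "q ^ p / q ^ g = q ^ (p - g)" using q g by (simp add: power_diff)
  hence kap: "kappa (of_nat g * \<tau>) (of_nat p * \<tau>) = nome (- (of_nat g * \<tau>) / 2) * (q ^ g - 1) / (2 * \<i>) / of_real pi *
     (qpoch (q ^ p * q ^ g) (q ^ p) * qpoch (q ^ (p - g)) (q ^ p)) / qpoch (q ^ p) (q ^ p) ^ 2"
    unfolding kappa_def sin_nome Q G by simp
  have rec: "qpoch (q ^ g) (q ^ p) = (1 - q ^ g) * qpoch (q ^ p * q ^ g) (q ^ p)"
    using qpoch_rec[OF qp, of "q ^ g"] by (simp add: mult.commute)
  have "- (2 * of_real pi * \<i>) * nome (of_nat g * \<tau> / 2 - of_nat g ^ 2 * \<tau> / (2 * of_nat p)) * qpoch (q ^ p) (q ^ p) ^ 2 * klein p g \<tau>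
      = (nome (of_nat g * \<tau> / 2 - of_nat g ^ 2 * \<tau> / (2 * of_nat p)) * nome (of_nat g ^ 2 * \<tau> / (2 * of_nat p)) * nome (- (of_nat g * \<tau>) / 2))
       * qpoch (q ^ g) (q ^ p) * qpoch (q ^ (p - g)) (q ^ p)"
  proof -
    have "- (2 * of_real pi * \<i>) * X * W ^ 2 * (Y * (Z * (E - 1) / (2 * \<i>) / of_real pi * (B * C) / W ^ 2)) =
       (X * Y * Z) * ((1 - E) * B) * C" if "W \<noteq> 0" for X Y Z W E B C :: complex
      using that by (simp add: field_simps)
    from this[OF nz] show ?thesis unfolding klein_def kap rec .
  qed
  also have "nome (of_nat g * \<tau> / 2 - of_nat g ^ 2 * \<tau> / (2 * of_nat p)) * nome (of_nat g ^ 2 * \<tau> / (2 * of_nat p)) * nome (- (of_nat g * \<tau>) / 2) = 1"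
    by (simp flip: nome_add)
  finally show ?thesis by simp
qed

lemma klein_nonzero:
  assumes "Im \<tau> > 0" "0 < g" "g < p"
  shows "klein p g \<tau> \<noteq> 0"
proof -
  have q: "norm (nome \<tau>) < 1" using assms by (auto simp: norm_nome_less_1)
  hence "norm (nome \<tau> ^ n) < 1" if "n > 0" for n using that by (simp add: norm_power power_less_one_iff)
  hence "qpoch (nome \<tau> ^ g) (nome \<tau> ^ p) * qpoch (nome \<tau> ^ (p - g)) (nome \<tau> ^ p) \<noteq> 0"
    using assms by (simp add: qpoch_nonzero')
  thus ?thesis unfolding klein_qpoch[OF assms] by auto
qed

text \<open>The hypothesis encodes \<open>s = (p\<^sup>2 - 1) / 24\<close> without division. That
  the sum of squares is a multiple of \<open>p\<close> is what removes the denominator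
  \<open>2 * p\<close> from the product of the Klein characters.\<close>

lemma sum_squares_half:
  fixes p h s :: nat
  assumes "p = 2 * h + 1" "6 * s = h * (h + 1)"
  shows "(\<Sum>g=1..h. g) = 3 * s" "(\<Sum>g=1..h. g ^ 2) = p * s"
proof -
  have "2 * (\<Sum>g=1..n. g) = n * (n + 1)" for n :: nat by (induction n) auto
  from this[of h] assms(2) show "(\<Sum>g=1..h. g) = 3 * s" by linarith
  have "6 * (\<Sum>g=1..n. g ^ 2) = n * (n + 1) * (2 * n + 1)" for n :: nat
    by (induction n) (auto simp: algebra_simps power2_eq_square)
  from this[of h] have "6 * (\<Sum>g=1..h. g ^ 2) = 6 * s * p" using assms by simp
  thus "(\<Sum>g=1..h. g ^ 2) = p * s" by simp
qed

lemma prod_nome: "(\<Prod>j\<in>A. nome (f j)) = nome (\<Sum>j\<in>A. f j)"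
  by (induction A rule: infinite_finite_induct) (simp_all add: nome_add)

text \<open>For \<open>s = (p\<^sup>2 - 1) / 24\<close> this is \<open>\<eta>(p\<^sup>2 \<tau>) / \<eta>(\<tau>)\<close>.\<close>

definition eta_quot :: "nat \<Rightarrow> nat \<Rightarrow> complex \<Rightarrow> complex" where
  "eta_quot p s \<tau> = nome (of_nat s * \<tau>) * qpoch (nome (of_nat p ^ 2 * \<tau>)) (nome (of_nat p ^ 2 * \<tau>)) / qpoch (nome \<tau>) (nome \<tau>)"

context
  fixes p h s :: nat
  assumes ph: "p = 2 * h + 1" and s: "6 * s = h * (h + 1)" and h: "h > 0"
begin

lemma p_pos: "p > 0" and p_odd: "odd p" using ph by auto

text \<open>The residues \<open>g\<close> and \<open>p - g\<close> pair up to a Klein form. The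
  exponents \<open>g / 2 - g\<^sup>2 / (2 * p)\<close> add up to \<open>(3 * s - s) / 2 = s\<close>,
  which explains the power of \<open>q\<close>.\<close>

lemma klein_prod:
  assumes "Im \<tau> > 0"
  shows "qpoch (nome \<tau>) (nome \<tau>) = (- (2 * of_real pi * \<i>)) ^ h * nome (of_nat s * \<tau>) *
    qpoch (nome (of_nat p * \<tau>)) (nome (of_nat p * \<tau>)) ^ p * (\<Prod>g=1..h. klein p g \<tau>)"
proof -
  define q where "q = nome \<tau>"
  define E where "E = (\<lambda>g::nat. of_nat g * \<tau> / 2 - of_nat g ^ 2 * \<tau> / (2 * of_nat p))"
  have q: "norm q < 1" using assms by (auto simp: q_def norm_nome_less_1)
  have Q: "nome (of_nat p * \<tau>) = q ^ p" by (simp add: q_def nome_power)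
  have "{1..p} = insert p {1..p-1}" using p_pos by auto
  hence "qpoch q q = qpoch (q ^ p) (q ^ p) * (\<Prod>j=1..p-1. qpoch (q ^ j) (q ^ p))"
    using qpoch_prod_residues[OF p_pos q] p_pos by simp
  also have "(\<Prod>j=1..p-1. qpoch (q ^ j) (q ^ p)) = (\<Prod>j=1..h. qpoch (q ^ j) (q ^ p) * qpoch (q ^ (p - j)) (q ^ p))"
    by (rule prod_pair[OF ph])
  also have "\<dots> = (\<Prod>g=1..h. - (2 * of_real pi * \<i>) * nome (E g) * qpoch (q ^ p) (q ^ p) ^ 2 * klein p g \<tau>)"
    unfolding q_def E_def using assms ph by (intro prod.cong klein_qpoch) auto
  also have "\<dots> = (- (2 * of_real pi * \<i>)) ^ h * nome (\<Sum>g=1..h. E g) * (qpoch (q ^ p) (q ^ p) ^ 2) ^ h * (\<Prod>g=1..h. klein p g \<tau>)"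
    by (simp only: prod.distrib prod_nome prod_constant card_atLeastAtMost) simp
  also have "(\<Sum>g=1..h. E g) = of_nat s * \<tau>"
  proof -
    have "(\<Sum>g=1..h. E g) = of_nat (\<Sum>g=1..h. g) * \<tau> / 2 - of_nat (\<Sum>g=1..h. g ^ 2) * \<tau> / (2 * of_nat p)"
      by (simp add: E_def sum_subtractf sum_distrib_right sum_divide_distrib)
    also have "\<dots> = of_nat s * \<tau>"
      unfolding sum_squares_half[OF ph s] using p_pos by (simp add: field_simps)
    finally show ?thesis .
  qed
  also have "qpoch (q ^ p) (q ^ p) * ((- (2 * of_real pi * \<i>)) ^ h * nome (of_nat s * \<tau>) * (qpoch (q ^ p) (q ^ p) ^ 2) ^ h * (\<Prod>g=1..h. klein p g \<tau>))
     = (- (2 * of_real pi * \<i>)) ^ h * nome (of_nat s * \<tau>) * qpoch (q ^ p) (q ^ p) ^ (2 * h + 1) * (\<Prod>g=1..h. klein p g \<tau>)"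
    unfolding power_add power_mult by simp
  finally show ?thesis unfolding Q unfolding q_def ph[symmetric] .
qed

text \<open>The arguments \<open>nome (j / p)\<close> and their inverses run through all nontrivial
  \<open>p\<close>-th roots of unity, so the products collapse to the Euler product in
  \<open>Q ^ p\<close>.\<close>

lemma kappa_torsion_prod:
  assumes "Im \<tau> > 0"
  defines "Q \<equiv> nome \<tau>"
  shows "(\<Prod>j=1..h. kappa (of_nat j / of_nat p) \<tau>) * qpoch Q Q ^ p =
    (\<Prod>j=1..h. sin (of_real pi * (of_nat j / of_nat p)) / of_real pi) * qpoch (Q ^ p) (Q ^ p)"
proof -
  let ?z = "\<lambda>j. nome (of_nat j / of_nat p)"
  have Q: "norm Q < 1" using assms by (auto simp: norm_nome_less_1)
  have nz: "qpoch Q Q \<noteq> 0" using qpoch_nonzero'[OF Q Q] .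
  have z_refl: "Q * ?z (p - j) = Q / ?z j" if "j \<in> {1..h}" for j
  proof -
    have of_diff: "of_nat (p - j) = (of_nat p - of_nat j :: complex)" using that ph by (intro of_nat_diff) auto
    show ?thesis unfolding of_diff using p_pos by (simp add: diff_divide_distrib nome_diff)
  qed
  have "{..<p} = insert 0 {1..p-1}" using p_pos by auto
  hence "qpoch (Q ^ p) (Q ^ p) = qpoch Q Q * (\<Prod>j=1..p-1. qpoch (Q * ?z j) Q)"
    using qpoch_prod_roots[OF p_pos Q] by (simp add: mult.commute)
  also have "(\<Prod>j=1..p-1. qpoch (Q * ?z j) Q) = (\<Prod>j=1..h. qpoch (Q * ?z j) Q * qpoch (Q * ?z (p - j)) Q)"
    by (rule prod_pair[OF ph])
  also have "\<dots> = (\<Prod>j=1..h. qpoch (Q * ?z j) Q * qpoch (Q / ?z j) Q)"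
    by (intro prod.cong refl) (simp only: z_refl)
  finally have A: "qpoch (Q ^ p) (Q ^ p) = qpoch Q Q * (\<Prod>j=1..h. qpoch (Q * ?z j) Q * qpoch (Q / ?z j) Q)" .
  have "(\<Prod>j=1..h. kappa (of_nat j / of_nat p) \<tau>) = (\<Prod>j=1..h. (sin (of_real pi * (of_nat j / of_nat p)) / of_real pi) *
      (qpoch (Q * ?z j) Q * qpoch (Q / ?z j) Q)) / (qpoch Q Q ^ 2) ^ h"
    by (simp add: kappa_def Q_def prod_dividef power_mult_distrib)
  also have "(qpoch Q Q ^ 2) ^ h = qpoch Q Q ^ p / qpoch Q Q"
    using nz by (simp add: ph power_mult)
  finally show ?thesis unfolding A prod.distrib using nz by (simp add: field_simps)
qed

lemma sin_frac_nonzero: "j \<in> {1..p-1} \<Longrightarrow> sin (of_real pi * (of_nat j / of_nat p)) \<noteq> (0::complex)"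
  using nome_frac_neq_1[of j p] unfolding sin_nome by simp

text \<open>The Klein product at \<open>\<tau>\<close> and the torsion product at
  \<open>p * \<tau>\<close> share the power \<open>qpoch Q Q ^ p\<close>. Eliminating it leaves the
  eta quotient as a quotient of two products of \<open>h\<close> division values.\<close>

lemma eta_quot_klein:
  assumes "Im \<tau> > 0"
  shows "eta_quot p s \<tau> * ((\<Prod>j=1..h. sin (of_real pi * (of_nat j / of_nat p)) / of_real pi) * (- (2 * of_real pi * \<i>)) ^ h)
      * (\<Prod>g=1..h. klein p g \<tau>) = (\<Prod>j=1..h. kappa (of_nat j / of_nat p) (of_nat p * \<tau>))"
proof -
  define q Q where "q = nome \<tau>" and "Q = nome (of_nat p * \<tau>)"
  have q: "norm q < 1" and Q: "norm Q < 1" and Im: "Im (of_nat p * \<tau>) > 0"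
    using assms p_pos by (auto simp: q_def Q_def norm_nome_less_1)
  have nz: "qpoch q q \<noteq> 0" "qpoch Q Q \<noteq> 0" using qpoch_nonzero'[OF q q] qpoch_nonzero'[OF Q Q] .
  have Qp: "nome (of_nat p ^ 2 * \<tau>) = Q ^ p" by (simp add: Q_def nome_power power2_eq_square mult.assoc)
  let ?c1 = "\<Prod>j=1..h. sin (of_real pi * (of_nat j / of_nat p)) / complex_of_real pi"
  let ?c2 = "(- (2 * of_real pi * \<i>)) ^ h"
  let ?K = "\<Prod>g=1..h. klein p g \<tau>"
  let ?P = "\<Prod>j=1..h. kappa (of_nat j / of_nat p) (of_nat p * \<tau>)"
  have A: "qpoch q q = ?c2 * nome (of_nat s * \<tau>) * qpoch Q Q ^ p * ?K"
    using klein_prod[OF assms] by (simp add: q_def Q_def)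
  have B: "?P * qpoch Q Q ^ p = ?c1 * qpoch (Q ^ p) (Q ^ p)"
    using kappa_torsion_prod[OF Im] by (simp add: Q_def)
  have C: "eta_quot p s \<tau> * qpoch q q = nome (of_nat s * \<tau>) * qpoch (Q ^ p) (Q ^ p)"
    using nz by (simp add: eta_quot_def Qp q_def)
  have "nome (of_nat s * \<tau>) * qpoch Q Q ^ p * (eta_quot p s \<tau> * (?c1 * ?c2) * ?K) = ?c1 * (eta_quot p s \<tau> * qpoch q q)"
    unfolding A by (simp only: mult_ac)
  also have "\<dots> = nome (of_nat s * \<tau>) * qpoch Q Q ^ p * ?P"
    unfolding C using B by (simp only: mult_ac)
  finally show ?thesis using nz by simp
qed

text \<open>Numerator and denominator have \<open>h\<close> factors each, so the powers of
  \<open>J\<close> cancel. The sums of the characters over \<open>g\<close> are halves of integers,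
  which \<open>gamma_parity\<close> shows to be even.\<close>

lemma eta_quot_modular:
  fixes a1 b c2 d1 :: int and \<tau> :: complex
  defines "a \<equiv> 1 + int p * a1" and "c \<equiv> int p ^ 2 * c2" and "d \<equiv> 1 + int p * d1"
  defines "J \<equiv> of_int c * \<tau> + of_int d"
  assumes \<tau>: "Im \<tau> > 0" and det: "a * d - b * c = 1"
  shows "eta_quot p s ((of_int a * \<tau> + of_int b) / J) = eta_quot p s \<tau>"
proof -
  define \<tau>' where "\<tau>' = (of_int a * \<tau> + of_int b) / J"
  note K = kappa_modular[OF \<tau> det, folded J_def]
  have J0: "J \<noteq> 0" and \<tau>': "Im \<tau>' > 0" using K(2,3) by (auto simp: \<tau>'_def)
  have sums: "(\<Sum>g=1..h. of_nat g) = (3 * of_nat s :: complex)" "(\<Sum>g=1..h. of_nat g ^ 2) = (of_nat p * of_nat s :: complex)"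
    using arg_cong[OF sum_squares_half(1)[OF ph s], of "of_nat :: nat \<Rightarrow> complex"]
      arg_cong[OF sum_squares_half(2)[OF ph s], of "of_nat :: nat \<Rightarrow> complex"] by simp_all
  have "(\<Prod>g=1..h. klein p g \<tau>') = (\<Prod>g=1..h. nome (of_int (int g ^ 2 * a1 * b + int g * (a1 + b)) / 2 +
      of_nat g ^ 2 * of_int b / (2 * of_nat p)) / J * klein p g \<tau>)"
    unfolding \<tau>'_def J_def c_def a_def
    using klein_modular[OF \<tau> p_pos, of a1 d b "int p * c2"] det
    by (intro prod.cong) (simp_all add: a_def c_def power2_eq_square mult.assoc)
  also have "\<dots> = nome (\<Sum>g=1..h. of_int (int g ^ 2 * a1 * b + int g * (a1 + b)) / 2 +
      of_nat g ^ 2 * of_int b / (2 * of_nat p)) / J ^ h * (\<Prod>g=1..h. klein p g \<tau>)"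
    by (simp only: prod.distrib prod_dividef prod_nome prod_constant card_atLeastAtMost) simp
  also have "(\<Sum>g=1..h. of_int (int g ^ 2 * a1 * b + int g * (a1 + b)) / 2 +
      of_nat g ^ 2 * of_int b / (2 * of_nat p)) = (of_int (int s * (int p * a1 * b + 3 * a1 + 4 * b)) / 2 :: complex)"
  proof -
    have "(\<Sum>g=1..h. of_int (int g ^ 2 * a1 * b + int g * (a1 + b)) / 2 + of_nat g ^ 2 * of_int b / (2 * of_nat p)) =
       (\<Sum>g=1..h. of_nat g ^ 2 * (of_int a1 * of_int b / 2 + of_int b / (2 * of_nat p)) + of_nat g * ((of_int a1 + of_int b) / 2 :: complex))"
      by (intro sum.cong refl) (simp add: field_simps)
    also have "\<dots> = of_nat p * of_nat s * (of_int a1 * of_int b / 2 + of_int b / (2 * of_nat p)) + 3 * of_nat s * ((of_int a1 + of_int b) / 2)"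
      by (simp only: sum.distrib sum_distrib_right[symmetric] sums)
    also have "\<dots> = of_int (int s * (int p * a1 * b + 3 * a1 + 4 * b)) / 2"
      using p_pos by (simp add: field_simps)
    finally show ?thesis .
  qed
  also have "even (int s * (int p * a1 * b + 3 * a1 + 4 * b))"
  proof -
    have "even (a1 * (b + 1))" using gamma_parity(1)[of "int p" a1 d b c] det p_odd by (simp add: a_def)
    thus ?thesis using p_odd by auto
  qed
  hence "nome (of_int (int s * (int p * a1 * b + 3 * a1 + 4 * b)) / 2) = 1" by (simp only: nome_half_int if_True)
  finally have A: "(\<Prod>g=1..h. klein p g \<tau>') = (\<Prod>g=1..h. klein p g \<tau>) / J ^ h" by simp
  have "(\<Prod>g=1..h. kappa (of_nat g / of_nat p) (of_nat p * \<tau>')) = (\<Prod>g=1..h. nome (of_int (int g ^ 2 * c2 * d1 + int g * (c2 + d1)) / 2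
       - of_nat g ^ 2 * of_int c2 / (2 * of_nat p)) / J * kappa (of_nat g / of_nat p) (of_nat p * \<tau>))"
    unfolding \<tau>'_def J_def c_def d_def
    using kappa_torsion_modular[OF \<tau> p_pos, of a d1 b c2] det
    by (intro prod.cong) (simp_all add: c_def d_def)
  also have "\<dots> = nome (\<Sum>g=1..h. of_int (int g ^ 2 * c2 * d1 + int g * (c2 + d1)) / 2
       - of_nat g ^ 2 * of_int c2 / (2 * of_nat p)) / J ^ h * (\<Prod>g=1..h. kappa (of_nat g / of_nat p) (of_nat p * \<tau>))"
    by (simp only: prod.distrib prod_dividef prod_nome prod_constant card_atLeastAtMost) simp
  also have "(\<Sum>g=1..h. of_int (int g ^ 2 * c2 * d1 + int g * (c2 + d1)) / 2
       - of_nat g ^ 2 * of_int c2 / (2 * of_nat p)) = (of_int (int s * (int p * c2 * d1 + 2 * c2 + 3 * d1)) / 2 :: complex)"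
  proof -
    have "(\<Sum>g=1..h. of_int (int g ^ 2 * c2 * d1 + int g * (c2 + d1)) / 2 - of_nat g ^ 2 * of_int c2 / (2 * of_nat p)) =
       (\<Sum>g=1..h. of_nat g ^ 2 * (of_int c2 * of_int d1 / 2 - of_int c2 / (2 * of_nat p)) + of_nat g * ((of_int c2 + of_int d1) / 2 :: complex))"
      by (intro sum.cong refl) (simp add: field_simps)
    also have "\<dots> = of_nat p * of_nat s * (of_int c2 * of_int d1 / 2 - of_int c2 / (2 * of_nat p)) + 3 * of_nat s * ((of_int c2 + of_int d1) / 2)"
      by (simp only: sum.distrib sum_distrib_right[symmetric] sums)
    also have "\<dots> = of_int (int s * (int p * c2 * d1 + 2 * c2 + 3 * d1)) / 2"
      using p_pos by (simp add: field_simps)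
    finally show ?thesis .
  qed
  also have "even (int s * (int p * c2 * d1 + 2 * c2 + 3 * d1))"
  proof -
    have "(1 + int p * d1) * a - c * b = 1" using det by (simp add: d_def mult_ac)
    from gamma_parity(1)[OF _ this] p_odd have "even (d1 * (c2 + 1))" by (auto simp: c_def)
    thus ?thesis using p_odd by auto
  qed
  hence "nome (of_int (int s * (int p * c2 * d1 + 2 * c2 + 3 * d1)) / 2) = 1" by (simp only: nome_half_int if_True)
  finally have B: "(\<Prod>g=1..h. kappa (of_nat g / of_nat p) (of_nat p * \<tau>')) =
      (\<Prod>g=1..h. kappa (of_nat g / of_nat p) (of_nat p * \<tau>)) / J ^ h" by simp
  define C where "C = (\<Prod>j=1..h. sin (of_real pi * (of_nat j / of_nat p)) / of_real pi) * (- (2 * of_real pi * \<i>)) ^ h"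
  have C: "C \<noteq> 0" using sin_frac_nonzero ph by (auto simp: C_def)
  have K: "(\<Prod>g=1..h. klein p g \<tau>) \<noteq> 0" using klein_nonzero[OF \<tau>] ph by auto
  have "eta_quot p s \<tau>' * C * ((\<Prod>g=1..h. klein p g \<tau>) / J ^ h) = (eta_quot p s \<tau> * C * (\<Prod>g=1..h. klein p g \<tau>)) / J ^ h"
    using eta_quot_klein[OF \<tau>'] eta_quot_klein[OF \<tau>] unfolding A B C_def by simp
  thus ?thesis using C K J0 by (simp add: \<tau>'_def)
qed

end

section \<open>Dissection and modularity\<close>

text \<open>Of the three kinds of factors in \<open>kappa\<close>, the two products give the
  \<open>qlog\<close> terms and \<open>nome (- x / 2) * (nome x - 1)\<close> gives the elementary
  term. The bracket found for the partition series is therefore the logarithmic derivative of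
  \<open>kappa\<close> divided by \<open>2 * pi * \<i>\<close>.\<close>

lemma kappa_log_derivative:
  assumes \<tau>: "Im \<tau> > 0" and z1: "nome x \<noteq> 1" "norm (nome x) = 1"
  defines "q \<equiv> nome \<tau>" and "z \<equiv> nome x"
  shows "kappa' x \<tau> = kappa x \<tau> * (2 * of_real pi * \<i>) * (qlog (q * z) q - qlog (q / z) q - (1 + z) / (2 * (1 - z)))"
    and "kappa x \<tau> \<noteq> 0"
    and "crank_gf q z = sin (of_real pi * x) / (of_real pi * kappa x \<tau> * qpoch q q)"
proof -
  have q: "norm q < 1" "q \<noteq> 0" and z: "z \<noteq> 0" "z \<noteq> 1" using \<tau> z1 by (auto simp: q_def z_def norm_nome_less_1)
  have A0: "qpoch (q * z) q \<noteq> 0" and B0: "qpoch (q / z) q \<noteq> 0" and Q0: "qpoch q q \<noteq> 0"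
    using q z1 qpoch_nonzero'[OF q(1), of "q * z"] qpoch_nonzero'[OF q(1), of "q / z"] qpoch_nonzero'[OF q(1), of q]
    by (simp_all add: norm_mult norm_divide z_def)
  define U where "U = 1 / (2 * \<i>) / of_real pi / qpoch q q ^ 2"
  have kap: "kappa y \<tau> = nome (- y / 2) * (nome y - 1) * (qpoch (q * nome y) q * qpoch (q / nome y) q) * U" for y
    by (simp add: kappa_def sin_nome U_def q_def)
  have dn: "(nome has_field_derivative (2 * of_real pi * \<i> * z)) (at x)"
    unfolding nome_def z_def by (auto intro!: derivative_eq_intros)
  have dh: "((\<lambda>y. nome (- y / 2)) has_field_derivative (- (of_real pi * \<i>) * nome (- x / 2))) (at x)"
    unfolding nome_def by (auto intro!: derivative_eq_intros)
  have dA: "((\<lambda>y. qpoch (q * nome y) q) has_field_derivative (2 * of_real pi * \<i> * qlog (q * z) q * qpoch (q * z) q)) (at x)"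
  proof -
    have "((\<lambda>y. qpoch (q * nome y) q) has_field_derivative (qlog (q * z) q * qpoch (q * z) q / (q * z) * (q * (2 * of_real pi * \<i> * z)))) (at x)"
    proof -
      have "((\<lambda>x. qpoch x q) has_field_derivative (qlog (q * z) q * qpoch (q * z) q / (q * z))) (at (q * nome x))"
        using qpoch_has_field_derivative[OF q(1) A0] q z by (simp add: z_def)
      from DERIV_chain'[OF DERIV_cmult[OF dn] this] show ?thesis .
    qed
    thus ?thesis by (rule DERIV_cong) (use q z in simp)
  qed
  have dB: "((\<lambda>y. qpoch (q / nome y) q) has_field_derivative (- (2 * of_real pi * \<i> * qlog (q / z) q * qpoch (q / z) q))) (at x)"
  proof -
    have "((\<lambda>y. q / nome y) has_field_derivative (- (2 * of_real pi * \<i>) * (q / z))) (at x)"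
      by (rule DERIV_divide[OF DERIV_const dn, THEN DERIV_cong])
        (use z in \<open>auto simp: z_def field_simps\<close>)
    hence "((\<lambda>y. qpoch (q / nome y) q) has_field_derivative (qlog (q / z) q * qpoch (q / z) q / (q / z) * (- (2 * of_real pi * \<i>) * (q / z)))) (at x)"
      by (rule DERIV_chain'[where g = "\<lambda>x. qpoch x q", THEN DERIV_cong])
        (use qpoch_has_field_derivative[OF q(1) B0] q z in \<open>auto simp: z_def\<close>)
    thus ?thesis by (rule DERIV_cong) (use q z in simp)
  qed
  have dm: "((\<lambda>y. nome y - 1) has_field_derivative (2 * of_real pi * \<i> * z)) (at x)"
    using DERIV_diff[OF dn DERIV_const[of 1]] by simp
  let ?A = "qpoch (q * z) q" and ?B = "qpoch (q / z) q" and ?E = "nome (- x / 2)" and ?c = "of_real pi * \<i>"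
  have "((\<lambda>y. nome (- y / 2) * (nome y - 1) * (qpoch (q * nome y) q * qpoch (q / nome y) q) * U) has_field_derivative
     ((- ?c * ?E * (z - 1) + 2 * ?c * z * ?E) * (?A * ?B) +
      (2 * ?c * qlog (q * z) q * ?A * ?B + - (2 * ?c * qlog (q / z) q * ?B) * ?A) * (?E * (z - 1))) * U) (at x)"
    using DERIV_cmult_right[OF DERIV_mult[OF DERIV_mult[OF dh dm] DERIV_mult[OF dA dB]], of U]
    by (simp add: z_def mult.assoc)
  hence "((\<lambda>y. kappa y \<tau>) has_field_derivative
     ((- ?c * ?E * (z - 1) + 2 * ?c * z * ?E) * (?A * ?B) +
      (2 * ?c * qlog (q * z) q * ?A * ?B + - (2 * ?c * qlog (q / z) q * ?B) * ?A) * (?E * (z - 1))) * U) (at x)"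
    unfolding kap .
  hence "kappa' x \<tau> = ((- ?c * ?E * (z - 1) + 2 * ?c * z * ?E) * (?A * ?B) +
      (2 * ?c * qlog (q * z) q * ?A * ?B + - (2 * ?c * qlog (q / z) q * ?B) * ?A) * (?E * (z - 1))) * U"
    using DERIV_unique kappa_has_field_derivative[OF \<tau>] by blast
  also have "\<dots> = (?E * (z - 1) * (?A * ?B) * U) * (2 * ?c) * (qlog (q * z) q - qlog (q / z) q - (1 + z) / (2 * (1 - z)))"
  proof -
    have F: "(z - 1) * ((1 + z) / (2 * (1 - z))) = - ((1 + z) / 2)" using z by (simp add: divide_simps) (simp add: algebra_simps)
    have "E * (z - 1) * (A * B) * U * (2 * c) * (X - Y - F) =
       E * (A * B) * U * (2 * c) * ((z - 1) * (X - Y) - (z - 1) * F)" for E A B c X Y F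
      by (simp add: algebra_simps)
    hence "E * (z - 1) * (A * B) * U * (2 * c) * (X - Y - (1 + z) / (2 * (1 - z))) =
       E * (A * B) * U * (2 * c) * ((z - 1) * (X - Y) - (- ((1 + z) / 2)))" for E A B c X Y
      unfolding F[symmetric] by blast
    hence "E * (z - 1) * (A * B) * U * (2 * c) * (X - Y - (1 + z) / (2 * (1 - z))) =
       E * (A * B) * U * (2 * c) * ((z - 1) * (X - Y) + (1 + z) / 2)" for E A B c X Y
      by (simp only: diff_minus_eq_add)
    moreover have "((- c * E * (z - 1) + 2 * c * z * E) * (A * B) + (2 * c * X * A * B + - (2 * c * Y * B) * A) * (E * (z - 1))) * U
       = E * (A * B) * U * (2 * c) * ((z - 1) * (X - Y) + (1 + z) / 2)" for E A B c X Y
      by (simp add: field_simps)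
    ultimately show ?thesis by metis
  qed
  also have "?E * (z - 1) * (?A * ?B) * U = kappa x \<tau>" by (simp add: kap z_def)
  finally show "kappa' x \<tau> = kappa x \<tau> * (2 * of_real pi * \<i>) * (qlog (q * z) q - qlog (q / z) q - (1 + z) / (2 * (1 - z)))"
    by (simp add: mult.assoc)
  show K0: "kappa x \<tau> \<noteq> 0" using A0 B0 Q0 z by (simp add: kap U_def z_def)
  have s0: "sin (of_real pi * x) \<noteq> 0" using z unfolding sin_nome by (simp add: z_def)
  have "kappa x \<tau> = sin (of_real pi * x) / of_real pi * (?A * ?B) / qpoch q q ^ 2"
    by (simp add: kappa_def q_def z_def)
  thus "crank_gf q z = sin (of_real pi * x) / (of_real pi * kappa x \<tau> * qpoch q q)"
    using A0 B0 Q0 s0 K0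
    by (simp add: crank_gf_def mult.commute[of z q] power2_eq_square divide_simps) (simp add: mult_ac)
qed

text \<open>The sine arises from writing \<open>crank_gf\<close> through \<open>1 / kappa\<close>;
  being constant in \<open>\<tau>\<close>, it leaves the weight 2 of
  \<open>kappa' / kappa\<^sup>2\<close> intact.\<close>

definition weight2 :: "nat \<Rightarrow> nat \<Rightarrow> complex \<Rightarrow> complex" where
  "weight2 p u \<tau> = (\<Sum>j=1..p-1. nome (- (of_nat j * of_nat u / of_nat p)) * sin (of_real pi * (of_nat j / of_nat p))
     * kappa' (of_nat j / of_nat p) \<tau> / kappa (of_nat j / of_nat p) \<tau> ^ 2)"

definition remainder_series :: "nat \<Rightarrow> nat \<Rightarrow> complex \<Rightarrow> complex" where
  "remainder_series p u \<tau> = (\<Sum>n. remainder_coeff p u n * nome \<tau> ^ n)"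

lemma remainder_series:
  assumes p: "p > 0" and \<tau>: "Im \<tau> > 0"
  shows "(\<lambda>n. remainder_coeff p u n * nome \<tau> ^ n) sums remainder_series p u \<tau>"
    and "remainder_series p u \<tau> = weight2 p u \<tau> / (2 * of_real pi ^ 2 * \<i> * of_nat p * qpoch (nome \<tau>) (nome \<tau>))"
proof -
  define q where "q = nome \<tau>"
  let ?z = "\<lambda>j. nome (of_nat j / of_nat p)"
  let ?w = "\<lambda>j. nome (- (of_nat j * of_nat u / of_nat p))"
  have q: "norm q < 1" "q \<noteq> 0" using \<tau> by (auto simp: q_def norm_nome_less_1)
  note sums = remainder_coeff_sums[OF p q, of u]
  thus "(\<lambda>n. remainder_coeff p u n * nome \<tau> ^ n) sums remainder_series p u \<tau>"
    unfolding remainder_series_def q_def by (rule sums_summable[THEN summable_sums])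
  have "remainder_series p u \<tau> = (\<Sum>j=1..p-1. ?w j * crank_gf q (?z j) *
       (qlog (q * ?z j) q - qlog (q / ?z j) q - (1 + ?z j) / (2 * (1 - ?z j)))) / of_nat p"
    using sums_unique[OF sums] by (simp add: remainder_series_def q_def)
  also have "(\<Sum>j=1..p-1. ?w j * crank_gf q (?z j) *
       (qlog (q * ?z j) q - qlog (q / ?z j) q - (1 + ?z j) / (2 * (1 - ?z j)))) =
     (\<Sum>j=1..p-1. ?w j * sin (of_real pi * (of_nat j / of_nat p))
       * kappa' (of_nat j / of_nat p) \<tau> / kappa (of_nat j / of_nat p) \<tau> ^ 2 / (2 * of_real pi ^ 2 * \<i> * qpoch q q))"
  proof (intro sum.cong refl)
    fix j assume j: "j \<in> {1..p-1}"
    note K = kappa_log_derivative[OF \<tau> nome_frac_neq_1[OF j] norm_nome_frac, folded q_def]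
    have "w * (S / (of_real pi * k * Q)) * X = w * S * (k * (2 * of_real pi * \<i>) * X) / k ^ 2 / (2 * of_real pi ^ 2 * \<i> * Q)"
      if "k \<noteq> 0" for w S k Q X :: complex
      using that by (cases "Q = 0") (simp_all add: field_simps power2_eq_square)
    from this[OF K(2)]
    show "?w j * crank_gf q (?z j) * (qlog (q * ?z j) q - qlog (q / ?z j) q - (1 + ?z j) / (2 * (1 - ?z j))) =
      ?w j * sin (of_real pi * (of_nat j / of_nat p))
       * kappa' (of_nat j / of_nat p) \<tau> / kappa (of_nat j / of_nat p) \<tau> ^ 2 / (2 * of_real pi ^ 2 * \<i> * qpoch q q)"
      unfolding K(1) K(3) .
  qed
  also have "\<dots> = weight2 p u \<tau> / (2 * of_real pi ^ 2 * \<i> * qpoch q q)"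
    by (simp only: weight2_def sum_divide_distrib)
  finally show "remainder_series p u \<tau> = weight2 p u \<tau> / (2 * of_real pi ^ 2 * \<i> * of_nat p * qpoch (nome \<tau>) (nome \<tau>))"
    by (simp add: q_def mult_ac)
qed

text \<open>The two extra factors turn the denominator \<open>qpoch q q\<close> of the remainder
  series into \<open>eta_quot\<close>.\<close>

definition twisted_remainder :: "nat \<Rightarrow> nat \<Rightarrow> nat \<Rightarrow> complex \<Rightarrow> complex" where
  "twisted_remainder p s u \<tau> = nome (of_nat s * \<tau>) * qpoch (nome (of_nat p ^ 2 * \<tau>)) (nome (of_nat p ^ 2 * \<tau>)) * remainder_series p u \<tau>"

lemma nome_add_of_int [simp]: "nome (x + of_int n) = nome x"
  by (simp add: nome_add)

lemma twisted_remainder_add_int [simp]: "twisted_remainder p s u (\<tau> + of_int n) = twisted_remainder p s u \<tau>"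
proof -
  have "nome (of_nat s * (\<tau> + of_int n)) = nome (of_nat s * \<tau> + of_int (int s * n))"
    "nome (of_nat p ^ 2 * (\<tau> + of_int n)) = nome (of_nat p ^ 2 * \<tau> + of_int (int p ^ 2 * n))"
    by (simp_all add: ring_distribs)
  thus ?thesis unfolding nome_add_of_int by (simp add: twisted_remainder_def remainder_series_def)
qed

lemma sum_periodic_shift:
  fixes f :: "int \<Rightarrow> 'a::ab_group_add"
  assumes "\<And>l. f (l + int p) = f l"
  shows "(\<Sum>l<p. f (int l + b)) = (\<Sum>l<p. f (int l))"
proof -
  have step: "(\<Sum>l<p. f (int l + (b + 1))) = (\<Sum>l<p. f (int l + b))" for b
  proof -
    have "(\<Sum>l<p. f (int l + (b + 1))) + f b = (\<Sum>l<Suc p. f (int l + b))"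
      by (subst sum.lessThan_Suc_shift) (simp add: algebra_simps)
    also have "\<dots> = (\<Sum>l<p. f (int l + b)) + f b" using assms[of b] by (simp add: add.commute)
    finally show ?thesis by simp
  qed
  show ?thesis
  proof (induction b rule: int_induct[where k = 0])
    case (step1 i)
    thus ?case using step[of i] by simp
  next
    case (step2 i)
    thus ?case using step[of "i - 1"] by simp
  qed simp
qed

context
  fixes p h s :: nat
  assumes ph: "p = 2 * h + 1" and s: "6 * s = h * (h + 1)" and h: "h > 0"
begin

lemma twisted_remainder_modular:
  fixes a1 b c2 d1 :: int and \<tau> :: complex
  defines "a \<equiv> 1 + int p * a1" and "c \<equiv> int p ^ 2 * c2" and "d \<equiv> 1 + int p * d1"
  defines "J \<equiv> of_int c * \<tau> + of_int d"
  assumes \<tau>: "Im \<tau> > 0" and det: "a * d - b * c = 1"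
  shows "twisted_remainder p s u ((of_int a * \<tau> + of_int b) / J) = J ^ 2 * twisted_remainder p s u \<tau>"
proof -
  define \<tau>' where "\<tau>' = (of_int a * \<tau> + of_int b) / J"
  have p: "p > 0" "odd p" using ph by auto
  note K = kappa_modular[OF \<tau> det, folded J_def]
  have \<tau>': "Im \<tau>' > 0" using K(3) by (simp add: \<tau>'_def)
  have T: "twisted_remainder p s u t = eta_quot p s t * weight2 p u t / (2 * of_real pi ^ 2 * \<i> * of_nat p)"
    if "Im t > 0" for t
    using that p by (simp add: twisted_remainder_def eta_quot_def remainder_series(2) mult_ac)
  have W: "weight2 p u \<tau>' = J ^ 2 * weight2 p u \<tau>"
    unfolding weight2_def sum_distrib_left
  proof (intro sum.cong refl)
    fix j assume "j \<in> {1..p-1}"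
    have "kappa (of_nat j / of_nat p) \<tau>' = kappa (of_nat j / of_nat p) \<tau> / J"
      "kappa' (of_nat j / of_nat p) \<tau>' = kappa' (of_nat j / of_nat p) \<tau>"
      unfolding \<tau>'_def J_def c_def d_def
      using kappa_torsion_modular'[OF \<tau> p(2), of a d1 b c2 j] det by (simp_all add: c_def d_def)
    thus "nome (- (of_nat j * of_nat u / of_nat p)) * sin (of_real pi * (of_nat j / of_nat p)) *
        kappa' (of_nat j / of_nat p) \<tau>' / kappa (of_nat j / of_nat p) \<tau>' ^ 2 =
      J ^ 2 * (nome (- (of_nat j * of_nat u / of_nat p)) * sin (of_real pi * (of_nat j / of_nat p)) *
        kappa' (of_nat j / of_nat p) \<tau> / kappa (of_nat j / of_nat p) \<tau> ^ 2)"
      by (simp add: power_divide)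
  qed
  have E: "eta_quot p s \<tau>' = eta_quot p s \<tau>"
    unfolding \<tau>'_def J_def c_def d_def a_def
    using eta_quot_modular[OF ph s h \<tau>, of a1 d1 b c2] det by (simp add: a_def c_def d_def)
  show ?thesis using T[OF \<tau>] T[OF \<tau>'] E W by (simp add: \<tau>'_def)
qed

text \<open>A Fourier filter for the exponents \<open>n + s\<close> with \<open>n\<close> congruent
  to \<open>k\<close>; the shift by \<open>s\<close> accounts for the factor
  \<open>nome (s * \<tau>)\<close> in \<open>twisted_remainder\<close>.\<close>

definition dissected :: "nat \<Rightarrow> nat \<Rightarrow> complex \<Rightarrow> complex" where
  "dissected u k \<tau> = (\<Sum>l<p. nome (- (of_int (int l) * of_nat (k + s) / of_nat p)) * twisted_remainder p s u ((\<tau> + of_int (int l)) / of_nat p))"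

text \<open>A matrix of \<open>\<Gamma>\<^sub>1(p)\<close> sends the summand at \<open>l + b\<close>
  to the one at \<open>l\<close>, through a matrix of the smaller group with the same automorphy
  factor \<open>J\<close>. Reindexing by \<open>b\<close> produces the character.\<close>

lemma dissected_modular:
  fixes a1 b c1 d1 :: int and \<tau> :: complex
  defines "a \<equiv> 1 + int p * a1" and "c \<equiv> int p * c1" and "d \<equiv> 1 + int p * d1"
  defines "J \<equiv> of_int c * \<tau> + of_int d"
  assumes \<tau>: "Im \<tau> > 0" and det: "a * d - b * c = 1"
  shows "dissected u k ((of_int a * \<tau> + of_int b) / J) = J ^ 2 * nome (of_int b * of_nat (k + s) / of_nat p) * dissected u k \<tau>"
proof -
  define \<tau>' where "\<tau>' = (of_int a * \<tau> + of_int b) / J"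
  define P where "P = (of_nat p :: complex)"
  have p: "p > 0" "odd p" using ph by auto
  have P: "P \<noteq> 0" using p by (simp add: P_def)
  have J0: "J \<noteq> 0" using kappa_modular(2)[OF \<tau> det] by (simp add: J_def)
  have key: "twisted_remainder p s u ((\<tau>' + of_int l) / P) = J ^ 2 * twisted_remainder p s u ((\<tau> + of_int (l + b)) / P)" for l
  proof -
    define l' where "l' = l + b"
    \<comment> \<open>The matrix that takes \<open>(\<tau> + l') / p\<close> to
      \<open>(\<tau>' + l) / p\<close>. Its upper right entry is
      \<open>(b + l * d - l' * A) / p\<close>, an integer because \<open>a\<close> and
      \<open>d\<close> are 1 modulo \<open>p\<close> and \<open>l' = l + b\<close>.\<close>
    define A1 B C2 D1 where "A1 = a1 + l * c1" and "B = l * d1 - l' * a1 - l' * l * c1"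
      and "C2 = c1" and "D1 = d1 - l' * c1"
    define A C D where "A = 1 + int p * A1" and "C = int p ^ 2 * C2" and "D = 1 + int p * D1"
    have A: "A = a + l * c" and D: "D = d - l' * c" and C: "C = int p * c"
      by (simp_all add: A_def A1_def a_def c_def C_def C2_def D_def D1_def d_def power2_eq_square algebra_simps)
    have B: "int p * B = b + l * d - l' * A"
      by (simp add: B_def A a_def c_def d_def l'_def algebra_simps)
    have "A * D - B * C = A * D - (int p * B) * c" by (simp add: C)
    also have "\<dots> = a * d - b * c" unfolding B by (simp add: A D algebra_simps)
    finally have det': "A * D - B * C = 1" using det by simp
    have Im: "Im ((\<tau> + of_int l') / P) > 0" using \<tau> p by (simp add: P_def)
    have JJ: "of_int C * ((\<tau> + of_int l') / P) + of_int D = J"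
      using P by (simp add: C D J_def P_def)  (simp add: algebra_simps)
    have BC: "P * of_int B = of_int b + of_int l * of_int d - of_int l' * of_int A"
      using arg_cong[OF B, of "of_int :: int \<Rightarrow> complex"] by (simp add: P_def)
    have "(of_int A * ((\<tau> + of_int l') / P) + of_int B) / J = (\<tau>' + of_int l) / P"
    proof -
      have "(of_int A * ((\<tau> + of_int l') / P) + of_int B) = (of_int A * (\<tau> + of_int l') + P * of_int B) / P"
        using P by (simp add: field_simps)
      also have "of_int A * (\<tau> + of_int l') + P * of_int B = of_int a * \<tau> + of_int b + of_int l * J"
        unfolding BC by (simp add: A J_def algebra_simps)
      finally show ?thesis using J0 P by (simp add: \<tau>'_def field_simps)
    qed
    moreover have "twisted_remainder p s u ((of_int A * ((\<tau> + of_int l') / P) + of_int B) / J) =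
        J ^ 2 * twisted_remainder p s u ((\<tau> + of_int l') / P)"
      using twisted_remainder_modular[OF Im, of A1 D1 B C2 u] det' JJ by (simp add: A_def C_def D_def)
    ultimately show ?thesis by (simp add: l'_def)
  qed
  define f where "f = (\<lambda>l::int. nome (- (of_int l * of_nat (k + s) / P)) * twisted_remainder p s u ((\<tau> + of_int l) / P))"
  have per: "f (l + int p) = f l" for l
  proof -
    have "(\<tau> + of_int (l + int p)) / P = (\<tau> + of_int l) / P + of_int 1" using P by (simp add: P_def field_simps)
    hence "twisted_remainder p s u ((\<tau> + of_int (l + int p)) / P) = twisted_remainder p s u ((\<tau> + of_int l) / P)"
      by (simp only: twisted_remainder_add_int)
    moreover have "- (of_int (l + int p) * of_nat (k + s) / P) = - (of_int l * of_nat (k + s) / P) + of_int (- int (k + s))"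
      using P by (simp add: P_def field_simps)
    hence "nome (- (of_int (l + int p) * of_nat (k + s) / P)) = nome (- (of_int l * of_nat (k + s) / P))"
      by (simp only: nome_add_of_int)
    ultimately show ?thesis by (simp only: f_def)
  qed
  have "dissected u k \<tau>' = (\<Sum>l<p. nome (- (of_int (int l) * of_nat (k + s) / P)) * (J ^ 2 * twisted_remainder p s u ((\<tau> + of_int (int l + b)) / P)))"
    by (simp only: dissected_def P_def[symmetric] key)
  also have "\<dots> = (\<Sum>l<p. J ^ 2 * nome (of_int b * of_nat (k + s) / P) * f (int l + b))"
  proof (intro sum.cong refl)
    fix l
    have "- (of_int (int l) * of_nat (k + s) / P) = of_int b * of_nat (k + s) / P + - (of_int (int l + b) * of_nat (k + s) / P)"
      by (simp add: algebra_simps add_divide_distrib)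
    hence "nome (- (of_int (int l) * of_nat (k + s) / P)) = nome (of_int b * of_nat (k + s) / P) * nome (- (of_int (int l + b) * of_nat (k + s) / P))"
      by (simp only: nome_add)
    thus "nome (- (of_int (int l) * of_nat (k + s) / P)) * (J ^ 2 * twisted_remainder p s u ((\<tau> + of_int (int l + b)) / P)) =
        J ^ 2 * nome (of_int b * of_nat (k + s) / P) * f (int l + b)"
      by (simp only: f_def mult_ac)
  qed
  also have "\<dots> = J ^ 2 * nome (of_int b * of_nat (k + s) / P) * (\<Sum>l<p. f (int l))"
    by (simp only: sum_distrib_left[symmetric] sum_periodic_shift[of f, OF per])
  also have "(\<Sum>l<p. f (int l)) = dissected u k \<tau>"
    by (simp only: f_def dissected_def P_def)
  finally show ?thesis by (simp add: \<tau>'_def P_def)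
qed

text \<open>The Euler product in \<open>nome (p\<^sup>2 w)\<close> is the same function
  \<open>qpoch Q Q\<close> at all the points, so the sum over \<open>l\<close> acts on the remainder
  series alone. As \<open>k < p\<close>, the surviving indices are exactly the
  \<open>p * n + k\<close>.\<close>

lemma dissected_sums:
  assumes \<tau>: "Im \<tau> > 0" and k: "k < p"
  defines "Q \<equiv> nome (of_nat p * \<tau>)"
  shows "(\<lambda>n. remainder_coeff p u (p * n + k) * nome \<tau> ^ n) sums
     (dissected u k \<tau> / (of_nat p * qpoch Q Q * nome (of_nat (k + s) * \<tau> / of_nat p)))"
proof -
  define P where "P = (of_nat p :: complex)"
  have p: "p > 0" using ph by auto
  have P: "P \<noteq> 0" using p by (simp add: P_def)
  define w where "w = (\<lambda>l::nat. (\<tau> + of_int (int l)) / P)"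
  have Imw: "Im (w l) > 0" for l using \<tau> p by (simp add: w_def P_def)
  have Q1: "norm Q < 1" using \<tau> p by (simp add: Q_def norm_nome_less_1)
  have Q0: "qpoch Q Q \<noteq> 0" using qpoch_nonzero'[OF Q1 Q1] .
  have Qw: "nome (of_nat p ^ 2 * w l) = Q" for l
  proof -
    have "of_nat p ^ 2 * w l = of_nat p * \<tau> + of_int (int p * int l)"
      using P by (simp add: w_def P_def power2_eq_square field_simps)
    thus ?thesis by (simp only: nome_add_of_int Q_def)
  qed
  have "(\<lambda>n. (\<Sum>l<p. nome (- (of_int (int l) * of_nat (k + s) / P)) *
      (nome (of_nat s * w l) * qpoch Q Q * (remainder_coeff p u n * nome (w l) ^ n)))) sums dissected u k \<tau>"
  proof -
    have "twisted_remainder p s u (w l) = nome (of_nat s * w l) * qpoch Q Q * remainder_series p u (w l)" for l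
      by (simp only: twisted_remainder_def Qw)
    moreover have "(\<tau> + of_int (int l)) / P = w l" for l by (simp only: w_def)
    ultimately have "dissected u k \<tau> = (\<Sum>l<p. nome (- (of_int (int l) * of_nat (k + s) / P)) *
        (nome (of_nat s * w l) * qpoch Q Q * remainder_series p u (w l)))"
      by (simp only: dissected_def P_def[symmetric])
    thus ?thesis by (simp only:) (intro sums_sum sums_mult remainder_series(1) p Imw)
  qed
  also have "(\<lambda>n. (\<Sum>l<p. nome (- (of_int (int l) * of_nat (k + s) / P)) *
      (nome (of_nat s * w l) * qpoch Q Q * (remainder_coeff p u n * nome (w l) ^ n)))) =
      (\<lambda>n. if [int n = int k] (mod int p) then P * qpoch Q Q * remainder_coeff p u n * nome (of_nat (n + s) * \<tau> / P) else 0)"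
  proof
    fix n
    have "nome (- (of_int (int l) * of_nat (k + s) / P)) * (nome (of_nat s * w l) * qpoch Q Q * (remainder_coeff p u n * nome (w l) ^ n))
      = qpoch Q Q * remainder_coeff p u n * nome (of_nat (n + s) * \<tau> / P) * nome (of_nat l * of_int (int n - int k) / of_nat p)" for l
    proof -
      have "- (of_int (int l) * of_nat (k + s) / P) + of_nat s * w l + of_nat n * w l =
        of_nat (n + s) * \<tau> / P + of_nat l * of_int (int n - int k) / of_nat p"
        by (simp add: w_def P_def add_divide_distrib diff_divide_distrib algebra_simps)
      hence "nome (- (of_int (int l) * of_nat (k + s) / P)) * nome (of_nat s * w l) * nome (w l) ^ n =
        nome (of_nat (n + s) * \<tau> / P) * nome (of_nat l * of_int (int n - int k) / of_nat p)"
        by (simp only: nome_power nome_add[symmetric])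
      thus ?thesis by (simp add: mult_ac)
    qed
    hence "(\<Sum>l<p. nome (- (of_int (int l) * of_nat (k + s) / P)) *
      (nome (of_nat s * w l) * qpoch Q Q * (remainder_coeff p u n * nome (w l) ^ n))) =
      qpoch Q Q * remainder_coeff p u n * nome (of_nat (n + s) * \<tau> / P) * (\<Sum>l<p. nome (of_nat l * of_int (int n - int k) / of_nat p))"
      by (simp only: sum_distrib_left)
    thus "(\<Sum>l<p. nome (- (of_int (int l) * of_nat (k + s) / P)) *
      (nome (of_nat s * w l) * qpoch Q Q * (remainder_coeff p u n * nome (w l) ^ n))) =
      (if [int n = int k] (mod int p) then P * qpoch Q Q * remainder_coeff p u n * nome (of_nat (n + s) * \<tau> / P) else 0)"
      unfolding root_filter[OF p] by (simp add: cong_iff_dvd_diff P_def)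
  qed
  finally have S: "(\<lambda>n. if [int n = int k] (mod int p) then P * qpoch Q Q * remainder_coeff p u n * nome (of_nat (n + s) * \<tau> / P) else 0)
      sums dissected u k \<tau>" (is "?f sums _") .
  have "(\<lambda>n. ?f (p * n + k)) sums dissected u k \<tau>"
  proof (subst sums_mono_reindex[of "\<lambda>n. p * n + k" ?f])
    show "strict_mono (\<lambda>n. p * n + k)" using p by (simp add: strict_mono_def)
    fix n assume "n \<notin> range (\<lambda>n. p * n + k)"
    moreover have "n = p * (n div p) + n mod p" by simp
    ultimately have "n mod p \<noteq> k" by (metis rangeI)
    hence "\<not> [n = k] (mod p)" using k by (simp add: cong_def)
    thus "?f n = 0" by (simp add: cong_int_iff)
  qed (rule S)
  moreover have "?f (p * n + k) = P * qpoch Q Q * nome (of_nat (k + s) * \<tau> / P) * (remainder_coeff p u (p * n + k) * nome \<tau> ^ n)" for n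
  proof -
    have "of_nat (p * n + k + s) * \<tau> / P = of_nat (k + s) * \<tau> / P + of_nat n * \<tau>"
      using P by (simp add: P_def field_simps)
    hence "nome (of_nat (p * n + k + s) * \<tau> / P) = nome (of_nat (k + s) * \<tau> / P) * nome \<tau> ^ n"
      by (simp only: nome_add nome_power)
    moreover have "[int (p * n + k) = int k] (mod int p)" by (simp add: cong_def)
    ultimately show ?thesis by simp
  qed
  ultimately have "(\<lambda>n. P * qpoch Q Q * nome (of_nat (k + s) * \<tau> / P) * (remainder_coeff p u (p * n + k) * nome \<tau> ^ n)) sums dissected u k \<tau>"
    by simp
  from sums_divide[OF this, of "P * qpoch Q Q * nome (of_nat (k + s) * \<tau> / P)"]
  show ?thesis using P Q0 by (simp add: P_def)
qed

end

section \<open>Coefficient bounds\<close>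

lemma crank_ones_le: "crank_ones r m n \<le> n * num_partitions n"
proof -
  have "crank_ones r m n \<le> (\<Sum>\<pi>\<in>partitions n. ones \<pi>)"
    unfolding crank_ones_def by (intro sum_mono2) auto
  also have "\<dots> \<le> (\<Sum>\<pi>\<in>partitions n. n)"
    by (intro sum_mono) (use ones_le_sum in \<open>force simp: partitions_def\<close>)
  finally show ?thesis by (simp add: num_partitions_def mult.commute)
qed

text \<open>The constant 3 makes room for the correction \<open>z - 1\<close> at
  \<open>n = 1\<close>, whose norm is at most 2.\<close>

lemma norm_crank_poly_le:
  assumes "norm z = 1"
  shows "norm (crank_poly n z) \<le> 3 * real (num_partitions n)"
proof -
  have "norm (\<Sum>\<pi>\<in>partitions n. z powi crank \<pi>) \<le> (\<Sum>\<pi>\<in>partitions n. norm (z powi crank \<pi>))"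
    by (rule norm_sum)
  also have "\<dots> = real (num_partitions n)" using assms by (simp add: norm_power_int num_partitions_def)
  finally have "norm (\<Sum>\<pi>\<in>partitions n. z powi crank \<pi>) \<le> real (num_partitions n)" .
  moreover have "norm (if n = 1 then z - 1 else 0) \<le> 2 * real (num_partitions n)"
    using norm_triangle_ineq4[of z 1] assms partitions_1 by (auto simp: num_partitions_def)
  ultimately show ?thesis unfolding crank_poly_def by (intro norm_triangle_le) linarith
qed

lemma norm_crank_deviation_le:
  assumes "p > 0"
  shows "norm (of_int (crank_count_mod a p n) - of_nat (num_partitions n) / of_nat p :: complex) \<le> 3 * real (num_partitions n)"
proof -
  have "norm (\<Sum>j=1..p-1. nome (- (of_nat j * of_int a / of_nat p)) * crank_poly n (nome (of_nat j / of_nat p)))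
     \<le> (\<Sum>j=1..p-1. 3 * real (num_partitions n))"
  proof (rule sum_norm_le)
    fix j
    have "norm (nome (- (of_nat j * of_int a / of_nat p))) = 1" by (simp add: norm_nome)
    thus "norm (nome (- (of_nat j * of_int a / of_nat p)) * crank_poly n (nome (of_nat j / of_nat p))) \<le> 3 * real (num_partitions n)"
      using norm_crank_poly_le[OF norm_nome_frac] by (simp add: norm_mult)
  qed
  also have "\<dots> \<le> real p * (3 * real (num_partitions n))"
    by (simp add: mult_right_mono)
  finally show ?thesis unfolding crank_deviation_fourier[OF assms] using assms
    by (simp add: norm_divide field_simps)
qed

text \<open>Coefficients are compared with the partition numbers themselves, because the series of
  the latter is already bounded by an Euler product; no asymptotics of partition numbers are
  involved.\<close>

definition moderate_coeffs :: "(nat \<Rightarrow> complex) \<Rightarrow> real \<Rightarrow> bool" where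
  "moderate_coeffs c C \<longleftrightarrow> C \<ge> 0 \<and> (\<forall>n. norm (c n) \<le> C * (real (n + 1) * real (num_partitions n)))"

lemma moderate_coeffs_diff:
  assumes "moderate_coeffs c C" "moderate_coeffs d D"
  shows "moderate_coeffs (\<lambda>n. c n - d n) (C + D)"
  unfolding moderate_coeffs_def
proof safe
  show "C + D \<ge> 0" using assms by (simp add: moderate_coeffs_def)
  fix n
  have "norm (c n - d n) \<le> norm (c n) + norm (d n)" by (rule norm_triangle_ineq4)
  also have "\<dots> \<le> C * (real (n + 1) * real (num_partitions n)) + D * (real (n + 1) * real (num_partitions n))"
    using assms by (intro add_mono) (auto simp: moderate_coeffs_def)
  finally show "norm (c n - d n) \<le> (C + D) * (real (n + 1) * real (num_partitions n))" by (simp add: ring_distribs)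
qed

lemma moderate_coeffs_cmult:
  assumes "moderate_coeffs c C"
  shows "moderate_coeffs (\<lambda>n. a * c n) (norm a * C)"
  using assms by (auto simp: moderate_coeffs_def norm_mult mult.assoc intro!: mult_left_mono)

lemma moderate_coeffs_sum:
  assumes "\<And>i. i \<in> I \<Longrightarrow> moderate_coeffs (c i) (C i)"
  shows "moderate_coeffs (\<lambda>n. \<Sum>i\<in>I. c i n) (\<Sum>i\<in>I. C i)"
  unfolding moderate_coeffs_def sum_distrib_right
  using assms by (intro conjI allI sum_nonneg sum_norm_le) (auto simp: moderate_coeffs_def)

lemma moderate_crank_ones: "moderate_coeffs (\<lambda>n. of_nat (crank_ones r m n)) 1"
  unfolding moderate_coeffs_def
proof safe
  fix n
  have "crank_ones r m n \<le> (n + 1) * num_partitions n"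
    by (rule order_trans[OF crank_ones_le]) auto
  hence "real (crank_ones r m n) \<le> real ((n + 1) * num_partitions n)" by (rule of_nat_mono)
  thus "norm (of_nat (crank_ones r m n) :: complex) \<le> 1 * (real (n + 1) * real (num_partitions n))"
    by (simp only: norm_of_nat of_nat_mult mult_1)
qed simp

lemma moderate_crank_deviation:
  assumes "p > 0"
  shows "moderate_coeffs (\<lambda>n. of_int (crank_count_mod a p n) - of_nat (num_partitions n) / of_nat p) 3"
  unfolding moderate_coeffs_def
proof safe
  fix n
  have "norm (of_int (crank_count_mod a p n) - of_nat (num_partitions n) / of_nat p :: complex) \<le> 3 * (1 * real (num_partitions n))"
    using norm_crank_deviation_le[OF assms] by simp
  also have "\<dots> \<le> 3 * (real (n + 1) * real (num_partitions n))"
    by (intro mult_left_mono mult_right_mono) auto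
  finally show "norm (of_int (crank_count_mod a p n) - of_nat (num_partitions n) / of_nat p :: complex) \<le> \<dots>" .
qed simp

text \<open>With \<open>y = sqrt x\<close>, one factor \<open>y ^ n\<close> absorbs
  \<open>n + 1\<close> at the cost of \<open>2 / (1 - y)\<close>; the other leaves the partition
  series at \<open>y\<close>.\<close>

lemma partition_series_bound:
  fixes x :: real
  assumes x: "0 < x" "x < 1"
  shows "summable (\<lambda>n. real (n + 1) * real (num_partitions n) * x ^ n)"
    and "(\<Sum>n. real (n + 1) * real (num_partitions n) * x ^ n) \<le> 2 / (1 - sqrt x) * exp ((pi\<^sup>2 / 6) / (1 - sqrt x))"
proof -
  define y where "y = sqrt x"
  have y: "0 < y" "y < 1" using x by (auto simp: y_def)
  define g where "g = (\<lambda>\<pi>. 2 / (1 - y) * y ^ sum_mset \<pi>)"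
  have "(g has_sum (2 / (1 - y) * infsum (\<lambda>\<pi>. y ^ sum_mset \<pi>) (msets {1..}))) (msets {1..})"
    unfolding g_def using msets_power_summable(1)[OF y] by (intro has_sum_cmult_right has_sum_infsum)
  from has_sum_imp_sums[OF has_sum_partitions[OF this]]
  have S: "(\<lambda>n. \<Sum>\<pi>\<in>partitions n. g \<pi>) sums (2 / (1 - y) * infsum (\<lambda>\<pi>. y ^ sum_mset \<pi>) (msets {1..}))" .
  have geq: "(\<Sum>\<pi>\<in>partitions n. g \<pi>) = 2 / (1 - y) * (real (num_partitions n) * y ^ n)" for n
    by (simp add: g_def num_partitions_def partitions_def)
  have le: "real (n + 1) * real (num_partitions n) * x ^ n \<le> (\<Sum>\<pi>\<in>partitions n. g \<pi>)" for n
  proof -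
    have "real (n + 1) * y ^ n = real n * y ^ n + y ^ n" by (simp add: ring_distribs)
    also have "\<dots> \<le> 1 / (1 - y) + 1 / (1 - y)"
    proof (rule add_mono)
      show "real n * y ^ n \<le> 1 / (1 - y)" using y by (intro n_power_le) auto
      have "y ^ n \<le> 1" using y by (simp add: power_le_one)
      also have "1 \<le> 1 / (1 - y)" using y by (simp add: field_simps)
      finally show "y ^ n \<le> 1 / (1 - y)" .
    qed
    finally have *: "real (n + 1) * y ^ n \<le> 2 / (1 - y)" by simp
    have "x ^ n = y ^ n * y ^ n" using x by (simp add: y_def power_mult_distrib[symmetric])
    hence "real (n + 1) * real (num_partitions n) * x ^ n = (real (n + 1) * y ^ n) * (real (num_partitions n) * y ^ n)" by simp
    also have "\<dots> \<le> 2 / (1 - y) * (real (num_partitions n) * y ^ n)"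
      using * y by (intro mult_right_mono) auto
    finally show ?thesis unfolding geq .
  qed
  show summ: "summable (\<lambda>n. real (n + 1) * real (num_partitions n) * x ^ n)"
    by (rule summable_comparison_test'[OF sums_summable[OF S], of 0]) (use le x in auto)
  have "(\<Sum>n. real (n + 1) * real (num_partitions n) * x ^ n) \<le> 2 / (1 - y) * infsum (\<lambda>\<pi>. y ^ sum_mset \<pi>) (msets {1..})"
    using suminf_le[OF le summ sums_summable[OF S]] sums_unique[OF S] by simp
  also have "\<dots> \<le> 2 / (1 - y) * exp ((pi\<^sup>2 / 6) / (1 - y))"
    using msets_power_summable(2)[OF y] y by (intro mult_left_mono) auto
  finally show "(\<Sum>n. real (n + 1) * real (num_partitions n) * x ^ n) \<le> 2 / (1 - sqrt x) * exp ((pi\<^sup>2 / 6) / (1 - sqrt x))"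
    by (simp add: y_def)
qed

text \<open>Here \<open>x\<close> is the \<open>p\<close>-th root of \<open>norm q\<close>, so the
  dissected series is dominated by a subseries of the nonnegative series at \<open>x\<close>. The
  factor \<open>1 / x ^ k\<close> compensates for the offset \<open>k\<close>.\<close>

lemma moderate_coeffs_dissect:
  fixes x :: real
  assumes c: "moderate_coeffs c C" and x: "0 < x" "x < 1" and p: "p > 0" and q: "norm q = x ^ p"
  shows "summable (\<lambda>n. c (p * n + k) * q ^ n)"
    and "norm (\<Sum>n. c (p * n + k) * q ^ n) \<le> C / x ^ k * (2 / (1 - sqrt x) * exp ((pi\<^sup>2 / 6) / (1 - sqrt x)))"
proof -
  define f where "f = (\<lambda>n. real (n + 1) * real (num_partitions n) * x ^ n)"
  have C: "C \<ge> 0" using c by (simp add: moderate_coeffs_def)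
  have cb: "norm (c n) \<le> C * (real (n + 1) * real (num_partitions n))" for n
    using c unfolding moderate_coeffs_def by blast
  have f0: "f n \<ge> 0" for n using x by (simp add: f_def)
  have inj: "inj (\<lambda>n. p * n + k)" using p by (auto simp: inj_def)
  note F = partition_series_bound[OF x, folded f_def]
  have le: "norm (c (p * n + k) * q ^ n) \<le> C / x ^ k * (f \<circ> (\<lambda>n. p * n + k)) n" for n
  proof -
    have "norm (c (p * n + k) * q ^ n) \<le> C * (real (p * n + k + 1) * real (num_partitions (p * n + k))) * x ^ (p * n)"
      unfolding norm_mult norm_power q power_mult using x
      by (intro mult_right_mono cb) simp_all
    also have "\<dots> = C / x ^ k * (f \<circ> (\<lambda>n. p * n + k)) n" using x by (simp add: f_def power_add)
    finally show ?thesis .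
  qed
  have summ: "summable (f \<circ> (\<lambda>n. p * n + k))" by (rule summable_reindex[OF F(1) inj f0])
  hence summ': "summable (\<lambda>n. C / x ^ k * (f \<circ> (\<lambda>n. p * n + k)) n)" by (rule summable_mult)
  have ns: "summable (\<lambda>n. norm (c (p * n + k) * q ^ n))"
    by (rule summable_comparison_test'[OF summ', of 0]) (use le in auto)
  thus "summable (\<lambda>n. c (p * n + k) * q ^ n)" by (rule summable_norm_cancel)
  have "norm (\<Sum>n. c (p * n + k) * q ^ n) \<le> (\<Sum>n. norm (c (p * n + k) * q ^ n))"
    by (rule summable_norm[OF ns])
  also have "\<dots> \<le> (\<Sum>n. C / x ^ k * (f \<circ> (\<lambda>n. p * n + k)) n)" by (rule suminf_le[OF le ns summ'])
  also have "\<dots> = C / x ^ k * (\<Sum>n. (f \<circ> (\<lambda>n. p * n + k)) n)" by (rule suminf_mult[OF summ])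
  also have "\<dots> \<le> C / x ^ k * (\<Sum>n. f n)"
    using C x suminf_reindex_mono[OF F(1) inj f0, unfolded o_def] by (intro mult_left_mono) simp_all
  also have "\<dots> \<le> C / x ^ k * (2 / (1 - sqrt x) * exp ((pi\<^sup>2 / 6) / (1 - sqrt x)))"
    using C x F(2) by (intro mult_left_mono) auto
  finally show "norm (\<Sum>n. c (p * n + k) * q ^ n) \<le> C / x ^ k * (2 / (1 - sqrt x) * exp ((pi\<^sup>2 / 6) / (1 - sqrt x)))" .
qed

lemma moderate_coeffs_dissect_summable:
  assumes c: "moderate_coeffs c C" and p: "p > 0" and q: "norm q < 1"
  shows "summable (\<lambda>n. c (p * n + k) * q ^ n)"
proof (cases "q = 0")
  case True
  thus ?thesis using powser_sums_zero[of "\<lambda>n. c (p * n + k)"] by (auto dest: sums_summable)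
next
  case False
  define x where "x = root p (norm q)"
  have "x > 0" "x < 1" "norm q = x ^ p" using p q False by (auto simp: x_def)
  thus ?thesis using moderate_coeffs_dissect(1)[OF c _ _ p] by blast
qed

definition remainder_bound :: "nat \<Rightarrow> real" where
  "remainder_bound p = 2 + (\<Sum>r=1..p-1. norm ((of_nat p - 2 * of_nat r) / (2 * of_nat p) :: complex) * 3)"

lemma moderate_remainder_coeff:
  assumes "p > 0"
  shows "moderate_coeffs (remainder_coeff p u) (remainder_bound p)"
proof -
  have "moderate_coeffs (\<lambda>n. remainder_coeff p u n)
     ((1 + 1) + (\<Sum>r=1..p-1. norm ((of_nat p - 2 * of_nat r) / (2 * of_nat p) :: complex) * 3))"
    unfolding remainder_coeff_def
    by (intro moderate_coeffs_diff moderate_coeffs_sum moderate_coeffs_cmult moderate_crank_ones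
        moderate_crank_deviation assms)
  thus ?thesis by (simp add: remainder_bound_def)
qed

text \<open>The defining expression is a combination of several infinite sums; merging them into one
  requires the convergence of each, which the coefficient bounds provide.\<close>

lemma crank_ones_remainder_eq:
  assumes p: "p > 0" and q: "norm q < 1"
  shows "crank_ones_remainder p u k q = (\<Sum>n. remainder_coeff p u (p * n + k) * q ^ n)"
proof -
  let ?D = "\<lambda>r n. of_int (crank_count_mod (int r - int u) p n) - of_nat (num_partitions n) / of_nat p :: complex"
  let ?c = "\<lambda>r. (of_nat p - 2 * of_nat r) / (2 * of_nat p) :: complex"
  let ?W = "\<lambda>n. of_nat (crank_ones (int u) p n) - of_nat (crank_ones (int p - int u) p n) :: complex"
  have mW: "moderate_coeffs ?W (1 + 1)" by (intro moderate_coeffs_diff moderate_crank_ones)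
  have S1: "(\<lambda>n. ?W (p * n + k) * q ^ n) sums (\<Sum>n. ?W (p * n + k) * q ^ n)"
    by (intro summable_sums moderate_coeffs_dissect_summable[OF mW] p q)
  have S2: "(\<lambda>n. ?D r (p * n + k) * q ^ n) sums crank_deviation (int r - int u) p k q" for r
    unfolding crank_deviation_def
    by (intro summable_sums moderate_coeffs_dissect_summable[OF moderate_crank_deviation] p q)
  have "(\<lambda>n. ?W (p * n + k) * q ^ n - (\<Sum>r=1..p-1. ?c r * (?D r (p * n + k) * q ^ n))) sums crank_ones_remainder p u k q"
    unfolding crank_ones_remainder_def by (intro sums_diff sums_sum sums_mult S1 S2)
  also have "(\<lambda>n. ?W (p * n + k) * q ^ n - (\<Sum>r=1..p-1. ?c r * (?D r (p * n + k) * q ^ n))) =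
      (\<lambda>n. remainder_coeff p u (p * n + k) * q ^ n)"
    by (intro ext) (simp add: remainder_coeff_def sum_distrib_right left_diff_distrib mult.assoc)
  finally show ?thesis by (simp add: sums_unique)
qed

lemma crank_ones_remainder_holomorphic:
  assumes "p > 0"
  shows "crank_ones_remainder p u k holomorphic_on ball 0 1"
proof (rule power_series_holomorphic)
  fix w :: complex assume "w \<in> ball 0 1"
  hence w: "norm w < 1" by simp
  have "(\<lambda>n. remainder_coeff p u (p * n + k) * w ^ n) sums (\<Sum>n. remainder_coeff p u (p * n + k) * w ^ n)"
    by (intro summable_sums moderate_coeffs_dissect_summable[OF moderate_remainder_coeff] assms w)
  thus "(\<lambda>n. remainder_coeff p u (p * n + k) * (w - 0) ^ n) sums crank_ones_remainder p u k w"
    using crank_ones_remainder_eq[OF assms w] by simp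
qed

section \<open>Growth and behaviour at the cusps\<close>

text \<open>Euler products, their inverses and the remainder series all satisfy such a bound, and it
  is closed under products, so the growth of the whole function is found factor by factor.\<close>

definition moderate_growth :: "(complex \<Rightarrow> complex) \<Rightarrow> bool" where
  "moderate_growth f \<longleftrightarrow> (\<exists>K\<ge>0. \<forall>\<tau>. Im \<tau> > 0 \<longrightarrow> norm (f \<tau>) \<le> exp (K * (1 + Im \<tau> + 1 / Im \<tau>)))"

lemma moderate_growth_mult:
  assumes "moderate_growth f" "moderate_growth g"
  shows "moderate_growth (\<lambda>\<tau>. f \<tau> * g \<tau>)"
proof -
  obtain K L where K: "K \<ge> 0" "\<And>\<tau>. Im \<tau> > 0 \<Longrightarrow> norm (f \<tau>) \<le> exp (K * (1 + Im \<tau> + 1 / Im \<tau>))"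
    and L: "L \<ge> 0" "\<And>\<tau>. Im \<tau> > 0 \<Longrightarrow> norm (g \<tau>) \<le> exp (L * (1 + Im \<tau> + 1 / Im \<tau>))"
    using assms unfolding moderate_growth_def by blast
  have "norm (f \<tau> * g \<tau>) \<le> exp ((K + L) * (1 + Im \<tau> + 1 / Im \<tau>))" if "Im \<tau> > 0" for \<tau>
    unfolding norm_mult ring_distribs(2) exp_add
    using K(2)[OF that] L(2)[OF that] by (intro mult_mono) auto
  thus ?thesis unfolding moderate_growth_def using K(1) L(1) by (intro exI[of _ "K + L"]) auto
qed

lemma moderate_growth_power:
  assumes "moderate_growth f"
  shows "moderate_growth (\<lambda>\<tau>. f \<tau> ^ n)"
proof (induction n)
  case 0
  thus ?case unfolding moderate_growth_def by (intro exI[of _ 0]) auto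
next
  case (Suc n)
  thus ?case using moderate_growth_mult[OF assms] by simp
qed

lemma moderate_growthI:
  assumes "A \<ge> 0" "\<And>\<tau>. Im \<tau> > 0 \<Longrightarrow> norm (f \<tau>) \<le> exp (A + B * Im \<tau> + D * (1 / Im \<tau>))"
  shows "moderate_growth f"
proof -
  define K where "K = \<bar>A\<bar> + \<bar>B\<bar> + \<bar>D\<bar>"
  have "norm (f \<tau>) \<le> exp (K * (1 + Im \<tau> + 1 / Im \<tau>))" if \<tau>: "Im \<tau> > 0" for \<tau>
  proof -
    have "A \<le> K" "B \<le> K" "D \<le> K" by (auto simp: K_def)
    hence "A * 1 + B * Im \<tau> + D * (1 / Im \<tau>) \<le> K * 1 + K * Im \<tau> + K * (1 / Im \<tau>)"
      using \<tau> by (intro add_mono mult_right_mono) auto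
    thus ?thesis using assms(2)[OF \<tau>] by (simp add: ring_distribs) (meson exp_le_cancel_iff order_trans)
  qed
  moreover have "K \<ge> 0" by (simp add: K_def)
  ultimately show ?thesis unfolding moderate_growth_def by blast
qed

lemma inverse_one_minus_exp_le:
  fixes t :: real
  assumes "t > 0"
  shows "1 / (1 - exp (- t)) \<le> 1 + 1 / t"
proof -
  have "exp (- t) \<le> 1 / (1 + t)"
    using exp_ge_add_one_self[of t] assms by (simp add: exp_minus field_simps)
  hence "1 - exp (- t) \<ge> t / (1 + t)" using assms by (simp add: field_simps)
  hence "1 / (1 - exp (- t)) \<le> 1 / (t / (1 + t))" using assms by (intro divide_left_mono) auto
  thus ?thesis using assms by (simp add: field_simps)
qed

lemma norm_nome_power: "norm (nome \<tau> ^ n) = exp (- (2 * pi * real n * Im \<tau>))"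
  by (simp add: nome_power norm_nome mult_ac)

lemma moderate_growth_qpoch:
  assumes "b > 0"
  shows "moderate_growth (\<lambda>\<tau>. qpoch (nome \<tau> ^ a) (nome \<tau> ^ b))"
proof (rule moderate_growthI[where A = 1 and B = 0 and D = 1])
  fix \<tau> assume \<tau>: "Im \<tau> > 0"
  define t where "t = 2 * pi * real b * Im \<tau>"
  have t: "t > 0" using \<tau> assms by (simp add: t_def)
  have nb: "norm (nome \<tau> ^ b) = exp (- t)" by (simp add: norm_nome_power t_def)
  have "norm (nome \<tau> ^ a) \<le> 1" using \<tau> by (simp add: norm_nome_power)
  have "Im \<tau> \<le> t"
  proof -
    have "1 * Im \<tau> \<le> (2 * pi * real b) * Im \<tau>"
    proof (intro mult_right_mono)
      have "1 * 1 \<le> (2 * pi) * real b" using assms pi_gt3 by (intro mult_mono) auto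
      thus "1 \<le> 2 * pi * real b" by simp
    qed (use \<tau> in auto)
    thus ?thesis by (simp add: t_def)
  qed
  have "norm (qpoch (nome \<tau> ^ a) (nome \<tau> ^ b)) \<le> exp (norm (nome \<tau> ^ a) / (1 - norm (nome \<tau> ^ b)))"
    using t by (intro qpoch_norm_le) (simp add: nb)
  also have "norm (nome \<tau> ^ a) / (1 - norm (nome \<tau> ^ b)) \<le> 1 / (1 - norm (nome \<tau> ^ b))"
    using \<open>norm (nome \<tau> ^ a) \<le> 1\<close> t unfolding nb by (intro divide_right_mono) auto
  also have "\<dots> \<le> 1 + 1 / t" unfolding nb by (rule inverse_one_minus_exp_le[OF t])
  also have "\<dots> \<le> 1 + 1 / Im \<tau>" using \<open>Im \<tau> \<le> t\<close> \<tau> by (simp add: frac_le)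
  finally show "norm (qpoch (nome \<tau> ^ a) (nome \<tau> ^ b)) \<le> exp (1 + 0 * Im \<tau> + 1 * (1 / Im \<tau>))" by simp
qed auto

lemma moderate_growth_inverse_qpoch:
  assumes "a > 0" "b > 0"
  shows "moderate_growth (\<lambda>\<tau>. inverse (qpoch (nome \<tau> ^ a) (nome \<tau> ^ b)))"
proof (rule moderate_growthI[where A = "pi\<^sup>2 / 6" and B = 0 and D = "pi\<^sup>2 / 6"])
  fix \<tau> assume \<tau>: "Im \<tau> > 0"
  define t where "t = 2 * pi * Im \<tau>"
  have t: "t > 0" using \<tau> by (simp add: t_def)
  have "1 * Im \<tau> \<le> (2 * pi) * Im \<tau>" using \<tau> pi_gt3 by (intro mult_right_mono) auto
  hence tI: "Im \<tau> \<le> t" by (simp add: t_def)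
  have le: "norm (nome \<tau> ^ n) \<le> exp (- t)" if "n > 0" for n
  proof -
    have "t * 1 \<le> t * real n" using that t by (intro mult_left_mono) auto
    thus ?thesis by (simp add: norm_nome_power t_def mult_ac)
  qed
  have "exp (- (pi\<^sup>2 / 6) / (1 - exp (- t))) \<le> norm (qpoch (nome \<tau> ^ a) (nome \<tau> ^ b))"
    using t assms by (intro qpoch_norm_ge le) auto
  hence "norm (inverse (qpoch (nome \<tau> ^ a) (nome \<tau> ^ b))) \<le> inverse (exp (- (pi\<^sup>2 / 6) / (1 - exp (- t))))"
    unfolding norm_inverse by (intro le_imp_inverse_le) auto
  also have "\<dots> = exp (pi\<^sup>2 / 6 * (1 / (1 - exp (- t))))" by (simp add: exp_minus[symmetric])
  also have "\<dots> \<le> exp (pi\<^sup>2 / 6 * (1 + 1 / Im \<tau>))"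
  proof -
    have "1 / (1 - exp (- t)) \<le> 1 + 1 / t" by (rule inverse_one_minus_exp_le[OF t])
    also have "\<dots> \<le> 1 + 1 / Im \<tau>" using tI \<tau> by (simp add: frac_le)
    finally show ?thesis by (simp only: exp_le_cancel_iff) (intro mult_left_mono, auto)
  qed
  finally show "norm (inverse (qpoch (nome \<tau> ^ a) (nome \<tau> ^ b))) \<le> exp (pi\<^sup>2 / 6 + 0 * Im \<tau> + pi\<^sup>2 / 6 * (1 / Im \<tau>))"
    by (simp add: ring_distribs)
qed auto

lemma moderate_growth_inverse_nome: "moderate_growth (\<lambda>\<tau>. inverse (nome \<tau>))"
  by (rule moderate_growthI[where A = 0 and B = "2 * pi" and D = 0])
    (simp_all add: norm_inverse norm_nome exp_minus[symmetric])

lemma moderate_growth_remainder: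
  assumes p: "p > 0"
  shows "moderate_growth (\<lambda>\<tau>. crank_ones_remainder p u k (nome \<tau>))"
proof -
  define C where "C = remainder_bound p"
  have C: "C \<ge> 0" using moderate_remainder_coeff[OF p] by (simp add: C_def moderate_coeffs_def)
  \<comment> \<open>The exponent \<open>pi\<^sup>2 / 6\<close> comes from the partition series; the
    additional 1 absorbs the factor \<open>1 / (1 - sqrt x)\<close> into an exponential.\<close>
  define E where "E = 1 + pi\<^sup>2 / 6"
  show ?thesis
  proof (rule moderate_growthI[where A = "2 * C + E" and B = "2 * pi * real k / real p" and D = "E * real p"])
    fix \<tau> assume \<tau>: "Im \<tau> > 0"
    define x where "x = exp (- (2 * pi * Im \<tau> / real p))"
    define t where "t = pi * Im \<tau> / real p"
    have t: "t > 0" using \<tau> p by (simp add: t_def)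
    have x: "0 < x" "x < 1" using \<tau> p by (auto simp: x_def)
    have "exp (- t) ^ 2 = x" by (simp add: x_def t_def power2_eq_square flip: exp_add)
    hence sx: "sqrt x = exp (- t)" by (metis exp_ge_zero real_sqrt_unique)
    have nq: "norm (nome \<tau>) = x ^ p" using p by (simp add: x_def norm_nome flip: exp_of_nat_mult)
    hence q1: "norm (nome \<tau>) < 1" using x p by (simp add: power_less_one_iff)
    have inv: "1 / (1 - sqrt x) \<le> 1 + real p * (1 / Im \<tau>)"
    proof -
      have "1 / (1 - sqrt x) \<le> 1 + 1 / t" unfolding sx by (rule inverse_one_minus_exp_le[OF t])
      also have "1 / t = real p * (1 / (pi * Im \<tau>))" by (simp add: t_def)
      also have "1 / (pi * Im \<tau>) \<le> 1 / Im \<tau>" using \<tau> pi_gt3 by (intro divide_left_mono) auto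
      finally show ?thesis using p by (simp add: mult_left_mono)
    qed
    have "norm (crank_ones_remainder p u k (nome \<tau>)) \<le> C / x ^ k * (2 / (1 - sqrt x) * exp ((pi\<^sup>2 / 6) / (1 - sqrt x)))"
      unfolding crank_ones_remainder_eq[OF p q1] C_def
      by (rule moderate_coeffs_dissect(2)[OF moderate_remainder_coeff[OF p] x p nq])
    also have "\<dots> = (2 * C) * inverse (x ^ k) * (1 / (1 - sqrt x)) * exp (pi\<^sup>2 / 6 * (1 / (1 - sqrt x)))"
      by (simp add: field_simps)
    also have "\<dots> \<le> exp (2 * C) * exp (2 * pi * real k / real p * Im \<tau>) * exp (1 / (1 - sqrt x)) * exp (pi\<^sup>2 / 6 * (1 / (1 - sqrt x)))"
    proof (intro mult_mono)
      show "2 * C \<le> exp (2 * C)" using exp_ge_add_one_self[of "2 * C"] by linarith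
      show "inverse (x ^ k) \<le> exp (2 * pi * real k / real p * Im \<tau>)"
        by (simp add: x_def mult_ac flip: exp_of_nat_mult exp_minus)
      show "1 / (1 - sqrt x) \<le> exp (1 / (1 - sqrt x))" using exp_ge_add_one_self[of "1 / (1 - sqrt x)"] by linarith
    qed (use C x in auto)
    also have "\<dots> = exp (2 * C + 2 * pi * real k / real p * Im \<tau> + E * (1 / (1 - sqrt x)))"
    proof -
      have "E * y = y + pi\<^sup>2 / 6 * y" for y by (simp add: E_def ring_distribs)
      thus ?thesis by (simp only: exp_add mult.assoc)
    qed
    also have "\<dots> \<le> exp (2 * C + 2 * pi * real k / real p * Im \<tau> + E * (1 + real p * (1 / Im \<tau>)))"
      using mult_left_mono[OF inv, of E] by (simp add: E_def)
    also have "2 * C + 2 * pi * real k / real p * Im \<tau> + E * (1 + real p * (1 / Im \<tau>)) =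
        (2 * C + E) + 2 * pi * real k / real p * Im \<tau> + E * real p * (1 / Im \<tau>)" by (simp add: ring_distribs)
    finally show "norm (crank_ones_remainder p u k (nome \<tau>)) \<le>
        exp ((2 * C + E) + 2 * pi * real k / real p * Im \<tau> + E * real p * (1 / Im \<tau>))" .
  qed (use C in \<open>simp add: E_def\<close>)
qed

text \<open>
  A periodic function is a function of the local parameter \<open>nome (\<tau> / N)\<close>; the growth
  bound says that it has at most a pole at the origin.
\<close>

lemma meromorphic_at_infinityI:
  fixes f :: "complex \<Rightarrow> complex" and N :: nat
  assumes N: "N > 0" and hol: "f holomorphic_on upper_half_plane"
    and per: "\<And>\<tau>. Im \<tau> > 0 \<Longrightarrow> f (\<tau> + of_nat N) = f \<tau>"
    and growth: "\<And>\<tau>. Im \<tau> \<ge> 1 \<Longrightarrow> Re \<tau> \<in> {0..real N} \<Longrightarrow> norm (f \<tau>) \<le> exp (K * Im \<tau>)"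
  shows "meromorphic_at_infinity f"
proof -
  define P where "P = (of_nat N :: complex)"
  have P: "P \<noteq> 0" using N by (simp add: P_def)
  have per_int: "f (\<tau> + of_int n * P) = f \<tau>" if \<tau>: "Im \<tau> > 0" for \<tau> and n :: int
  proof (induction n rule: int_induct[where k = 0])
    case (step1 i)
    have "f (\<tau> + of_int (i + 1) * P) = f ((\<tau> + of_int i * P) + of_nat N)" by (simp add: P_def algebra_simps)
    also have "\<dots> = f (\<tau> + of_int i * P)" by (rule per) (use \<tau> in \<open>simp add: P_def\<close>)
    finally show ?case using step1 by simp
  next
    case (step2 i)
    have "f (\<tau> + of_int i * P) = f ((\<tau> + of_int (i - 1) * P) + of_nat N)" by (simp add: P_def algebra_simps)
    also have "\<dots> = f (\<tau> + of_int (i - 1) * P)" by (rule per) (use \<tau> in \<open>simp add: P_def\<close>)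
    finally show ?case using step2 by simp
  qed auto
  have growth': "norm (f \<tau>) \<le> exp (K * Im \<tau>)" if \<tau>: "Im \<tau> \<ge> 1" for \<tau>
  proof -
    define n where "n = \<lfloor>Re \<tau> / real N\<rfloor>"
    have "Re (\<tau> + of_int (- n) * P) = real N * frac (Re \<tau> / real N)"
      using N by (simp add: P_def n_def frac_def field_simps)
    moreover have "real N * frac (Re \<tau> / real N) \<le> real N * 1"
      by (intro mult_left_mono) (auto simp: less_imp_le[OF frac_lt_1])
    ultimately have "Re (\<tau> + of_int (- n) * P) \<in> {0..real N}" by simp
    from growth[OF _ this] show ?thesis using \<tau> per_int[of \<tau> "- n"] by (simp add: P_def)
  qed
  define c where "c = 2 * of_real pi * \<i>"
  have c: "c \<noteq> 0" by (simp add: c_def)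
  have feq: "f \<tau> = f \<tau>'" if "nome (\<tau> / P) = nome (\<tau>' / P)" "Im \<tau> > 0" for \<tau> \<tau>'
  proof -
    have "nome (\<tau> / P - \<tau>' / P) = 1" using that by (simp add: nome_diff)
    then obtain n :: int where "\<tau> / P - \<tau>' / P = of_int n" unfolding nome_eq_1_iff by (auto elim: Ints_cases)
    hence "\<tau>' = \<tau> + of_int (- n) * P" using P by (simp add: field_simps)
    thus ?thesis using per_int[OF that(2), of "- n"] by simp
  qed
  \<comment> \<open>The argument inverts \<open>w = nome (\<tau> / P)\<close>. Another branch of the
    logarithm changes it by a multiple of the period of \<open>f\<close>, so \<open>g\<close> does
    not see the branch cut.\<close>
  define g where "g = (\<lambda>w. f (P * Ln w / c))"
  have Im_Ln: "Im (P * v / c) > 0" if "Re v < 0" for v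
  proof -
    have "P * v / c = of_real (real N / (2 * pi)) * (- \<i> * v)" by (simp add: c_def P_def field_simps)
    hence "Im (P * v / c) = real N / (2 * pi) * (- Re v)" by simp
    thus ?thesis using that N by (auto intro!: divide_neg_pos mult_pos_neg)
  qed
  have nome_Ln: "nome (P * v / c / P) = exp v" for v using P by (simp add: nome_def c_def field_simps)
  have g_nome: "g (nome (\<tau> / P)) = f \<tau>" if "Im \<tau> > 0" for \<tau>
  proof -
    have "norm (nome (\<tau> / P)) < 1" using that N by (simp add: norm_nome P_def Im_divide_of_nat)
    hence "Re (Ln (nome (\<tau> / P))) < 0" by (simp add: Re_Ln)
    moreover have "nome (P * Ln (nome (\<tau> / P)) / c / P) = nome (\<tau> / P)" unfolding nome_Ln by simp
    ultimately show ?thesis unfolding g_def by (intro feq Im_Ln) auto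
  qed
  have g_hol: "g holomorphic_on ball 0 1 - {0}"
    unfolding holomorphic_on_def
  proof
    fix w0 :: complex assume w0: "w0 \<in> ball 0 1 - {0}"
    \<comment> \<open>Near \<open>w0\<close> the logarithm is replaced by a branch whose cut is
      rotated away from \<open>w0\<close>.\<close>
    define V where "V = (\<lambda>w. w / w0) -` (- \<real>\<^sub>\<le>\<^sub>0) \<inter> (ball 0 1 - {0})"
    have openV: "open V" unfolding V_def
      using w0 by (intro open_Int open_vimage continuous_intros open_delete) (auto simp: closed_def[symmetric])
    have wV: "w0 \<in> V" using w0 by (simp add: V_def)
    define L where "L = (\<lambda>w. Ln (w / w0) + Ln w0)"
    have expL: "exp (L w) = w" if "w \<in> V" for w using that w0 by (auto simp: L_def exp_add V_def)
    have ReL: "Re (L w) < 0" if "w \<in> V" for w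
    proof -
      have "exp (Re (L w)) = norm w" using expL[OF that] by (metis norm_exp_eq_Re)
      also have "\<dots> < 1" using that by (auto simp: V_def)
      finally show ?thesis by simp
    qed
    have "(\<lambda>w. f (P * L w / c)) holomorphic_on V"
    proof (rule holomorphic_on_compose_gen[OF _ hol, unfolded o_def])
      show "(\<lambda>w. P * L w / c) holomorphic_on V"
        unfolding L_def using c w0 by (intro holomorphic_intros) (auto simp: V_def)
      show "(\<lambda>w. P * L w / c) ` V \<subseteq> upper_half_plane"
        using Im_Ln ReL by (auto simp: upper_half_plane_def)
    qed
    moreover have "f (P * L w / c) = g w" if "w \<in> V" for w
      unfolding g_def
    proof (rule feq)
      show "nome (P * L w / c / P) = nome (P * Ln w / c / P)"
        unfolding nome_Ln using expL[OF that] that by (simp add: V_def)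
    qed (rule Im_Ln[OF ReL[OF that]])
    ultimately have "g holomorphic_on V" by (rule holomorphic_transform)
    hence "g field_differentiable at w0" using openV wV by (simp add: holomorphic_on_imp_differentiable_at)
    thus "g field_differentiable at w0 within ball 0 1 - {0}" by (rule field_differentiable_at_within)
  qed
  \<comment> \<open>Since \<open>norm w = exp (- 2 * pi * Im \<tau> / N)\<close>, this power of
    \<open>w\<close> outweighs the growth \<open>exp (K * Im \<tau>)\<close>.\<close>
  define m where "m = nat \<lceil>\<bar>K\<bar> * real N / (2 * pi)\<rceil>"
  have m: "\<bar>K\<bar> * real N / (2 * pi) \<le> real m" by (simp add: m_def)
  \<comment> \<open>The value of \<open>norm w\<close> at \<open>Im \<tau> = 1\<close>, where the
    growth hypothesis sets in.\<close>
  define \<rho> where "\<rho> = exp (- (2 * pi / real N))"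
  have \<rho>: "0 < \<rho>" "\<rho> < 1" using N by (auto simp: \<rho>_def)
  have bound: "norm (w ^ m * g w) \<le> 1" if w: "w \<noteq> 0" "norm w < \<rho>" for w
  proof -
    define \<tau> where "\<tau> = P * Ln w / c"
    have "norm w < 1" using w \<rho> by simp
    hence "Re (Ln w) < 0" using w by (simp add: Re_Ln)
    hence Im: "Im \<tau> > 0" by (simp add: \<tau>_def Im_Ln)
    have wn: "w = nome (\<tau> / P)" unfolding \<tau>_def nome_Ln using w by simp
    have nw: "norm w = exp (- (2 * pi * Im \<tau> / real N))" unfolding wn by (simp add: norm_nome P_def Im_divide_of_nat)
    hence "2 * pi / real N < 2 * pi * Im \<tau> / real N" using w by (simp add: \<rho>_def)
    hence Im1: "Im \<tau> > 1" using N by (simp add: field_simps)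
    have "norm (g w) \<le> exp (K * Im \<tau>)" using growth'[of \<tau>] Im1 g_nome[OF Im] by (simp add: wn)
    hence "norm (w ^ m * g w) \<le> norm w ^ m * exp (K * Im \<tau>)"
      unfolding norm_mult norm_power by (intro mult_left_mono) auto
    also have "\<dots> = exp ((K - real m * (2 * pi / real N)) * Im \<tau>)"
      unfolding nw by (simp add: algebra_simps flip: exp_of_nat_mult exp_add)
    also have "\<dots> \<le> exp 0"
    proof -
      have "\<bar>K\<bar> \<le> real m * (2 * pi / real N)" using m N by (simp add: field_simps)
      hence "K \<le> real m * (2 * pi / real N)" by linarith
      hence "(K - real m * (2 * pi / real N)) * Im \<tau> \<le> 0" using Im by (intro mult_nonpos_nonneg) auto
      thus ?thesis by simp
    qed
    finally show ?thesis by simp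
  qed
  \<comment> \<open>The additional factor \<open>w\<close> forces the limit 0 at the origin, so
    boundedness suffices for a continuous extension. Its price is one more negative exponent, hence
    \<open>Suc m\<close> in \<open>n0\<close>.\<close>
  define G where "G = (\<lambda>w. if w = 0 then 0 else w * (w ^ m * g w))"
  have "G holomorphic_on ball 0 \<rho>"
  proof (rule no_isolated_singularity')
    fix z :: complex assume z: "z \<in> {0}"
    have "(G \<longlongrightarrow> 0) (at 0)"
    proof (rule Lim_null_comparison[where g = norm])
      have "eventually (\<lambda>w::complex. w \<in> ball 0 \<rho>) (at 0)"
        using \<rho> by (intro eventually_at_in_open') auto
      thus "eventually (\<lambda>w. norm (G w) \<le> norm w) (at 0)"
      proof eventually_elim
        case (elim w)
        show ?case
        proof (cases "w = 0")
          case False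
          hence "norm w * norm (w ^ m * g w) \<le> norm w * 1" using bound[of w] elim by (intro mult_left_mono) auto
          thus ?thesis using False by (simp add: G_def norm_mult)
        qed (simp add: G_def)
      qed
      show "(norm \<longlongrightarrow> 0) (at (0::complex))" by (rule tendsto_norm_zero[OF tendsto_ident_at])
    qed
    thus "(G \<longlongrightarrow> G z) (at z within ball 0 \<rho>)" using z by (auto simp: G_def intro: tendsto_within_subset)
  next
    have "(\<lambda>w. w * (w ^ m * g w)) holomorphic_on ball 0 \<rho> - {0}"
      using \<rho> by (intro holomorphic_intros holomorphic_on_subset[OF g_hol]) auto
    thus "G holomorphic_on ball 0 \<rho> - {0}" by (rule holomorphic_transform) (auto simp: G_def)
  qed auto
  note Ghol = this
  define a where "a = (\<lambda>n. (deriv ^^ n) G 0 / fact n)"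
  have S: "(\<lambda>n. a n * w ^ n) sums G w" if "norm w < \<rho>" for w
    using holomorphic_power_series[OF Ghol, of w] that by (simp add: a_def)
  define n0 where "n0 = - int (Suc m)"
  show ?thesis
    unfolding meromorphic_at_infinity_def
  proof (rule exI[of _ N], intro conjI N exI[of _ n0] exI[of _ "\<lambda>n. a (nat (n - n0))"] exI[of _ 1] allI impI)
    fix \<tau> :: complex assume "Im \<tau> > 1 \<and> Im \<tau> > 0"
    hence Im: "Im \<tau> > 1" "Im \<tau> > 0" by auto
    define w where "w = nome (\<tau> / P)"
    have w0: "w \<noteq> 0" by (simp add: w_def)
    have nw: "norm w = exp (- (2 * pi * Im \<tau> / real N))" unfolding w_def by (simp add: norm_nome P_def Im_divide_of_nat)
    have w\<rho>: "norm w < \<rho>" unfolding nw \<rho>_def using Im N by (simp add: field_simps)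
    obtain r where r: "norm w < r" "r < \<rho>" using dense[OF w\<rho>] by blast
    have "norm (of_real r :: complex) = r" using r by (smt (verit) norm_ge_zero norm_of_real)
    hence "summable (\<lambda>n. norm (a n * w ^ n))"
      using r by (intro powser_insidea[OF sums_summable[OF S[of "of_real r"]]]) auto
    hence "((\<lambda>n. a n * w ^ n) has_sum G w) UNIV" using S[OF w\<rho>] by (rule norm_summable_imp_has_sum)
    hence "((\<lambda>n. a n * w ^ n * w powi n0) has_sum (G w * w powi n0)) UNIV" by (rule has_sum_cmult_left)
    also have "G w * w powi n0 = f \<tau>"
    proof -
      have "G w = w ^ Suc m * f \<tau>" using w0 g_nome[OF Im(2)] by (simp add: G_def w_def)
      moreover have "w powi n0 = inverse (w ^ Suc m)" by (simp only: n0_def power_int_minus power_int_of_nat)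
      ultimately have "G w * w powi n0 = (w ^ Suc m * inverse (w ^ Suc m)) * f \<tau>" by (simp only: mult_ac)
      thus ?thesis using w0 by (simp del: power_Suc)
    qed
    finally have H: "((\<lambda>n. a n * w ^ n * w powi n0) has_sum f \<tau>) UNIV" .
    have "((\<lambda>n. a (nat (n - n0)) * w powi n) has_sum f \<tau>) {n0..} = ((\<lambda>n. a n * w ^ n * w powi n0) has_sum f \<tau>) UNIV"
      by (rule has_sum_reindex_bij_witness[of _ "\<lambda>n. int n + n0" "\<lambda>n. nat (n - n0)"])
        (use w0 in \<open>auto simp: mult.assoc simp flip: power_int_of_nat power_int_add\<close>)
    hence "((\<lambda>n. a (nat (n - n0)) * w powi n) has_sum f \<tau>) {n0..}" using H by simp
    thus "((\<lambda>n. a (nat (n - n0)) * nome (of_int n * \<tau> / of_nat N)) has_sum f \<tau>) {n0..}"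
      by (simp add: w_def nome_powi P_def)
  qed
qed

section \<open>The modular function\<close>

text \<open>Here \<open>s\<close> stands for the \<open>s_p\<close> of the theorem and
  \<open>u\<close> for the residue that the theorem calls \<open>s\<close>.\<close>

definition modular_remainder :: "nat \<Rightarrow> nat \<Rightarrow> nat \<Rightarrow> nat \<Rightarrow> complex \<Rightarrow> complex" where
  "modular_remainder p s u k \<tau> = (let q = nome \<tau> in
     (qpochs [q, q ^ (p - 1)] (q ^ p)) ^ 2 / (q * (qpoch (q ^ p) (q ^ p)) ^ 3)
       * G_quot p q ^ (k + s + 1) * crank_ones_remainder p u k q)"

context
  fixes p h s u k :: nat
  assumes ph: "p = 2 * h + 1" and s: "6 * s = h * (h + 1)" and h: "h \<ge> 2" and k: "k < p"
begin

lemma p0: "p > 0" using ph by simp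

lemma half_p: "(p - 1) div 2 = h" "(p + 1) div 2 = p - h" "(p - 3) div 2 = h - 1" "(p + 3) div 2 = p - (h - 1)"
  using ph h by auto

text \<open>In this form every denominator is the inverse of \<open>nome \<tau>\<close> or of an
  Euler product with positive exponents, as \<open>h \<ge> 2\<close>. Holomorphy and growth can then
  be read off from the factors.\<close>

lemma modular_remainder_products:
  "modular_remainder p s u k \<tau> =
    (qpoch (nome \<tau> ^ 1) (nome \<tau> ^ p) * qpoch (nome \<tau> ^ (p - 1)) (nome \<tau> ^ p)) ^ 2 * inverse (nome \<tau>) *
    inverse (qpoch (nome \<tau> ^ p) (nome \<tau> ^ p)) ^ 3 *
    ((qpoch (nome \<tau> ^ h) (nome \<tau> ^ p) * qpoch (nome \<tau> ^ (p - h)) (nome \<tau> ^ p)) *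
     (inverse (qpoch (nome \<tau> ^ (h - 1)) (nome \<tau> ^ p)) * inverse (qpoch (nome \<tau> ^ (p - (h - 1))) (nome \<tau> ^ p)))) ^ (k + s + 1) *
    crank_ones_remainder p u k (nome \<tau>)"
  unfolding modular_remainder_def Let_def G_quot_def half_p qpochs_def
  by (simp add: divide_inverse power_inverse mult_ac)

lemma modular_remainder_holomorphic: "modular_remainder p s u k holomorphic_on upper_half_plane"
proof -
  have U: "open upper_half_plane" by (simp add: upper_half_plane_def open_halfspace_Im_gt)
  have n1: "norm (nome \<tau> ^ n) < 1" if "\<tau> \<in> upper_half_plane" "n > 0" for \<tau> n
    using that norm_nome_less_1[of \<tau>] by (simp add: upper_half_plane_def norm_power power_less_one_iff)
  have nome: "nome holomorphic_on upper_half_plane"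
    using nome_holomorphic[OF holomorphic_on_ident] .
  have Q: "(\<lambda>\<tau>. qpoch (nome \<tau> ^ a) (nome \<tau> ^ p)) holomorphic_on upper_half_plane" for a
    using n1 p0 by (intro holomorphic_intros nome U) auto
  have Qi: "(\<lambda>\<tau>. inverse (qpoch (nome \<tau> ^ a) (nome \<tau> ^ p))) holomorphic_on upper_half_plane" if "a > 0" for a
  proof (rule holomorphic_on_inverse[OF Q])
    fix \<tau> assume "\<tau> \<in> upper_half_plane"
    thus "qpoch (nome \<tau> ^ a) (nome \<tau> ^ p) \<noteq> 0" using n1 p0 that by (intro qpoch_nonzero') auto
  qed
  have M: "(\<lambda>\<tau>. crank_ones_remainder p u k (nome \<tau>)) holomorphic_on upper_half_plane"
    using n1[of _ 1] by (intro holomorphic_on_compose_gen[OF nome crank_ones_remainder_holomorphic[OF p0], unfolded o_def]) auto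
  have Ni: "(\<lambda>\<tau>. inverse (nome \<tau>)) holomorphic_on upper_half_plane"
    by (rule holomorphic_on_inverse[OF nome]) simp
  show ?thesis
    unfolding modular_remainder_products[abs_def]
    using h ph by (intro holomorphic_on_mult holomorphic_on_power Q Qi M Ni) auto
qed

lemma modular_remainder_growth: "moderate_growth (modular_remainder p s u k)"
  unfolding modular_remainder_products[abs_def]
  using h ph by (intro moderate_growth_mult moderate_growth_power moderate_growth_qpoch moderate_growth_inverse_qpoch
    moderate_growth_inverse_nome moderate_growth_remainder) auto

text \<open>All powers of \<open>e = nome (\<tau> / p)\<close> cancel: -1 from the squared product
  over \<open>q\<close>, \<open>k + s + 1\<close> from \<open>G_quot\<close>, and
  \<open>- (k + s)\<close> from the dissection. The Euler product \<open>W\<close> occurs with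
  exponents 4, -3 and -1.\<close>

lemma modular_remainder_klein:
  assumes \<tau>: "Im \<tau> > 0"
  shows "modular_remainder p s u k \<tau> = (2 * of_real pi * \<i>) ^ 2 / of_nat p * klein p 1 \<tau> ^ 2 *
    (klein p h \<tau> / klein p (h - 1) \<tau>) ^ (k + s + 1) * dissected p s u k \<tau>"
proof -
  define q where "q = nome \<tau>"
  define c where "c = - (2 * of_real pi * \<i> :: complex)"
  define W where "W = qpoch (q ^ p) (q ^ p)"
  define X where "X = (\<lambda>g::nat. nome (of_nat g * \<tau> / 2 - of_nat g ^ 2 * \<tau> / (2 * of_nat p)))"
  define e where "e = nome (\<tau> / of_nat p)"
  have q: "norm q < 1" "q \<noteq> 0" using \<tau> by (auto simp: q_def norm_nome_less_1)
  have qp: "norm (q ^ p) < 1" using q p0 by (simp add: norm_power power_less_one_iff)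
  have nz: "W \<noteq> 0" "c \<noteq> 0" "e \<noteq> 0" "X g \<noteq> 0" for g using qpoch_nonzero'[OF qp qp] by (simp_all add: W_def c_def e_def X_def)
  have J: "qpoch (q ^ g) (q ^ p) * qpoch (q ^ (p - g)) (q ^ p) = c * X g * W ^ 2 * klein p g \<tau>" if "0 < g" "g < p" for g
    using klein_qpoch[OF \<tau> that] by (simp add: q_def c_def X_def W_def)
  have X1: "X 1 ^ 2 = q / e"
  proof -
    have "X 1 ^ 2 = nome (of_nat 2 * (\<tau> / 2 - \<tau> / (2 * of_nat p)))" by (simp add: X_def nome_power)
    also have "of_nat 2 * (\<tau> / 2 - \<tau> / (2 * of_nat p)) = \<tau> - \<tau> / of_nat p" by (simp add: field_simps)
    finally show ?thesis by (simp add: nome_diff q_def e_def)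
  qed
  \<comment> \<open>The indices \<open>h\<close> and \<open>h - 1\<close> are adjacent and
    \<open>h\<^sup>2 - (h - 1)\<^sup>2 = p - 2\<close>, so the exponent is
    \<open>1 / 2 - (p - 2) / (2 * p) = 1 / p\<close>, the smallest fractional power in use.\<close>
  have Xh: "X h / X (h - 1) = e"
  proof -
    have h1: "of_nat (h - 1) = (of_nat h - 1 :: complex)" using h by (simp add: of_nat_diff)
    have pc: "of_nat p = (2 * of_nat h + 1 :: complex)" using ph by simp
    have pn: "of_nat p \<noteq> (0::complex)" using p0 by simp
    have "X h / X (h - 1) = nome ((of_nat h * \<tau> / 2 - of_nat h ^ 2 * \<tau> / (2 * of_nat p)) -
        (of_nat (h - 1) * \<tau> / 2 - of_nat (h - 1) ^ 2 * \<tau> / (2 * of_nat p)))"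
      by (simp only: X_def nome_diff)
    also have "(of_nat h * \<tau> / 2 - of_nat h ^ 2 * \<tau> / (2 * of_nat p)) -
        (of_nat (h - 1) * \<tau> / 2 - of_nat (h - 1) ^ 2 * \<tau> / (2 * of_nat p)) =
        (of_nat p - (2 * of_nat h - 1)) * \<tau> / (2 * of_nat p)"
      unfolding h1 using pn by (simp add: field_simps power2_eq_square)
    also have "of_nat p - (2 * of_nat h - 1) = (2 :: complex)" by (simp add: pc)
    also have "2 * \<tau> / (2 * of_nat p) = \<tau> / of_nat p" by simp
    finally show ?thesis by (simp add: e_def)
  qed
  have G: "G_quot p q = e * (klein p h \<tau> / klein p (h - 1) \<tau>)"
  proof -
    have "G_quot p q = (qpoch (q ^ h) (q ^ p) * qpoch (q ^ (p - h)) (q ^ p)) /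
        (qpoch (q ^ (h - 1)) (q ^ p) * qpoch (q ^ (p - (h - 1))) (q ^ p))"
      unfolding G_quot_def half_p by (simp add: qpochs_def)
    also have "\<dots> = (c * X h * W ^ 2 * klein p h \<tau>) / (c * X (h - 1) * W ^ 2 * klein p (h - 1) \<tau>)"
    proof -
      have "0 < h" "h < p" "0 < h - 1" "h - 1 < p" using h ph by auto
      thus ?thesis by (simp only: J)
    qed
    also have "\<dots> = X h / X (h - 1) * (klein p h \<tau> / klein p (h - 1) \<tau>)" using nz by (simp add: field_simps)
    finally show ?thesis by (simp only: Xh)
  qed
  have D: "crank_ones_remainder p u k q = dissected p s u k \<tau> / (of_nat p * W * e ^ (k + s))"
  proof -
    have "crank_ones_remainder p u k q = (\<Sum>n. remainder_coeff p u (p * n + k) * q ^ n)"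
      by (rule crank_ones_remainder_eq[OF p0 q(1)])
    also have "\<dots> = dissected p s u k \<tau> / (of_nat p * qpoch (nome (of_nat p * \<tau>)) (nome (of_nat p * \<tau>)) *
        nome (of_nat (k + s) * \<tau> / of_nat p))"
      unfolding q_def using dissected_sums[OF ph s _ \<tau> k, of u] h by (intro sums_unique[symmetric]) auto
    also have "nome (of_nat p * \<tau>) = q ^ p" by (simp add: q_def nome_power)
    also have "nome (of_nat (k + s) * \<tau> / of_nat p) = e ^ (k + s)" by (simp add: e_def nome_power)
    finally show ?thesis by (simp add: W_def)
  qed
  have J1: "qpochs [q, q ^ (p - 1)] (q ^ p) = c * X 1 * W ^ 2 * klein p 1 \<tau>"
    using J[of 1] h ph by (simp add: qpochs_def)
  have "modular_remainder p s u k \<tau> = (c * X 1 * W ^ 2 * klein p 1 \<tau>) ^ 2 / (q * W ^ 3) *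
      (e * (klein p h \<tau> / klein p (h - 1) \<tau>)) ^ (k + s + 1) * (dissected p s u k \<tau> / (of_nat p * W * e ^ (k + s)))"
    by (simp only: modular_remainder_def Let_def q_def[symmetric] J1 G D W_def[symmetric])
  also have "\<dots> = (c ^ 2 * (q / e) * W ^ 4 * klein p 1 \<tau> ^ 2) / (q * W ^ 3) *
      (e * e ^ (k + s) * (klein p h \<tau> / klein p (h - 1) \<tau>) ^ (k + s + 1)) * (dissected p s u k \<tau> / (of_nat p * W * e ^ (k + s)))"
    unfolding X1[symmetric] by (simp add: power_mult_distrib power_divide)
  also have "\<dots> = c ^ 2 / of_nat p * klein p 1 \<tau> ^ 2 *
    (klein p h \<tau> / klein p (h - 1) \<tau>) ^ (k + s + 1) * dissected p s u k \<tau>"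
    using nz q p0 by (simp add: divide_simps power4_eq_xxxx power3_eq_cube)
  finally show ?thesis by (simp add: c_def)
qed

lemma modular_remainder_modular:
  fixes a1 b c1 d1 :: int and \<tau> :: complex
  defines "a \<equiv> 1 + int p * a1" and "c \<equiv> int p * c1" and "d \<equiv> 1 + int p * d1"
  defines "J \<equiv> of_int c * \<tau> + of_int d"
  assumes \<tau>: "Im \<tau> > 0" and det: "a * d - b * c = 1"
  shows "modular_remainder p s u k ((of_int a * \<tau> + of_int b) / J) = modular_remainder p s u k \<tau>"
proof -
  define \<tau>' where "\<tau>' = (of_int a * \<tau> + of_int b) / J"
  define e where "e = nome (of_int b / of_nat p)"
  have e: "e \<noteq> 0" by (simp add: e_def)
  have J0: "J \<noteq> 0" using Im_moebius(1)[OF \<tau> det] by (simp add: J_def)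
  have \<tau>': "Im \<tau>' > 0" using Im_moebius[OF \<tau> det] \<tau> by (simp add: \<tau>'_def J_def)
  have pn: "of_nat p \<noteq> (0::complex)" using p0 by simp
  define E where "E = (\<lambda>g::nat. of_int (int g ^ 2 * a1 * b + int g * (a1 + b)) / 2 + of_nat g ^ 2 * of_int b / (2 * of_nat p) :: complex)"
  have KL: "klein p g \<tau>' = nome (E g) / J * klein p g \<tau>" for g
    using klein_modular[OF \<tau> p0, of a1 d b c1 g] det by (simp add: a_def c_def J_def \<tau>'_def E_def)
  have K1: "klein p 1 \<tau>' ^ 2 = e / J ^ 2 * klein p 1 \<tau> ^ 2"
  proof -
    have "nome (E 1) ^ 2 = nome (of_nat 2 * E 1)" by (simp add: nome_power)
    also have "of_nat 2 * E 1 = of_int b / of_nat p + of_int (a1 * b + (a1 + b))"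
      by (simp add: E_def field_simps)
    finally have "nome (E 1) ^ 2 = e" by (simp only: nome_add_of_int e_def)
    thus ?thesis unfolding KL by (simp add: power_mult_distrib power_divide)
  qed
  \<comment> \<open>Again \<open>h\<^sup>2 - (h - 1)\<^sup>2 = p - 2\<close>: the character of the
    quotient is \<open>- b / p\<close> plus half an integer that \<open>gamma_parity\<close> makes
    even.\<close>
  have Kh: "klein p h \<tau>' / klein p (h - 1) \<tau>' = inverse e * (klein p h \<tau> / klein p (h - 1) \<tau>)"
  proof -
    have "E h - E (h - 1) = of_int ((int p - 2) * a1 * b + a1 + 2 * b) / 2 - of_int b / of_nat p"
    proof -
      have h1: "of_nat (h - 1) = (of_nat h - 1 :: complex)" "int (h - 1) = int h - 1" using h by (simp_all add: of_nat_diff)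
      have "E h - E (h - 1) = ((2 * of_nat h - 1) * of_int a1 * of_int b + of_int a1 + of_int b) / 2 +
          (2 * of_nat h - 1) * of_int b / (2 * of_nat p)"
        unfolding E_def h1 using pn by (simp add: field_simps power2_eq_square)
      also have "2 * of_nat h - 1 = (of_nat p - 2 :: complex)" by (simp add: ph)
      also have "((of_nat p - 2) * of_int a1 * of_int b + of_int a1 + of_int b) / 2 + (of_nat p - 2) * of_int b / (2 * of_nat p)
          = of_int ((int p - 2) * a1 * b + a1 + 2 * b) / 2 - of_int b / (of_nat p :: complex)"
        using pn by (simp add: field_simps)
      finally show ?thesis .
    qed
    moreover have "even ((int p - 2) * a1 * b + a1 + 2 * b)"
    proof -
      have "even (a1 * (b + 1))" using gamma_parity(1)[of "int p" a1 d b c] det ph by (simp add: a_def)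
      thus ?thesis using ph by auto
    qed
    hence "nome (of_int ((int p - 2) * a1 * b + a1 + 2 * b) / 2) = 1" by (simp only: nome_half_int if_True)
    ultimately have "nome (E h) / nome (E (h - 1)) = inverse e"
      by (simp only: nome_diff[symmetric]) (simp only: nome_diff e_def inverse_eq_divide)
    thus ?thesis unfolding KL using J0 by (simp add: field_simps)
  qed
  have D: "dissected p s u k \<tau>' = J ^ 2 * e ^ (k + s) * dissected p s u k \<tau>"
  proof -
    have "dissected p s u k \<tau>' = J ^ 2 * nome (of_int b * of_nat (k + s) / of_nat p) * dissected p s u k \<tau>"
      unfolding \<tau>'_def J_def a_def c_def d_def
      using dissected_modular[OF ph s _ \<tau>, of a1 d1 b c1 u k] det h by (simp add: a_def c_def d_def)
    also have "nome (of_int b * of_nat (k + s) / of_nat p) = e ^ (k + s)"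
      by (simp add: e_def nome_power mult.commute)
    finally show ?thesis .
  qed
  show ?thesis
    unfolding \<tau>'_def[symmetric] modular_remainder_klein[OF \<tau>] modular_remainder_klein[OF \<tau>'] K1 Kh D
    using e J0 by (simp add: power_mult_distrib power_inverse field_simps)
qed

end

section \<open>The criterion for modular functions, and the conclusion\<close>

lemma mat_act_eq: "mat_act A \<tau> = (of_int (A $ 1 $ 1) * \<tau> + of_int (A $ 1 $ 2)) / (of_int (A $ 2 $ 1) * \<tau> + of_int (A $ 2 $ 2))"
  by (simp add: mat_act_def moebius_def)

lemma SL2Z_det: "A \<in> SL2Z \<Longrightarrow> A $ 1 $ 1 * A $ 2 $ 2 - A $ 1 $ 2 * A $ 2 $ 1 = 1"
  by (simp add: SL2Z_def det_2)

text \<open>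
  For fixed \<open>A\<close>, both \<open>Im (A \<tau>)\<close> and \<open>1 / Im (A \<tau>)\<close> are \<open>O(Im \<tau>)\<close> high up in a vertical
  strip, so the growth condition controls all cusps at once.
\<close>

lemma modular_function_Gamma1I:
  fixes f :: "complex \<Rightarrow> complex" and p :: nat
  assumes p: "p > 0" and hol: "f holomorphic_on upper_half_plane" and growth: "moderate_growth f"
    and inv: "\<And>a1 b c1 d1 \<tau>. Im \<tau> > 0 \<Longrightarrow> (1 + int p * a1) * (1 + int p * d1) - b * (int p * c1) = 1 \<Longrightarrow>
      f ((of_int (1 + int p * a1) * \<tau> + of_int b) / (of_int (int p * c1) * \<tau> + of_int (1 + int p * d1))) = f \<tau>"
  shows "modular_function_Gamma1 p f"
  unfolding modular_function_Gamma1_def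
proof (intro conjI ballI)
  have U: "open upper_half_plane" by (simp add: upper_half_plane_def open_halfspace_Im_gt)
  show "f nicely_meromorphic_on upper_half_plane"
    using hol U by (intro analytic_on_imp_nicely_meromorphic_on) (simp add: analytic_on_open)
next
  fix A \<tau> assume A: "A \<in> Gamma1 p" and \<tau>: "\<tau> \<in> upper_half_plane"
  have "int p dvd A $ 2 $ 1" "int p dvd A $ 1 $ 1 - 1" "int p dvd A $ 2 $ 2 - 1"
    using A by (auto simp: Gamma1_def cong_0_iff cong_iff_dvd_diff)
  then obtain c1 a1 d1 where "A $ 2 $ 1 = int p * c1" "A $ 1 $ 1 - 1 = int p * a1" "A $ 2 $ 2 - 1 = int p * d1"
    unfolding dvd_def by blast
  hence *: "A $ 2 $ 1 = int p * c1" "A $ 1 $ 1 = 1 + int p * a1" "A $ 2 $ 2 = 1 + int p * d1" by linarith+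
  have "A $ 1 $ 1 * A $ 2 $ 2 - A $ 1 $ 2 * A $ 2 $ 1 = 1" using A by (intro SL2Z_det) (simp add: Gamma1_def)
  thus "f (mat_act A \<tau>) = f \<tau>"
    unfolding mat_act_eq * using \<tau> by (intro inv) (auto simp: upper_half_plane_def)
next
  fix A assume "A \<in> SL2Z"
  define a b c d where "a = A $ 1 $ 1" and "b = A $ 1 $ 2" and "c = A $ 2 $ 1" and "d = A $ 2 $ 2"
  have det: "a * d - b * c = 1" using SL2Z_det[OF \<open>A \<in> SL2Z\<close>] by (simp add: a_def b_def c_def d_def)
  define j where "j = (\<lambda>\<tau>. of_int c * \<tau> + of_int d :: complex)"
  define t where "t = (\<lambda>\<tau>. (of_int a * \<tau> + of_int b) / j \<tau>)"
  have act: "mat_act A = t" by (simp add: fun_eq_iff mat_act_eq t_def j_def a_def b_def c_def d_def)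
  have j0: "j \<tau> \<noteq> 0" and Imt: "Im (t \<tau>) = Im \<tau> / (norm (j \<tau>))\<^sup>2" if "Im \<tau> > 0" for \<tau>
    using Im_moebius[OF that det] by (simp_all add: j_def t_def)
  have Imt_pos: "Im (t \<tau>) > 0" if "Im \<tau> > 0" for \<tau> using Imt[OF that] j0[OF that] that by simp
  obtain K where K: "K \<ge> 0" "\<And>\<tau>. Im \<tau> > 0 \<Longrightarrow> norm (f \<tau>) \<le> exp (K * (1 + Im \<tau> + 1 / Im \<tau>))"
    using growth unfolding moderate_growth_def by blast
  \<comment> \<open>In the strip, \<open>Im \<tau> \<ge> 1\<close> gives
    \<open>norm \<tau> \<le> (p + 1) * Im \<tau>\<close>; \<open>L\<close> is the resulting constant
    for the automorphy factor.\<close>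
  define L where "L = \<bar>real_of_int c\<bar> * (real p + 1) + \<bar>real_of_int d\<bar>"
  have "meromorphic_at_infinity (\<lambda>\<tau>. f (t \<tau>))"
  proof (rule meromorphic_at_infinityI[OF p, where K = "K * (2 + L\<^sup>2)"])
    have "t holomorphic_on upper_half_plane"
      unfolding t_def using j0 by (intro holomorphic_intros) (auto simp: j_def upper_half_plane_def intro!: holomorphic_intros)
    moreover have "t ` upper_half_plane \<subseteq> upper_half_plane" using Imt_pos by (auto simp: upper_half_plane_def)
    ultimately show "(\<lambda>\<tau>. f (t \<tau>)) holomorphic_on upper_half_plane"
      using holomorphic_on_compose_gen[OF _ hol, of t upper_half_plane] by (simp add: o_def)
  next
    fix \<tau> :: complex assume \<tau>: "Im \<tau> > 0"
    \<comment> \<open>The conjugate by \<open>A\<close> of the translation by \<open>p\<close> is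
      the matrix \<open>(1 - p a c, p a\<^sup>2; - p c\<^sup>2, 1 + p a c)\<close>, which lies in
      \<open>Gamma1 p\<close>. Hence \<open>p\<close> is a period at every cusp.\<close>
    define a1 b' c1 d1 where "a1 = - a * c" and "b' = a * a * int p" and "c1 = - c * c" and "d1 = a * c"
    have "f ((of_int (1 + int p * a1) * t \<tau> + of_int b') / (of_int (int p * c1) * t \<tau> + of_int (1 + int p * d1))) = f (t \<tau>)"
      by (intro inv Imt_pos[OF \<tau>]) (simp add: a1_def b'_def c1_def d1_def algebra_simps)
    moreover have "(of_int (1 + int p * a1) * t \<tau> + of_int b') / (of_int (int p * c1) * t \<tau> + of_int (1 + int p * d1)) = t (\<tau> + of_nat p)"
    proof -
      have N: "of_int (1 + int p * a1) * t \<tau> + of_int b' = (of_int a * (\<tau> + of_nat p) + of_int b) / j \<tau>"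
      proof -
        have "(of_int (1 + int p * a1) * t \<tau> + of_int b') * j \<tau> =
            of_int (1 + int p * a1) * (of_int a * \<tau> + of_int b) + of_int b' * j \<tau>"
          using j0[OF \<tau>] by (simp add: t_def field_simps)
        also have "\<dots> = of_int a * \<tau> + of_int b + of_nat p * of_int a * (of_int a * of_int d - of_int b * of_int c)"
          by (simp add: a1_def b'_def j_def algebra_simps)
        also have "\<dots> = of_int a * (\<tau> + of_nat p) + of_int b" unfolding of_int_det[OF det] by (simp add: algebra_simps)
        finally show ?thesis using j0[OF \<tau>] by (simp add: field_simps)
      qed
      have D: "of_int (int p * c1) * t \<tau> + of_int (1 + int p * d1) = j (\<tau> + of_nat p) / j \<tau>"
      proof -
        have "(of_int (int p * c1) * t \<tau> + of_int (1 + int p * d1)) * j \<tau> =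
            of_int (int p * c1) * (of_int a * \<tau> + of_int b) + of_int (1 + int p * d1) * j \<tau>"
          using j0[OF \<tau>] by (simp add: t_def field_simps)
        also have "\<dots> = j \<tau> + of_nat p * of_int c * (of_int a * of_int d - of_int b * of_int c)"
          by (simp add: c1_def d1_def j_def algebra_simps)
        also have "\<dots> = j (\<tau> + of_nat p)" unfolding of_int_det[OF det] by (simp add: j_def algebra_simps)
        finally show ?thesis using j0[OF \<tau>] by (simp add: field_simps)
      qed
      show ?thesis unfolding N D using j0[OF \<tau>] by (simp add: t_def)
    qed
    ultimately show "f (t (\<tau> + of_nat p)) = f (t \<tau>)" by simp
  next
    fix \<tau> :: complex assume \<tau>: "Im \<tau> \<ge> 1" "Re \<tau> \<in> {0..real p}"
    hence pos: "Im \<tau> > 0" by simp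
    have jL: "norm (j \<tau>) \<le> L * Im \<tau>"
    proof -
      have "norm \<tau> \<le> \<bar>Re \<tau>\<bar> + \<bar>Im \<tau>\<bar>" by (rule cmod_le)
      also have "\<dots> \<le> real p * 1 + Im \<tau>" using \<tau> by auto
      also have "\<dots> \<le> real p * Im \<tau> + Im \<tau>" using \<tau> by (intro add_right_mono mult_left_mono) auto
      finally have "norm \<tau> \<le> (real p + 1) * Im \<tau>" by (simp add: ring_distribs)
      hence "norm (j \<tau>) \<le> \<bar>real_of_int c\<bar> * ((real p + 1) * Im \<tau>) + \<bar>real_of_int d\<bar> * 1"
        unfolding j_def by (intro norm_triangle_mono) (auto simp: norm_mult intro!: mult_left_mono)
      also have "\<dots> \<le> \<bar>real_of_int c\<bar> * ((real p + 1) * Im \<tau>) + \<bar>real_of_int d\<bar> * Im \<tau>"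
        using \<tau> by (intro add_left_mono mult_left_mono) auto
      finally show ?thesis by (simp add: L_def ring_distribs mult.assoc)
    qed
    have j1: "norm (j \<tau>) \<ge> 1"
    proof (cases "c = 0")
      case True
      hence "a * d = 1" using det by simp
      hence "\<bar>d\<bar> = 1" using zmult_eq_1_iff by auto
      hence "norm (of_int d :: complex) = 1" by (simp add: norm_of_int flip: of_int_abs)
      thus ?thesis using True by (simp add: j_def)
    next
      case False
      hence "\<bar>real_of_int c\<bar> \<ge> 1" by linarith
      hence "1 * 1 \<le> \<bar>real_of_int c\<bar> * Im \<tau>" using \<tau> by (intro mult_mono) auto
      also have "\<dots> = \<bar>Im (j \<tau>)\<bar>" using pos by (simp add: j_def abs_mult)
      also have "\<dots> \<le> norm (j \<tau>)" by (rule abs_Im_le_cmod)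
      finally show ?thesis by simp
    qed
    have "1 + Im (t \<tau>) + 1 / Im (t \<tau>) \<le> Im \<tau> + Im \<tau> + L\<^sup>2 * Im \<tau>"
    proof (intro add_mono)
      show "Im (t \<tau>) \<le> Im \<tau>"
        unfolding Imt[OF pos] using j1 pos by (simp add: divide_le_eq mult_le_cancel_left1)
      have "1 / Im (t \<tau>) = (norm (j \<tau>))\<^sup>2 / Im \<tau>" unfolding Imt[OF pos] by simp
      also have "\<dots> \<le> (L * Im \<tau>)\<^sup>2 / Im \<tau>" using jL pos by (intro divide_right_mono power_mono) auto
      also have "\<dots> = L\<^sup>2 * Im \<tau>" using pos by (simp add: power2_eq_square)
      finally show "1 / Im (t \<tau>) \<le> L\<^sup>2 * Im \<tau>" .
    qed (use \<tau> in auto)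
    hence "K * (1 + Im (t \<tau>) + 1 / Im (t \<tau>)) \<le> K * (Im \<tau> + Im \<tau> + L\<^sup>2 * Im \<tau>)"
      using K(1) by (rule mult_left_mono)
    also have "\<dots> = K * (2 + L\<^sup>2) * Im \<tau>" by (simp add: algebra_simps)
    finally show "norm (f (t \<tau>)) \<le> exp (K * (2 + L\<^sup>2) * Im \<tau>)"
      using K(2)[OF Imt_pos[OF pos]] by (meson exp_le_cancel_iff order_trans)
  qed
  thus "meromorphic_at_infinity (\<lambda>\<tau>. f (mat_act A \<tau>))" by (simp add: act)
qed

theorem theorem3p7:
  fixes p s k s_p :: nat
  assumes "prime p" and "p \<ge> 5"
    and "0 < s" and "2 * s < p"
    and "k < p"
    and "s_p = (p ^ 2 - 1) div 24"
  shows "modular_function_Gamma1 p (\<lambda>\<tau>. let q = nome \<tau> in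
           (qpochs [q, q ^ (p - 1)] (q ^ p)) ^ 2 / (q * (qpoch (q ^ p) (q ^ p)) ^ 3)
             * G_quot p q ^ (k + s_p + 1)
             * crank_ones_remainder p s k q)"
proof -
  have "odd p" using assms(1,2) by (intro prime_odd_nat) auto
  then obtain h where ph: "p = 2 * h + 1" by (elim oddE) auto
  have h: "h \<ge> 2" using ph assms(2) by linarith
  \<comment> \<open>The division by 24 is exact: \<open>p\<^sup>2 - 1 = 4 * h * (h + 1)\<close>, and
    3 divides \<open>h * (h + 1)\<close> because \<open>h\<close> congruent to 1 modulo 3 would make
    3 divide \<open>p\<close>.\<close>
  have sp: "6 * s_p = h * (h + 1)"
  proof -
    have "\<not> 3 dvd p" using assms(1,2) by (auto simp: prime_nat_iff)
    hence "h mod 3 = 0 \<or> h mod 3 = 2" unfolding ph by presburger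
    hence "3 dvd h \<or> 3 dvd h + 1" by presburger
    hence "3 dvd h * (h + 1)" by (metis dvd_mult dvd_mult2)
    moreover have "2 dvd h * (h + 1)" by simp
    moreover have "6 dvd n" if "3 dvd n" "2 dvd n" for n :: nat using that by presburger
    ultimately have "6 dvd h * (h + 1)" by blast
    then obtain m where m: "h * (h + 1) = 6 * m" by (rule dvdE)
    have "p ^ 2 = 4 * (h * (h + 1)) + 1" unfolding ph by (simp add: power2_eq_square algebra_simps)
    hence "p ^ 2 - 1 = 24 * m" unfolding m by simp
    hence "s_p = m" using assms(6) by simp
    thus ?thesis using m by simp
  qed
  note hyps = ph sp h assms(5)
  have "modular_function_Gamma1 p (modular_remainder p s_p s k)"
  proof (rule modular_function_Gamma1I)
    show "p > 0" using ph by simp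
    show "modular_remainder p s_p s k holomorphic_on upper_half_plane"
      by (rule modular_remainder_holomorphic[OF hyps])
    show "moderate_growth (modular_remainder p s_p s k)"
      by (rule modular_remainder_growth[OF hyps])
  qed (rule modular_remainder_modular[OF hyps])
  thus ?thesis unfolding modular_remainder_def .
qed

end
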